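(* Let $\mathbb X$ be a virtual equipment and let $j\colon A\to E$ be a dense tight-cell in $\mathbb X$. There are isomorphisms of categories $$\mathbf{Mon}(\mathbb X[j]_{\lambda\rho})\cong\mathbf{Mon}(\mathbb X[j])\cong\mathbf{RMnd}(j)$$ commuting with the forgetful functors to $\mathbb X[A,E]$, where $\mathbb X[j]_{\lambda\rho}$ is the (ordinary) multicategory whose objects are tight-cells $A\to E$ and whose multimorphisms $f_1,\dots,f_n\to g$ are the 2-cells $E(1,j),E(j,f_1),\dots,E(j,f_n)\Rightarrow E(1,g)$, $\mathbb X[j]$ is the associative-normal left-skew-multicategory associated to $j$, and $\mathbf{RMnd}(j)$ is the category of $j$-relative monads.
   Context: Virtual equipments. A virtual double category has objects; a category of tight-cells $f\colon A\to B$ (the composite of $f\colon A\to B$ and $g\colon B\to C$ is $gf$); loose-cells $p\colon A\nrightarrow B$; and 2-cells, each having as frame a chain of loose-cells $p_1\colon A_1\nrightarrow A_0,\dots,p_n\colon A_n\nrightarrow A_{n-1}$ ($n\ge 0$; chains are always listed in this order), a loose-cell $q\colon B_n\nrightarrow B_0$, and tight-cells $f_0\colon A_0\to B_0$ (left) and $f_n\colon A_n\to B_n$ (right); 2-cells have identities and associative unital multicategory-style composition. $\phi\colon p_1,\dots,p_n\Rightarrow q$ denotes a 2-cell whose tight-cells are identities; $(\phi_1,\dots,\phi_n)$ denotes juxtaposition. A 2-cell $q_1,\dots,q_m\Rightarrow q$ is opcartesian if every 2-cell (with any tight-cells) with domain $p_1,\dots,p_l,q_1,\dots,q_m,r_1,\dots,r_n$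 factors uniquely through it; then $q$ is the loose-composite $q_1\odot\cdots\odot q_m$ (the loose-identity $A(1,1)\colon A\nrightarrow A$ if $m=0$). A unary 2-cell from $p$ to $q$ with left $f$ and right $g$ is cartesian if every 2-cell into $q$ with left $ff'$ and right $gg'$ factors uniquely through it via a 2-cell with left $f'$ and right $g'$; then $p$ is the restriction $q(f,g)$. A virtual equipment has all loose-identities and restrictions. Write $E(f,g):=E(1,1)(f,g)$; for $f\colon D\to E$, $g\colon A\to E$ it is a loose-cell $A\nrightarrow D$. The canonical isomorphisms $q(f,g)\cong C(f,1)\odot q\odot B(1,g)$ are used implicitly. A 2-cell $f\Rightarrow g$ between tight-cells $A\to B$ is equivalently a 2-cell $B(1,f)\Rightarrow B(1,g)$, or $B(g,1)\Rightarrow B(f,1)$, or $()\Rightarrow B(f,g)$; $\mathbb X[A,B]$ is the category of tight-cells $A\to B$ and such 2-cells. Restriction is functorial in 2-cells (contravariantly in the first argument, covariantly in the second). For $f\colon A\to B$, $\frown_f\colon ()\Rightarrow B(f,f)$ (corresponding to $1_f$) and $\smile_f\colon B(1,f),B(f,1)\Rightarrow B(1,1)$ are the canonical 2-cells (unit and counit of the adjunction $B(1,f)\dashv B(f,1)$). $\phi(f,g)$ denotes the 2-cell obtained from $\phi$ by restricting along $f$ on the left and $g$ on the right; e.g. $\smile_t(x,y)\colon E(x,t),E(t,y)\Rightarrow E(x,y)$ is composition. Density. A tight-cell $j\colon A\to E$ is dense if $1_j$ exhibits $1_E$ as the pointwise left extension of $j$ along $j$; explicitly, if for every chain $r_1,\dots,r_n$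 ($n\ge0$) from $E$ to $E$, the assignment sending $\phi\colon r_1,\dots,r_n\Rightarrow E(1,1)$ to $(1_{E(j,1)},\phi)\colon E(j,1),r_1,\dots,r_n\Rightarrow E(j,1)$ is a bijection. (It follows that 2-cells $r_1,\dots,r_n\Rightarrow E(g,h)$ are in bijection with 2-cells $E(j,g),r_1,\dots,r_n\Rightarrow E(j,h)$.) Relative monads. A $j$-relative monad $(t,\dagger,\eta)$ comprises a tight-cell $t\colon A\to E$, a 2-cell $\dagger\colon E(j,t)\Rightarrow E(t,t)$ and a 2-cell $\eta\colon j\Rightarrow t$ such that: (i) $E(\eta,t)\circ\dagger=1_{E(j,t)}$; (ii) $\dagger\circ E(j,\eta)\circ\frown_j=\frown_t$ as 2-cells $()\Rightarrow E(t,t)$; (iii) the following two 2-cells $E(j,t),E(j,t)\Rightarrow E(t,t)$ are equal: $(\dagger,\dagger)$ followed by $\smile_t(t,t)$; and $(1,\dagger)$ followed by $\smile_t(j,t)\colon E(j,t),E(t,t)\Rightarrow E(j,t)$ followed by $\dagger$. A morphism $(t,\dagger,\eta)\to(t',\dagger',\eta')$ is a 2-cell $\tau\colon t\Rightarrow t'$ with $\tau\circ\eta=\eta'$ and $E(t,\tau)\circ\dagger=E(\tau,t')\circ\dagger'\circ E(j,\tau)$. These form $\mathbf{RMnd}(j)$, with forgetful functor $(t,\dagger,\eta)\mapsto t$. The skew-multicategory $\mathbb X[j]$. An associative-normal left-skew-multicategory is like a multicategory without nullary multimorphisms, except that the domain of a multimorphism is a nonempty list whose entries are objects or copies of a formal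 marker $\bullet$ (composition substitutes only at object entries), equipped with left-unitor functions $\lambda_{(\vec X;Y),k}$ inserting a $\bullet$ immediately after the $k$-th entry of an $n$-entry domain ($0\le k<n$) and right-unitor functions $\rho_{(\vec X;Y),k}$ deleting a $\bullet$ occurring immediately after the $k$-th entry ($0<k\le n$), compatible with composition and with themselves, and with $\rho_k\circ\lambda_k=1$ for $0<k<n$. $\mathbb X[j]$ has as objects the tight-cells $A\to E$ (identified with $E(1,t)\colon A\nrightarrow E$). A multimorphism $x_1,\dots,x_n\to s$ is a 2-cell $p_1,E(j,1),p_2,E(j,1),\dots,E(j,1),p_n\Rightarrow E(1,s)$ where $p_i=E(1,t_i)$ if $x_i=t_i$ is a tight-cell and $p_i=E(1,j)$ if $x_i=\bullet$. Composition is that of 2-cells; $\lambda$ is given by pasting $\smile_j$, and $\rho$ by pasting $\frown_j\colon()\Rightarrow E(j,1)\odot E(1,j)$. The multicategory $\mathbb X[j]_{\lambda\rho}$. By transposition across $E(1,j)\dashv E(j,1)$, a multimorphism $f_1,\dots,f_n\to g$ ($n\ge 0$) is equivalently a 2-cell $E(j,f_1),\dots,E(j,f_n)\Rightarrow E(j,g)$; identities and composition are those of 2-cells in this latter form. As $j$ is dense, its category of unary multimorphisms is identified with $\mathbb X[A,E]$. Monoids. A monoid in an associative-normal left-skew-multicategory comprises an object $M$, a multimorphism $m\colon M,M\to M$ and a multimorphism $u\colon\bullet\to M$ such that $m\circ(u,1_M)=\lambda_{(M;M),0}(1_M)$, $\rho_{(M;M),1}(m\circ(1_M,u))=1_M$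 and $m\circ(m,1_M)=m\circ(1_M,m)$; a homomorphism is a unary multimorphism $f$ with $f\circ u=u'$ and $f\circ m=m'\circ(f,f)$. Monoids in a multicategory are as usual (with $u$ a nullary multimorphism). $\mathbf{Mon}(-)$ denotes the category of monoids, with forgetful functor sending a monoid to its carrier. *)

theory Defs
  imports Main
begin

section \<open>Categories, with hom-sets indexed by pairs of objects\<close>

record ('a, 'm) cat =
  Obj :: "'a set"
  Hom :: "'a \<Rightarrow> 'a \<Rightarrow> 'm set"
  Idn :: "'a \<Rightarrow> 'm"
  Comp :: "'a \<Rightarrow> 'a \<Rightarrow> 'a \<Rightarrow> 'm \<Rightarrow> 'm \<Rightarrow> 'm"
    \<comment> \<open>\<open>Comp a b c g f\<close> is \<open>g \<circ> f\<close> for \<open>f: a \<rightarrow> b\<close> and \<open>g: b \<rightarrow> c\<close>; hom-sets need not be disjoint\<close>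

locale category =
  fixes C :: "('a, 'm) cat"
  assumes Idn_in: "a \<in> Obj C \<Longrightarrow> Idn C a \<in> Hom C a a"
    and Comp_in: "\<lbrakk>a \<in> Obj C; b \<in> Obj C; c \<in> Obj C; f \<in> Hom C a b; g \<in> Hom C b c\<rbrakk>
      \<Longrightarrow> Comp C a b c g f \<in> Hom C a c"
    and Comp_Idn_left: "\<lbrakk>a \<in> Obj C; b \<in> Obj C; f \<in> Hom C a b\<rbrakk>
      \<Longrightarrow> Comp C a b b (Idn C b) f = f"
    and Comp_Idn_right: "\<lbrakk>a \<in> Obj C; b \<in> Obj C; f \<in> Hom C a b\<rbrakk>
      \<Longrightarrow> Comp C a a b f (Idn C a) = f"
    and Comp_assoc: "\<lbrakk>a \<in> Obj C; b \<in> Obj C; c \<in> Obj C; d \<in> Obj C;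
        f \<in> Hom C a b; g \<in> Hom C b c; h \<in> Hom C c d\<rbrakk>
      \<Longrightarrow> Comp C a c d h (Comp C a b c g f) = Comp C a b d (Comp C b c d h g) f"

record ('a, 'm, 'b, 'n) fctr =
  fob :: "'a \<Rightarrow> 'b"
  farr :: "'a \<Rightarrow> 'a \<Rightarrow> 'm \<Rightarrow> 'n"

definition is_functor :: "('a, 'm) cat \<Rightarrow> ('b, 'n) cat \<Rightarrow> ('a, 'm, 'b, 'n) fctr \<Rightarrow> bool" where
  "is_functor C D F \<longleftrightarrow> category C \<and> category D \<and>
    (\<forall>a\<in>Obj C. fob F a \<in> Obj D) \<and>
    (\<forall>a\<in>Obj C. \<forall>b\<in>Obj C. \<forall>f\<in>Hom C a b. farr F a b f \<in> Hom D (fob F a) (fob F b)) \<and>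
    (\<forall>a\<in>Obj C. farr F a a (Idn C a) = Idn D (fob F a)) \<and>
    (\<forall>a\<in>Obj C. \<forall>b\<in>Obj C. \<forall>c\<in>Obj C. \<forall>f\<in>Hom C a b. \<forall>g\<in>Hom C b c.
      farr F a c (Comp C a b c g f) =
        Comp D (fob F a) (fob F b) (fob F c) (farr F b c g) (farr F a b f))"

definition is_left_inverse ::
    "('a, 'm) cat \<Rightarrow> ('a, 'm, 'b, 'n) fctr \<Rightarrow> ('b, 'n, 'a, 'm) fctr \<Rightarrow> bool" where
  "is_left_inverse C F G \<longleftrightarrow>
    (\<forall>a\<in>Obj C. fob G (fob F a) = a) \<and>
    (\<forall>a\<in>Obj C. \<forall>b\<in>Obj C. \<forall>f\<in>Hom C a b. farr G (fob F a) (fob F b) (farr F a b f) = f)"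

definition is_isomorphism :: "('a, 'm) cat \<Rightarrow> ('b, 'n) cat \<Rightarrow> ('a, 'm, 'b, 'n) fctr \<Rightarrow> bool" where
  "is_isomorphism C D F \<longleftrightarrow> is_functor C D F \<and>
    (\<exists>G. is_functor D C G \<and> is_left_inverse C F G \<and> is_left_inverse D G F)"

definition isomorphic_over ::
    "('x, 'y) cat \<Rightarrow> ('a, 'm) cat \<Rightarrow> ('a, 'm, 'x, 'y) fctr
      \<Rightarrow> ('b, 'n) cat \<Rightarrow> ('b, 'n, 'x, 'y) fctr \<Rightarrow> bool" where
  "isomorphic_over B C U D V \<longleftrightarrow> is_functor C B U \<and> is_functor D B V \<and>
    (\<exists>F. is_isomorphism C D F \<and>
      (\<forall>a\<in>Obj C. fob V (fob F a) = fob U a) \<and>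
      (\<forall>a\<in>Obj C. \<forall>b\<in>Obj C. \<forall>f\<in>Hom C a b.
        farr V (fob F a) (fob F b) (farr F a b f) = farr U a b f))"


section \<open>Virtual double categories\<close>

text \<open>
  A loose-cell \<open>p: A -|-> B\<close> has source \<open>A\<close> and target \<open>B\<close>; in a frame, its target is drawn on the
  left and its source on the right. In \<open>ccomp X \<phi> f [\<phi>\<^sub>1, \<dots>, \<phi>\<^sub>n]\<close>, the composite of \<open>\<phi>\<close> with
  \<open>\<phi>\<^sub>1, \<dots>, \<phi>\<^sub>n\<close>, the tight-cell \<open>f\<close> is the left boundary of the juxtaposition of the \<open>\<phi>\<^sub>i\<close>. It is
  the left tight-cell of \<open>\<phi>\<^sub>1\<close> if \<open>n > 0\<close>, but is genuine data if \<open>n = 0\<close>, where the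
  (empty) juxtaposition consists of \<open>f\<close> alone.
\<close>

record ('o, 't, 'l, 'c) vdc =
  Ob :: "'o set"
  Tight :: "'t set"
  tdom :: "'t \<Rightarrow> 'o"
  tcod :: "'t \<Rightarrow> 'o"
  tid :: "'o \<Rightarrow> 't"
  tcomp :: "'t \<Rightarrow> 't \<Rightarrow> 't"
  Loose :: "'l set"
  lsrc :: "'l \<Rightarrow> 'o"
  ltgt :: "'l \<Rightarrow> 'o"
  Cell :: "'c set"
  cdom :: "'c \<Rightarrow> 'l list"
  ccod :: "'c \<Rightarrow> 'l"
  cleft :: "'c \<Rightarrow> 't"
  cright :: "'c \<Rightarrow> 't"
  cid :: "'l \<Rightarrow> 'c"
  ccomp :: "'c \<Rightarrow> 't \<Rightarrow> 'c list \<Rightarrow> 'c"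

definition tights :: "('o, 't, 'l, 'c) vdc \<Rightarrow> 'o \<Rightarrow> 'o \<Rightarrow> 't set" where
  "tights X A B = {f \<in> Tight X. tdom X f = A \<and> tcod X f = B}"

text \<open>\<open>chain X A [p\<^sub>1, \<dots>, p\<^sub>n] B\<close>: the \<open>p\<^sub>i: A\<^sub>i -|-> A\<^sub>i\<^sub>-\<^sub>1\<close> form a chain with \<open>A\<^sub>0 = A\<close> and \<open>A\<^sub>n = B\<close>.\<close>

fun chain :: "('o, 't, 'l, 'c) vdc \<Rightarrow> 'o \<Rightarrow> 'l list \<Rightarrow> 'o \<Rightarrow> bool" where
  "chain X A [] B \<longleftrightarrow> A \<in> Ob X \<and> A = B"
| "chain X A (p # ps) B \<longleftrightarrow> p \<in> Loose X \<and> ltgt X p = A \<and> chain X (lsrc X p) ps B"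

text \<open>\<open>juxt X f \<phi>s g\<close>: the \<open>\<phi>s\<close> can be juxtaposed, with left boundary \<open>f\<close> and right boundary \<open>g\<close>.\<close>

fun juxt :: "('o, 't, 'l, 'c) vdc \<Rightarrow> 't \<Rightarrow> 'c list \<Rightarrow> 't \<Rightarrow> bool" where
  "juxt X f [] g \<longleftrightarrow> f \<in> Tight X \<and> f = g"
| "juxt X f (\<phi> # \<phi>s) g \<longleftrightarrow> \<phi> \<in> Cell X \<and> cleft X \<phi> = f \<and> juxt X (cright X \<phi>) \<phi>s g"

definition composable :: "('o, 't, 'l, 'c) vdc \<Rightarrow> 'c \<Rightarrow> 't \<Rightarrow> 'c list \<Rightarrow> 't \<Rightarrow> bool" where
  "composable X \<phi> f \<phi>s g \<longleftrightarrow> \<phi> \<in> Cell X \<and> juxt X f \<phi>s g \<and>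
    map (ccod X) \<phi>s = cdom X \<phi> \<and> tcod X f = tdom X (cleft X \<phi>)"

text \<open>The componentwise composites of \<open>[\<phi>\<^sub>1, \<dots>, \<phi>\<^sub>n]\<close> with blocks \<open>[\<psi>s\<^sub>1, \<dots>, \<psi>s\<^sub>n]\<close>, the left
  boundary of the juxtaposition of all blocks being \<open>h\<close>.\<close>

fun ccomps :: "('o, 't, 'l, 'c) vdc \<Rightarrow> 'c list \<Rightarrow> 't \<Rightarrow> 'c list list \<Rightarrow> 'c list" where
  "ccomps X (\<phi> # \<phi>s) h (\<psi>s # \<psi>ss) =
     ccomp X \<phi> h \<psi>s # ccomps X \<phi>s (if \<psi>s = [] then h else cright X (last \<psi>s)) \<psi>ss"
| "ccomps X _ h _ = []"

locale virtual_double_category =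
  fixes X :: "('o, 't, 'l, 'c) vdc"
  assumes tdom_in: "f \<in> Tight X \<Longrightarrow> tdom X f \<in> Ob X"
    and tcod_in: "f \<in> Tight X \<Longrightarrow> tcod X f \<in> Ob X"
    and tid_in: "A \<in> Ob X \<Longrightarrow> tid X A \<in> tights X A A"
    and tcomp_in: "\<lbrakk>f \<in> tights X A B; g \<in> tights X B C\<rbrakk> \<Longrightarrow> tcomp X g f \<in> tights X A C"
    and tcomp_tid_left: "f \<in> tights X A B \<Longrightarrow> tcomp X (tid X B) f = f"
    and tcomp_tid_right: "f \<in> tights X A B \<Longrightarrow> tcomp X f (tid X A) = f"
    and tcomp_assoc: "\<lbrakk>f \<in> tights X A B; g \<in> tights X B C; h \<in> tights X C D\<rbrakk>
      \<Longrightarrow> tcomp X h (tcomp X g f) = tcomp X (tcomp X h g) f"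
    and lsrc_in: "p \<in> Loose X \<Longrightarrow> lsrc X p \<in> Ob X"
    and ltgt_in: "p \<in> Loose X \<Longrightarrow> ltgt X p \<in> Ob X"
    and cleft_in: "\<phi> \<in> Cell X \<Longrightarrow> cleft X \<phi> \<in> Tight X"
    and cright_in: "\<phi> \<in> Cell X \<Longrightarrow> cright X \<phi> \<in> Tight X"
    and ccod_in: "\<phi> \<in> Cell X \<Longrightarrow> ccod X \<phi> \<in> Loose X"
    and cdom_chain: "\<phi> \<in> Cell X
      \<Longrightarrow> chain X (tdom X (cleft X \<phi>)) (cdom X \<phi>) (tdom X (cright X \<phi>))"
    and tcod_cleft: "\<phi> \<in> Cell X \<Longrightarrow> tcod X (cleft X \<phi>) = ltgt X (ccod X \<phi>)"
    and tcod_cright: "\<phi> \<in> Cell X \<Longrightarrow> tcod X (cright X \<phi>) = lsrc X (ccod X \<phi>)"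
    and cid_in: "p \<in> Loose X \<Longrightarrow> cid X p \<in> Cell X"
    and cid_frame: "p \<in> Loose X \<Longrightarrow> cdom X (cid X p) = [p] \<and> ccod X (cid X p) = p \<and>
      cleft X (cid X p) = tid X (ltgt X p) \<and> cright X (cid X p) = tid X (lsrc X p)"
    and ccomp_in: "composable X \<phi> f \<phi>s g \<Longrightarrow> ccomp X \<phi> f \<phi>s \<in> Cell X"
    and ccomp_frame: "composable X \<phi> f \<phi>s g \<Longrightarrow>
      cdom X (ccomp X \<phi> f \<phi>s) = concat (map (cdom X) \<phi>s) \<and>
      ccod X (ccomp X \<phi> f \<phi>s) = ccod X \<phi> \<and>
      cleft X (ccomp X \<phi> f \<phi>s) = tcomp X (cleft X \<phi>) f \<and>
      cright X (ccomp X \<phi> f \<phi>s) = tcomp X (cright X \<phi>) g"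
    and ccomp_cid_left: "\<phi> \<in> Cell X \<Longrightarrow> ccomp X (cid X (ccod X \<phi>)) (cleft X \<phi>) [\<phi>] = \<phi>"
    and ccomp_cid_right: "\<phi> \<in> Cell X
      \<Longrightarrow> ccomp X \<phi> (tid X (tdom X (cleft X \<phi>))) (map (cid X) (cdom X \<phi>)) = \<phi>"
    and ccomp_assoc: "\<lbrakk>composable X \<chi> f \<phi>s g; map (map (ccod X)) \<psi>ss = map (cdom X) \<phi>s;
        juxt X h (concat \<psi>ss) k; tcod X h = tdom X f\<rbrakk>
      \<Longrightarrow> ccomp X (ccomp X \<chi> f \<phi>s) h (concat \<psi>ss) = ccomp X \<chi> (tcomp X f h) (ccomps X \<phi>s h \<psi>ss)"

text \<open>The 2-cells \<open>ps \<Rightarrow> q\<close> whose tight-cells are identities.\<close>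

definition cells :: "('o, 't, 'l, 'c) vdc \<Rightarrow> 'l list \<Rightarrow> 'l \<Rightarrow> 'c set" where
  "cells X ps q = {\<phi> \<in> Cell X. cdom X \<phi> = ps \<and> ccod X \<phi> = q \<and>
     cleft X \<phi> = tid X (ltgt X q) \<and> cright X \<phi> = tid X (lsrc X q)}"

text \<open>The composite of a unary 2-cell with a 2-cell.\<close>

definition vcomp :: "('o, 't, 'l, 'c) vdc \<Rightarrow> 'c \<Rightarrow> 'c \<Rightarrow> 'c" where
  "vcomp X \<psi> \<phi> = ccomp X \<psi> (cleft X \<phi>) [\<phi>]"

text \<open>The composite of \<open>\<psi>\<close> with \<open>(1, \<dots>, 1, \<phi>, 1, \<dots>, 1)\<close>.\<close>

definition paste :: "('o, 't, 'l, 'c) vdc \<Rightarrow> 'c \<Rightarrow> 'l list \<Rightarrow> 'c \<Rightarrow> 'l list \<Rightarrow> 'c" where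
  "paste X \<psi> ps \<phi> rs =
     ccomp X \<psi> (tid X (tdom X (cleft X \<psi>))) (map (cid X) ps @ [\<phi>] @ map (cid X) rs)"


section \<open>Opcartesian and cartesian 2-cells, and virtual equipments\<close>

definition is_opfactor ::
    "('o, 't, 'l, 'c) vdc \<Rightarrow> 'c \<Rightarrow> 'l list \<Rightarrow> 'c \<Rightarrow> 'l list \<Rightarrow> 'c \<Rightarrow> bool" where
  "is_opfactor X \<phi> ps \<psi> rs \<psi>' \<longleftrightarrow> \<psi>' \<in> Cell X \<and>
     cdom X \<psi>' = ps @ [ccod X \<phi>] @ rs \<and> ccod X \<psi>' = ccod X \<psi> \<and>
     cleft X \<psi>' = cleft X \<psi> \<and> cright X \<psi>' = cright X \<psi> \<and> paste X \<psi>' ps \<phi> rs = \<psi>"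

text \<open>The chain condition matters only if \<open>\<phi>\<close> is nullary: it then says that \<open>ps\<close> and \<open>rs\<close> meet at
  the object at which \<open>\<phi>\<close> lives.\<close>

definition opcartesian :: "('o, 't, 'l, 'c) vdc \<Rightarrow> 'c \<Rightarrow> bool" where
  "opcartesian X \<phi> \<longleftrightarrow> \<phi> \<in> cells X (cdom X \<phi>) (ccod X \<phi>) \<and>
     (\<forall>\<psi>\<in>Cell X. \<forall>ps rs. cdom X \<psi> = ps @ cdom X \<phi> @ rs \<longrightarrow>
        chain X (tdom X (cleft X \<psi>)) (ps @ [ccod X \<phi>] @ rs) (tdom X (cright X \<psi>)) \<longrightarrow>
        (\<exists>!\<psi>'. is_opfactor X \<phi> ps \<psi> rs \<psi>'))"

definition opfactor :: "('o, 't, 'l, 'c) vdc \<Rightarrow> 'c \<Rightarrow> 'l list \<Rightarrow> 'c \<Rightarrow> 'l list \<Rightarrow> 'c" where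
  "opfactor X \<phi> ps \<psi> rs = (THE \<psi>'. is_opfactor X \<phi> ps \<psi> rs \<psi>')"

definition is_factor :: "('o, 't, 'l, 'c) vdc \<Rightarrow> 'c \<Rightarrow> 't \<Rightarrow> 't \<Rightarrow> 'c \<Rightarrow> 'c \<Rightarrow> bool" where
  "is_factor X \<chi> f' g' \<psi> \<psi>' \<longleftrightarrow> \<psi>' \<in> Cell X \<and>
     cdom X \<psi>' = cdom X \<psi> \<and> [ccod X \<psi>'] = cdom X \<chi> \<and>
     cleft X \<psi>' = f' \<and> cright X \<psi>' = g' \<and> vcomp X \<chi> \<psi>' = \<psi>"

definition cartesian :: "('o, 't, 'l, 'c) vdc \<Rightarrow> 'c \<Rightarrow> bool" where
  "cartesian X \<chi> \<longleftrightarrow> \<chi> \<in> Cell X \<and> length (cdom X \<chi>) = 1 \<and>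
     (\<forall>\<psi>\<in>Cell X. \<forall>f'\<in>Tight X. \<forall>g'\<in>Tight X.
        tcod X f' = tdom X (cleft X \<chi>) \<longrightarrow> tcod X g' = tdom X (cright X \<chi>) \<longrightarrow>
        ccod X \<psi> = ccod X \<chi> \<longrightarrow>
        cleft X \<psi> = tcomp X (cleft X \<chi>) f' \<longrightarrow> cright X \<psi> = tcomp X (cright X \<chi>) g' \<longrightarrow>
        (\<exists>!\<psi>'. is_factor X \<chi> f' g' \<psi> \<psi>'))"

definition factor :: "('o, 't, 'l, 'c) vdc \<Rightarrow> 'c \<Rightarrow> 't \<Rightarrow> 't \<Rightarrow> 'c \<Rightarrow> 'c" where
  "factor X \<chi> f' g' \<psi> = (THE \<psi>'. is_factor X \<chi> f' g' \<psi> \<psi>')"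

definition is_lid_cell :: "('o, 't, 'l, 'c) vdc \<Rightarrow> 'o \<Rightarrow> 'c \<Rightarrow> bool" where
  "is_lid_cell X A \<upsilon> \<longleftrightarrow> opcartesian X \<upsilon> \<and> cdom X \<upsilon> = [] \<and> cleft X \<upsilon> = tid X A"

definition is_restr_cell :: "('o, 't, 'l, 'c) vdc \<Rightarrow> 'l \<Rightarrow> 't \<Rightarrow> 't \<Rightarrow> 'c \<Rightarrow> bool" where
  "is_restr_cell X q f g \<chi> \<longleftrightarrow>
     cartesian X \<chi> \<and> ccod X \<chi> = q \<and> cleft X \<chi> = f \<and> cright X \<chi> = g"

locale virtual_equipment = virtual_double_category X for X :: "('o, 't, 'l, 'c) vdc" +
  assumes loose_identities: "A \<in> Ob X \<Longrightarrow> \<exists>\<upsilon>. is_lid_cell X A \<upsilon>"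
    and restrictions: "\<lbrakk>q \<in> Loose X; f \<in> Tight X; g \<in> Tight X;
        tcod X f = ltgt X q; tcod X g = lsrc X q\<rbrakk> \<Longrightarrow> \<exists>\<chi>. is_restr_cell X q f g \<chi>"

text \<open>An arbitrary choice of loose-identities and restrictions is fixed. \<open>rep X f g\<close> is the
  loose-cell \<open>E(f,g)\<close>, and \<open>rep_cell X f g\<close> the cartesian 2-cell from \<open>E(f,g)\<close> to the
  loose-identity of \<open>E\<close>.\<close>

definition lid_cell :: "('o, 't, 'l, 'c) vdc \<Rightarrow> 'o \<Rightarrow> 'c" where
  "lid_cell X A = (SOME \<upsilon>. is_lid_cell X A \<upsilon>)"

definition lid :: "('o, 't, 'l, 'c) vdc \<Rightarrow> 'o \<Rightarrow> 'l" where
  "lid X A = ccod X (lid_cell X A)"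

definition restr_cell :: "('o, 't, 'l, 'c) vdc \<Rightarrow> 'l \<Rightarrow> 't \<Rightarrow> 't \<Rightarrow> 'c" where
  "restr_cell X q f g = (SOME \<chi>. is_restr_cell X q f g \<chi>)"

definition restr :: "('o, 't, 'l, 'c) vdc \<Rightarrow> 'l \<Rightarrow> 't \<Rightarrow> 't \<Rightarrow> 'l" where
  "restr X q f g = hd (cdom X (restr_cell X q f g))"

definition rep_cell :: "('o, 't, 'l, 'c) vdc \<Rightarrow> 't \<Rightarrow> 't \<Rightarrow> 'c" where
  "rep_cell X f g = restr_cell X (lid X (tcod X f)) f g"

definition rep :: "('o, 't, 'l, 'c) vdc \<Rightarrow> 't \<Rightarrow> 't \<Rightarrow> 'l" where
  "rep X f g = restr X (lid X (tcod X f)) f g"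

text \<open>The conjoint \<open>E(f,1)\<close> and companion \<open>E(1,f)\<close> of \<open>f: A \<rightarrow> E\<close>.\<close>

abbreviation conjoint :: "('o, 't, 'l, 'c) vdc \<Rightarrow> 't \<Rightarrow> 'l" where
  "conjoint X f \<equiv> rep X f (tid X (tcod X f))"

abbreviation companion :: "('o, 't, 'l, 'c) vdc \<Rightarrow> 't \<Rightarrow> 'l" where
  "companion X f \<equiv> rep X (tid X (tcod X f)) f"


section \<open>Canonical 2-cells in a virtual equipment\<close>

text \<open>The canonical 2-cell \<open>q, E(1,1) \<Rightarrow> q\<close>, exhibiting \<open>q \<odot> E(1,1) = q\<close>.\<close>

definition runit :: "('o, 't, 'l, 'c) vdc \<Rightarrow> 'l \<Rightarrow> 'c" where
  "runit X q = opfactor X (lid_cell X (lsrc X q)) [q] (cid X q) []"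

definition lmult :: "('o, 't, 'l, 'c) vdc \<Rightarrow> 'o \<Rightarrow> 'c" where
  "lmult X B = runit X (lid X B)"

text \<open>The unit \<open>() \<Rightarrow> E(f,f)\<close>, corresponding to the identity 2-cell on \<open>f\<close>.\<close>

definition frown :: "('o, 't, 'l, 'c) vdc \<Rightarrow> 't \<Rightarrow> 'c" where
  "frown X f = factor X (rep_cell X f f) (tid X (tdom X f)) (tid X (tdom X f))
     (ccomp X (lid_cell X (tcod X f)) f [])"

text \<open>The counit \<open>E(1,f), E(f,1) \<Rightarrow> E(1,1)\<close>, whose codomain is the loose-identity of \<open>E\<close>.\<close>

definition counit :: "('o, 't, 'l, 'c) vdc \<Rightarrow> 't \<Rightarrow> 'c" where
  "counit X f = ccomp X (lmult X (tcod X f)) (tid X (tcod X f))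
     [rep_cell X (tid X (tcod X f)) f, rep_cell X f (tid X (tcod X f))]"

text \<open>The counit of \<open>t\<close> restricted along \<open>x\<close> and \<open>y\<close>, \<open>E(x,t), E(t,y) \<Rightarrow> E(x,y)\<close>. Since the cartesian
  2-cells \<open>E(x,t) \<Rightarrow> E(1,1)\<close> and \<open>E(t,y) \<Rightarrow> E(1,1)\<close> factor through those of \<open>E(1,t)\<close> and \<open>E(t,1)\<close>, the
  2-cell that is factored through \<open>E(x,y)\<close> is the restricted chain followed by \<open>counit X t\<close>.\<close>

definition smile :: "('o, 't, 'l, 'c) vdc \<Rightarrow> 't \<Rightarrow> 't \<Rightarrow> 't \<Rightarrow> 'c" where
  "smile X t x y = factor X (rep_cell X x y) (tid X (tdom X x)) (tid X (tdom X y))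
     (ccomp X (lmult X (tcod X t)) x [rep_cell X x t, rep_cell X t y])"

text \<open>2-cells \<open>f \<Rightarrow> g\<close> between tight-cells are represented throughout by 2-cells \<open>E(1,f) \<Rightarrow> E(1,g)\<close>.
  As several tight-cells may have the same companion, \<open>f\<close> and \<open>g\<close> are passed explicitly.\<close>

definition tight_hom_cat :: "('o, 't, 'l, 'c) vdc \<Rightarrow> 'o \<Rightarrow> 'o \<Rightarrow> ('t, 'c) cat" where
  "tight_hom_cat X A B = \<lparr>
     Obj = tights X A B,
     Hom = (\<lambda>f g. cells X [companion X f] (companion X g)),
     Idn = (\<lambda>f. cid X (companion X f)),
     Comp = (\<lambda>f g h \<tau>' \<tau>. vcomp X \<tau>' \<tau>)\<rparr>"

text \<open>The universal 2-cell \<open>() \<Rightarrow> E(1,f)\<close> with left tight-cell \<open>f\<close> and right tight-cell the identity.\<close>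

definition companion_unit :: "('o, 't, 'l, 'c) vdc \<Rightarrow> 't \<Rightarrow> 'c" where
  "companion_unit X f = factor X (rep_cell X (tid X (tcod X f)) f) f (tid X (tdom X f))
     (ccomp X (lid_cell X (tcod X f)) f [])"

text \<open>The nullary form \<open>() \<Rightarrow> E(1,1)\<close> of \<open>\<tau>: f \<Rightarrow> g\<close>, with left tight-cell \<open>f\<close> and right tight-cell \<open>g\<close>;
  equivalently a 2-cell \<open>() \<Rightarrow> E(f,g)\<close>.\<close>

definition nullary :: "('o, 't, 'l, 'c) vdc \<Rightarrow> 't \<Rightarrow> 't \<Rightarrow> 'c \<Rightarrow> 'c" where
  "nullary X f g \<tau> = vcomp X (rep_cell X (tid X (tcod X g)) g) (vcomp X \<tau> (companion_unit X f))"

text \<open>For \<open>\<tau>: f \<Rightarrow> g\<close>, the 2-cells \<open>E(x,\<tau>): E(x,f) \<Rightarrow> E(x,g)\<close> and \<open>E(\<tau>,y): E(g,y) \<Rightarrow> E(f,y)\<close>.\<close>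

definition rep_right :: "('o, 't, 'l, 'c) vdc \<Rightarrow> 't \<Rightarrow> 't \<Rightarrow> 't \<Rightarrow> 'c \<Rightarrow> 'c" where
  "rep_right X x f g \<tau> = factor X (rep_cell X x g) (tid X (tdom X x)) (tid X (tdom X g))
     (ccomp X (lmult X (tcod X x)) x [rep_cell X x f, nullary X f g \<tau>])"

definition rep_left :: "('o, 't, 'l, 'c) vdc \<Rightarrow> 't \<Rightarrow> 't \<Rightarrow> 'c \<Rightarrow> 't \<Rightarrow> 'c" where
  "rep_left X f g \<tau> y = factor X (rep_cell X f y) (tid X (tdom X f)) (tid X (tdom X y))
     (ccomp X (lmult X (tcod X y)) f [nullary X f g \<tau>, rep_cell X g y])"


section \<open>Density\<close>

text \<open>\<open>(1,\<phi>): E(j,1), r\<^sub>1, \<dots>, r\<^sub>n \<Rightarrow> E(j,1), E(1,1)\<close> is regarded as a 2-cell into \<open>E(j,1)\<close> by means of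
  \<open>runit\<close>.\<close>

definition dense :: "('o, 't, 'l, 'c) vdc \<Rightarrow> 't \<Rightarrow> bool" where
  "dense X j \<longleftrightarrow>
     (\<forall>rs. chain X (tcod X j) rs (tcod X j) \<longrightarrow>
        bij_betw
          (\<lambda>\<phi>. ccomp X (runit X (conjoint X j)) (tid X (tdom X j)) [cid X (conjoint X j), \<phi>])
          (cells X rs (lid X (tcod X j)))
          (cells X (conjoint X j # rs) (conjoint X j)))"


section \<open>Relative monads\<close>

text \<open>A relative monad is a triple \<open>(t, \<dagger>, \<eta>)\<close>.\<close>

definition is_rel_monad :: "('o, 't, 'l, 'c) vdc \<Rightarrow> 't \<Rightarrow> 't \<times> 'c \<times> 'c \<Rightarrow> bool" where
  "is_rel_monad X j T \<longleftrightarrow> (case T of (t, d, \<eta>) \<Rightarrow>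
     t \<in> tights X (tdom X j) (tcod X j) \<and>
     d \<in> cells X [rep X j t] (rep X t t) \<and>
     \<eta> \<in> cells X [companion X j] (companion X t) \<and>
     vcomp X (rep_left X j t \<eta> t) d = cid X (rep X j t) \<and>
     vcomp X d (vcomp X (rep_right X j j t \<eta>) (frown X j)) = frown X t \<and>
     ccomp X (smile X t t t) (tid X (tdom X j)) [d, d] =
       vcomp X d (ccomp X (smile X t j t) (tid X (tdom X j)) [cid X (rep X j t), d]))"

definition is_rel_monad_morphism ::
    "('o, 't, 'l, 'c) vdc \<Rightarrow> 't \<Rightarrow> 't \<times> 'c \<times> 'c \<Rightarrow> 't \<times> 'c \<times> 'c \<Rightarrow> 'c \<Rightarrow> bool" where
  "is_rel_monad_morphism X j T T' \<tau> \<longleftrightarrow> (case (T, T') of ((t, d, \<eta>), (t', d', \<eta>')) \<Rightarrow>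
     \<tau> \<in> cells X [companion X t] (companion X t') \<and>
     vcomp X \<tau> \<eta> = \<eta>' \<and>
     vcomp X (rep_right X t t t' \<tau>) d =
       vcomp X (rep_left X t t' \<tau> t') (vcomp X d' (rep_right X j t t' \<tau>)))"

definition RMnd :: "('o, 't, 'l, 'c) vdc \<Rightarrow> 't \<Rightarrow> ('t \<times> 'c \<times> 'c, 'c) cat" where
  "RMnd X j = \<lparr>
     Obj = {T. is_rel_monad X j T},
     Hom = (\<lambda>T T'. {\<tau>. is_rel_monad_morphism X j T T' \<tau>}),
     Idn = (\<lambda>T. cid X (companion X (fst T))),
     Comp = (\<lambda>T T' T'' \<tau>' \<tau>. vcomp X \<tau>' \<tau>)\<rparr>"

definition RMnd_forget :: "('t \<times> 'c \<times> 'c, 'c, 't, 'c) fctr" where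
  "RMnd_forget = \<lparr>fob = fst, farr = (\<lambda>T T' \<tau>. \<tau>)\<rparr>"


section \<open>Monoids in multicategories and in skew-multicategories\<close>

text \<open>
  These records carry the data of a multicategory and of an associative-normal
  left-skew-multicategory; monoids and their homomorphisms are formulated in terms of the data
  alone. Composition takes the frames of its arguments: \<open>mcomp M xss ys z g fs\<close> is the composite of
  \<open>g: ys \<rightarrow> z\<close> with the \<open>fs ! i: xss ! i \<rightarrow> ys ! i\<close>.
\<close>

record ('a, 'm) multicat =
  mob :: "'a set"
  mhom :: "'a list \<Rightarrow> 'a \<Rightarrow> 'm set"
  mid :: "'a \<Rightarrow> 'm"
  mcomp :: "'a list list \<Rightarrow> 'a list \<Rightarrow> 'a \<Rightarrow> 'm \<Rightarrow> 'm list \<Rightarrow> 'm"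

definition is_monoid :: "('a, 'm) multicat \<Rightarrow> 'a \<times> 'm \<times> 'm \<Rightarrow> bool" where
  "is_monoid \<M> S \<longleftrightarrow> (case S of (M, m, u) \<Rightarrow>
     M \<in> mob \<M> \<and> m \<in> mhom \<M> [M, M] M \<and> u \<in> mhom \<M> [] M \<and>
     mcomp \<M> [[], [M]] [M, M] M m [u, mid \<M> M] = mid \<M> M \<and>
     mcomp \<M> [[M], []] [M, M] M m [mid \<M> M, u] = mid \<M> M \<and>
     mcomp \<M> [[M, M], [M]] [M, M] M m [m, mid \<M> M] =
       mcomp \<M> [[M], [M, M]] [M, M] M m [mid \<M> M, m])"

definition is_monoid_hom ::
    "('a, 'm) multicat \<Rightarrow> 'a \<times> 'm \<times> 'm \<Rightarrow> 'a \<times> 'm \<times> 'm \<Rightarrow> 'm \<Rightarrow> bool" where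
  "is_monoid_hom \<M> S S' f \<longleftrightarrow> (case (S, S') of ((M, m, u), (M', m', u')) \<Rightarrow>
     f \<in> mhom \<M> [M] M' \<and>
     mcomp \<M> [[]] [M] M' f [u] = u' \<and>
     mcomp \<M> [[M, M]] [M] M' f [m] = mcomp \<M> [[M], [M]] [M', M'] M' m' [f, f])"

definition Mon :: "('a, 'm) multicat \<Rightarrow> ('a \<times> 'm \<times> 'm, 'm) cat" where
  "Mon \<M> = \<lparr>
     Obj = {S. is_monoid \<M> S},
     Hom = (\<lambda>S S'. {f. is_monoid_hom \<M> S S' f}),
     Idn = (\<lambda>S. mid \<M> (fst S)),
     Comp = (\<lambda>S S' S'' g f. mcomp \<M> [[fst S]] [fst S'] (fst S'') g [f])\<rparr>"

text \<open>
  In a skew-multicategory, the entries of domains are elements of \<open>'a option\<close>, with \<open>None\<close>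
  for the marker \<open>\<bullet>\<close>. In \<open>scomp M xss ys z g fs\<close>, the list \<open>fs\<close> is aligned with
  the domain \<open>ys\<close> of \<open>g\<close>: it has \<open>None\<close> at the markers, where nothing is substituted (and \<open>xss\<close> has
  \<open>[None]\<close>). The left-unitor \<open>slam M xs y k\<close> sends \<open>xs \<rightarrow> y\<close> to \<open>ins_marker k xs \<rightarrow> y\<close>, and the
  right-unitor \<open>srho M xs y k\<close> sends \<open>ins_marker k xs \<rightarrow> y\<close> to \<open>xs \<rightarrow> y\<close>, where \<open>ins_marker k xs\<close> is
  \<open>take k xs @ None # drop k xs\<close>.
\<close>

record ('a, 'm) skew_multicat =
  sob :: "'a set"
  shom :: "'a option list \<Rightarrow> 'a \<Rightarrow> 'm set"
  sid :: "'a \<Rightarrow> 'm"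
  scomp :: "'a option list list \<Rightarrow> 'a option list \<Rightarrow> 'a \<Rightarrow> 'm \<Rightarrow> 'm option list \<Rightarrow> 'm"
  slam :: "'a option list \<Rightarrow> 'a \<Rightarrow> nat \<Rightarrow> 'm \<Rightarrow> 'm"
  srho :: "'a option list \<Rightarrow> 'a \<Rightarrow> nat \<Rightarrow> 'm \<Rightarrow> 'm"

definition is_skew_monoid :: "('a, 'm) skew_multicat \<Rightarrow> 'a \<times> 'm \<times> 'm \<Rightarrow> bool" where
  "is_skew_monoid \<M> S \<longleftrightarrow> (case S of (M, m, u) \<Rightarrow>
     M \<in> sob \<M> \<and> m \<in> shom \<M> [Some M, Some M] M \<and> u \<in> shom \<M> [None] M \<and>
     scomp \<M> [[None], [Some M]] [Some M, Some M] M m [Some u, Some (sid \<M> M)] =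
       slam \<M> [Some M] M 0 (sid \<M> M) \<and>
     srho \<M> [Some M] M 1
       (scomp \<M> [[Some M], [None]] [Some M, Some M] M m [Some (sid \<M> M), Some u]) = sid \<M> M \<and>
     scomp \<M> [[Some M, Some M], [Some M]] [Some M, Some M] M m [Some m, Some (sid \<M> M)] =
       scomp \<M> [[Some M], [Some M, Some M]] [Some M, Some M] M m [Some (sid \<M> M), Some m])"

definition is_skew_monoid_hom ::
    "('a, 'm) skew_multicat \<Rightarrow> 'a \<times> 'm \<times> 'm \<Rightarrow> 'a \<times> 'm \<times> 'm \<Rightarrow> 'm \<Rightarrow> bool" where
  "is_skew_monoid_hom \<M> S S' f \<longleftrightarrow> (case (S, S') of ((M, m, u), (M', m', u')) \<Rightarrow>
     f \<in> shom \<M> [Some M] M' \<and>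
     scomp \<M> [[None]] [Some M] M' f [Some u] = u' \<and>
     scomp \<M> [[Some M, Some M]] [Some M] M' f [Some m] =
       scomp \<M> [[Some M], [Some M]] [Some M', Some M'] M' m' [Some f, Some f])"

definition skew_Mon :: "('a, 'm) skew_multicat \<Rightarrow> ('a \<times> 'm \<times> 'm, 'm) cat" where
  "skew_Mon \<M> = \<lparr>
     Obj = {S. is_skew_monoid \<M> S},
     Hom = (\<lambda>S S'. {f. is_skew_monoid_hom \<M> S S' f}),
     Idn = (\<lambda>S. sid \<M> (fst S)),
     Comp = (\<lambda>S S' S'' g f. scomp \<M> [[Some (fst S)]] [Some (fst S')] (fst S'') g [Some f])\<rparr>"


section \<open>The skew-multicategory associated to a tight-cell\<close>

fun intersperse :: "'a \<Rightarrow> 'a list \<Rightarrow> 'a list" where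
  "intersperse s (x # y # zs) = x # s # intersperse s (y # zs)"
| "intersperse s xs = xs"

definition entry :: "('o, 't, 'l, 'c) vdc \<Rightarrow> 't \<Rightarrow> 't option \<Rightarrow> 'l" where
  "entry X j x = (case x of None \<Rightarrow> companion X j | Some t \<Rightarrow> companion X t)"

text \<open>The chain \<open>p\<^sub>1, E(j,1), p\<^sub>2, E(j,1), \<dots>, E(j,1), p\<^sub>n\<close>.\<close>

definition skew_dom :: "('o, 't, 'l, 'c) vdc \<Rightarrow> 't \<Rightarrow> 't option list \<Rightarrow> 'l list" where
  "skew_dom X j xs = intersperse (conjoint X j) (map (entry X j) xs)"

text \<open>
  With \<open>ps = skew_dom X j xs\<close>, the entry \<open>p\<^sub>k\<^sub>+\<^sub>1\<close> of \<open>ps\<close> is \<open>ps ! (2 * k)\<close>. The left-unitor inserts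
  \<open>E(1,j), E(j,1)\<close> just before \<open>p\<^sub>k\<^sub>+\<^sub>1\<close>: a loose-identity is inserted there, through which the counit
  of \<open>j\<close> is pasted. The right-unitor removes \<open>E(j,1), E(1,j)\<close> just after \<open>p\<^sub>k\<close>: these
  two loose-cells are replaced by their composite \<open>E(j,j)\<close>, exhibited by the opcartesian 2-cell
  \<open>smile X 1 j j: E(j,1), E(1,j) \<Rightarrow> E(j,j)\<close>, through which \<open>frown X j\<close> is pasted.
\<close>

definition skew_lam ::
    "('o, 't, 'l, 'c) vdc \<Rightarrow> 't \<Rightarrow> 't option list \<Rightarrow> 't \<Rightarrow> nat \<Rightarrow> 'c \<Rightarrow> 'c" where
  "skew_lam X j xs s k \<phi> =
     (let ps = take (2 * k) (skew_dom X j xs); rs = drop (2 * k) (skew_dom X j xs)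
      in paste X (opfactor X (lid_cell X (tcod X j)) ps \<phi> rs) ps (counit X j) rs)"

definition skew_rho ::
    "('o, 't, 'l, 'c) vdc \<Rightarrow> 't \<Rightarrow> 't option list \<Rightarrow> 't \<Rightarrow> nat \<Rightarrow> 'c \<Rightarrow> 'c" where
  "skew_rho X j xs s k \<phi> =
     (let ps = take (2 * k - 1) (skew_dom X j xs); rs = drop (2 * k - 1) (skew_dom X j xs)
      in paste X (opfactor X (smile X (tid X (tcod X j)) j j) ps \<phi> rs) ps (frown X j) rs)"

definition skew_multicat_of ::
    "('o, 't, 'l, 'c) vdc \<Rightarrow> 't \<Rightarrow> ('t, 'c) skew_multicat" where
  "skew_multicat_of X j = \<lparr>
     sob = tights X (tdom X j) (tcod X j),
     shom = (\<lambda>xs s.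
       if xs \<noteq> [] \<and> (\<forall>t. Some t \<in> set xs \<longrightarrow> t \<in> tights X (tdom X j) (tcod X j)) \<and>
          s \<in> tights X (tdom X j) (tcod X j)
       then cells X (skew_dom X j xs) (companion X s) else {}),
     sid = (\<lambda>t. cid X (companion X t)),
     scomp = (\<lambda>xss ys z \<psi> \<phi>s. ccomp X \<psi> (tid X (tcod X j))
       (intersperse (cid X (conjoint X j))
         (map (case_option (cid X (companion X j)) (\<lambda>\<phi>. \<phi>)) \<phi>s))),
     slam = skew_lam X j,
     srho = skew_rho X j\<rparr>"

definition skew_Mon_forget :: "('t \<times> 'c \<times> 'c, 'c, 't, 'c) fctr" where
  "skew_Mon_forget = \<lparr>fob = fst, farr = (\<lambda>S S' \<phi>. \<phi>)\<rparr>"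


section \<open>The multicategory associated to a dense tight-cell\<close>

text \<open>Transposition of 2-cells \<open>E(j,f\<^sub>1), \<dots>, E(j,f\<^sub>n) \<Rightarrow> E(j,g)\<close> to 2-cells
  \<open>E(1,j), E(j,f\<^sub>1), \<dots>, E(j,f\<^sub>n) \<Rightarrow> E(1,g)\<close>, and its inverse.\<close>

definition transpose :: "('o, 't, 'l, 'c) vdc \<Rightarrow> 't \<Rightarrow> 't \<Rightarrow> 'c \<Rightarrow> 'c" where
  "transpose X j g \<phi> = ccomp X (smile X j (tid X (tcod X j)) g) (tid X (tcod X j))
     [cid X (companion X j), \<phi>]"

definition untranspose :: "('o, 't, 'l, 'c) vdc \<Rightarrow> 't \<Rightarrow> 't list \<Rightarrow> 't \<Rightarrow> 'c \<Rightarrow> 'c" where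
  "untranspose X j fs g \<psi> =
     (THE \<phi>. \<phi> \<in> cells X (map (rep X j) fs) (rep X j g) \<and> transpose X j g \<phi> = \<psi>)"

definition multicat_of :: "('o, 't, 'l, 'c) vdc \<Rightarrow> 't \<Rightarrow> ('t, 'c) multicat" where
  "multicat_of X j = \<lparr>
     mob = tights X (tdom X j) (tcod X j),
     mhom = (\<lambda>fs g.
       if set fs \<subseteq> tights X (tdom X j) (tcod X j) \<and> g \<in> tights X (tdom X j) (tcod X j)
       then cells X (companion X j # map (rep X j) fs) (companion X g) else {}),
     mid = (\<lambda>f. transpose X j f (cid X (rep X j f))),
     mcomp = (\<lambda>fss gs h \<psi> \<phi>s.
       transpose X j h (ccomp X (untranspose X j gs h \<psi>) (tid X (tdom X j))
         (map (\<lambda>(fs, g, \<phi>). untranspose X j fs g \<phi>) (zip fss (zip gs \<phi>s)))))\<rparr>"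

text \<open>A unary multimorphism \<open>f \<rightarrow> g\<close> corresponds to a 2-cell \<open>E(j,f) \<Rightarrow> E(j,g)\<close>, which, as \<open>j\<close> is
  dense, is \<open>E(j,\<tau>)\<close> for a unique \<open>\<tau>: f \<Rightarrow> g\<close>.\<close>

definition unary_to_tight :: "('o, 't, 'l, 'c) vdc \<Rightarrow> 't \<Rightarrow> 't \<Rightarrow> 't \<Rightarrow> 'c \<Rightarrow> 'c" where
  "unary_to_tight X j f g \<psi> =
     (THE \<tau>. \<tau> \<in> cells X [companion X f] (companion X g) \<and>
        rep_right X j f g \<tau> = untranspose X j [f] g \<psi>)"

definition Mon_forget :: "('o, 't, 'l, 'c) vdc \<Rightarrow> 't \<Rightarrow> ('t \<times> 'c \<times> 'c, 'c, 't, 'c) fctr" where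
  "Mon_forget X j = \<lparr>fob = fst, farr = (\<lambda>S S' \<psi>. unary_to_tight X j (fst S) (fst S') \<psi>)\<rparr>"

end

(*
  A 2-cell into a restriction E(x,y), with identity boundaries, is the same as a 2-cell into the
  loose-identity of E with left boundary x and right boundary y. Juxtaposing two such 2-cells and
  multiplying the two copies of the loose-identity is an associative and unital operation, written
  with a star. It turns the unit, the counit and the actions E(x,tau), E(tau,y) into products, and
  substitution distributes over it. Writing e(x,y) for the cartesian 2-cell of E(x,y), density of j
  says that D |-> e(j,g) * D is bijective.

  All three kinds of structure on t are given by U: () => E(j,t) and D: E(j,t) => E(t,t) such that
  U * D = e(j,t), D[U] = 1_t and D * D = D[e(j,t) * D]: a relative monad is (t, D, U) itself, the
  multiplication of a monoid is e(j,t) * D, and that of a skew monoid is e(1,t) * D composed with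
  E(j,1), E(1,t) => E(j,t), which is opcartesian. Morphisms are compared in the same way. Density is
  needed only to invert multiplication by e(j,t), in the monoid case.
*)
theory Submission
  imports Defs
begin

section \<open>Pasting in a virtual double category\<close>

text \<open>Two difficulties shape the proof. First, \<open>ccomp\<close> carries a tight-cell as
  left boundary, and its associativity law threads boundaries through every block. The algebra is
  therefore done with \<open>sub\<close>, where the substituted cells have identity boundaries;
  general boundaries survive mainly where units of companions and conjoints are pasted in. Second,
  the axioms provide opcartesian 2-cells only for loose-identities, and density speaks only of
  chains from E to E. That E(j,1), E(1,t) composes to E(j,t) must be proved, and density must be
  carried along companions and conjoints to other chains.

  Multiplication by e(1,t) can always be undone by pasting the unit of the companion; this strips
  the leading factor from the laws of skew monoids.

  The isomorphisms hold on the nose and respect the forgetful functors. Each of the three categories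
  is therefore shown to be a renaming of one presentation over the base, and any two renamings are
  compared by a single general argument.\<close>

context virtual_double_category
begin

section \<open>Boundaries and frames of juxtapositions\<close>

lemma tid_Tight [simp]: "A \<in> Ob X \<Longrightarrow> tid X A \<in> Tight X"
  and tdom_tid [simp]: "A \<in> Ob X \<Longrightarrow> tdom X (tid X A) = A"
  and tcod_tid [simp]: "A \<in> Ob X \<Longrightarrow> tcod X (tid X A) = A"
  using tid_in[of A] by (auto simp: tights_def)

lemma tcomp_tid [simp]:
  assumes "f \<in> Tight X"
  shows "tcomp X (tid X (tcod X f)) f = f" and "tcomp X f (tid X (tdom X f)) = f"
  using tcomp_tid_left[of f "tdom X f" "tcod X f"] tcomp_tid_right[of f "tdom X f" "tcod X f"] assms
  by (auto simp: tights_def)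

lemma tcod_tcomp:
  "f \<in> Tight X \<Longrightarrow> g \<in> Tight X \<Longrightarrow> tcod X f = tdom X g \<Longrightarrow> tcod X (tcomp X g f) = tcod X g"
  using tcomp_in[of f "tdom X f" "tcod X f" g "tcod X g"] by (auto simp: tights_def)

lemmas tight_intros [simp] = tdom_in tcod_in lsrc_in ltgt_in cleft_in cright_in ccod_in cid_in

lemma cid_simps [simp]:
  assumes "p \<in> Loose X"
  shows "cdom X (cid X p) = [p]" "ccod X (cid X p) = p"
    "cleft X (cid X p) = tid X (ltgt X p)" "cright X (cid X p) = tid X (lsrc X p)"
  using cid_frame[OF assms] by auto

lemma chain_Loose: "chain X A ps B \<Longrightarrow> set ps \<subseteq> Loose X"
  by (induction ps arbitrary: A) auto

lemma chain_Ob: "chain X A ps B \<Longrightarrow> A \<in> Ob X \<and> B \<in> Ob X"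
  by (induction ps arbitrary: A) auto

lemma chain_append: "chain X A (ps @ qs) B \<longleftrightarrow> (\<exists>C. chain X A ps C \<and> chain X C qs B)"
  by (induction ps arbitrary: A) (auto dest: chain_Ob)

lemma chain_determ: "chain X A ps B \<Longrightarrow> chain X A ps C \<Longrightarrow> B = C"
  by (induction ps arbitrary: A) auto

lemma juxt_append: "juxt X f (\<phi>s @ \<psi>s) g \<longleftrightarrow> (\<exists>h. juxt X f \<phi>s h \<and> juxt X h \<psi>s g)"
proof (induction \<phi>s arbitrary: f)
  case Nil
  have "juxt X f \<psi>s g \<Longrightarrow> f \<in> Tight X" by (cases \<psi>s) auto
  then show ?case by auto
qed auto

lemma juxt_right: "juxt X f \<phi>s g \<Longrightarrow> g = (if \<phi>s = [] then f else cright X (last \<phi>s))"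
  by (induction \<phi>s arbitrary: f) auto

lemma juxt_Tight: "juxt X f \<phi>s g \<Longrightarrow> f \<in> Tight X \<and> g \<in> Tight X"
  by (induction \<phi>s arbitrary: f) auto

lemma juxt_chain_cod: "juxt X f \<phi>s g \<Longrightarrow> chain X (tcod X f) (map (ccod X) \<phi>s) (tcod X g)"
  by (induction \<phi>s arbitrary: f) (auto simp: tcod_cleft tcod_cright[symmetric])

lemma juxt_cid: "chain X A ps B \<Longrightarrow> juxt X (tid X A) (map (cid X) ps) (tid X B)"
  by (induction ps arbitrary: A) auto

lemma composable_chain:
  "juxt X f \<phi>s g \<Longrightarrow> \<phi> \<in> Cell X \<Longrightarrow> map (ccod X) \<phi>s = cdom X \<phi> \<Longrightarrow>
    tcod X f = tdom X (cleft X \<phi>) \<Longrightarrow> composable X \<phi> f \<phi>s g \<and> tcod X g = tdom X (cright X \<phi>)"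
  using juxt_chain_cod[of f \<phi>s g] cdom_chain[of \<phi>] chain_determ
  by (fastforce simp: composable_def)

text \<open>Each block starts at the right boundary of the block before it, so the second group of
  blocks must start at \<open>h'\<close>, where the first group ends.\<close>

lemma ccomps_append:
  assumes "length \<phi>s = length \<psi>ss" and "juxt X h (concat \<psi>ss) h'"
  shows "ccomps X (\<phi>s @ \<phi>s') h (\<psi>ss @ \<psi>ss') = ccomps X \<phi>s h \<psi>ss @ ccomps X \<phi>s' h' \<psi>ss'"
  using assms
proof (induction \<phi>s \<psi>ss arbitrary: h rule: list_induct2)
  case (Cons \<phi> \<phi>s \<psi>s \<psi>ss)
  from Cons.prems obtain k where k: "juxt X h \<psi>s k" "juxt X k (concat \<psi>ss) h'"
    by (auto simp: juxt_append)
  with Cons.IH[OF k(2)] juxt_right[OF k(1)] show ?case by auto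
qed auto

lemma ccomps_cid_left:
  "juxt X h \<psi>s k \<Longrightarrow> ccomps X (map (cid X) (map (ccod X) \<psi>s)) h (map (\<lambda>\<psi>. [\<psi>]) \<psi>s) = \<psi>s"
  by (induction \<psi>s arbitrary: h) (auto simp: ccomp_cid_left)

section \<open>2-cells whose tight boundaries are identities, and their substitution\<close>

definition glob :: "'c set" where
  "glob = {\<alpha>. \<alpha> \<in> cells X (cdom X \<alpha>) (ccod X \<alpha>)}"

lemma cells_glob: "\<alpha> \<in> cells X ps q \<Longrightarrow> \<alpha> \<in> glob"
  by (auto simp: glob_def cells_def)

lemma cells_simps:
  "\<alpha> \<in> cells X ps q \<Longrightarrow> \<alpha> \<in> Cell X" "\<alpha> \<in> cells X ps q \<Longrightarrow> cdom X \<alpha> = ps"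
  "\<alpha> \<in> cells X ps q \<Longrightarrow> ccod X \<alpha> = q"
  "\<alpha> \<in> cells X ps q \<Longrightarrow> cleft X \<alpha> = tid X (ltgt X q)"
  "\<alpha> \<in> cells X ps q \<Longrightarrow> cright X \<alpha> = tid X (lsrc X q)"
  by (auto simp: cells_def)

lemma glob_simps:
  "\<alpha> \<in> glob \<Longrightarrow> \<alpha> \<in> Cell X"
  "\<alpha> \<in> glob \<Longrightarrow> cleft X \<alpha> = tid X (ltgt X (ccod X \<alpha>))"
  "\<alpha> \<in> glob \<Longrightarrow> cright X \<alpha> = tid X (lsrc X (ccod X \<alpha>))"
  by (auto simp: glob_def cells_def)

lemma cid_cells: "p \<in> Loose X \<Longrightarrow> cid X p \<in> cells X [p] p"
  by (auto simp: cells_def)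

lemma juxt_glob:
  "set \<alpha>s \<subseteq> glob \<Longrightarrow> chain X A (map (ccod X) \<alpha>s) B \<Longrightarrow> juxt X (tid X A) \<alpha>s (tid X B)"
  by (induction \<alpha>s arbitrary: A) (auto simp: glob_simps)

text \<open>For a nonempty list of cells in \<open>glob\<close> the left boundary is forced to be
  this identity; for the empty list it is chosen so. The cell \<open>\<psi>\<close> itself may have
  arbitrary tight-cells.\<close>

definition sub :: "'c \<Rightarrow> 'c list \<Rightarrow> 'c" where
  "sub \<psi> \<alpha>s = ccomp X \<psi> (tid X (tdom X (cleft X \<psi>))) \<alpha>s"

lemma sub_composable:
  assumes "\<psi> \<in> Cell X" "set \<alpha>s \<subseteq> glob" "map (ccod X) \<alpha>s = cdom X \<psi>"
  shows "composable X \<psi> (tid X (tdom X (cleft X \<psi>))) \<alpha>s (tid X (tdom X (cright X \<psi>)))"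
  using assms cdom_chain[of \<psi>] by (auto simp: composable_def juxt_glob)

lemma sub_frame:
  assumes "\<psi> \<in> Cell X" "set \<alpha>s \<subseteq> glob" "map (ccod X) \<alpha>s = cdom X \<psi>"
  shows "sub \<psi> \<alpha>s \<in> Cell X" "cdom X (sub \<psi> \<alpha>s) = concat (map (cdom X) \<alpha>s)"
    "ccod X (sub \<psi> \<alpha>s) = ccod X \<psi>" "cleft X (sub \<psi> \<alpha>s) = cleft X \<psi>"
    "cright X (sub \<psi> \<alpha>s) = cright X \<psi>"
  using ccomp_in[OF sub_composable[OF assms]] ccomp_frame[OF sub_composable[OF assms]] assms(1)
  by (auto simp: sub_def)

lemma sub_cells:
  assumes "\<psi> \<in> cells X (map (ccod X) \<alpha>s) q" "set \<alpha>s \<subseteq> glob"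
  shows "sub \<psi> \<alpha>s \<in> cells X (concat (map (cdom X) \<alpha>s)) q"
  using sub_frame[of \<psi> \<alpha>s] assms by (auto simp: cells_def)

lemma ccomps_glob:
  assumes "set \<alpha>s \<subseteq> glob" "\<forall>\<beta>s\<in>set \<beta>ss. set \<beta>s \<subseteq> glob"
    "map (map (ccod X)) \<beta>ss = map (cdom X) \<alpha>s" "chain X A (map (ccod X) \<alpha>s) B"
  shows "ccomps X \<alpha>s (tid X A) \<beta>ss = map2 sub \<alpha>s \<beta>ss"
  using assms
proof (induction \<alpha>s arbitrary: \<beta>ss A)
  case (Cons \<alpha> \<alpha>s)
  then obtain \<beta>s \<beta>ss' where b: "\<beta>ss = \<beta>s # \<beta>ss'" by (cases \<beta>ss) auto
  have a: "\<alpha> \<in> glob" "ltgt X (ccod X \<alpha>) = A" "ccod X \<alpha> \<in> Loose X" "set \<beta>s \<subseteq> glob"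
    "map (ccod X) \<beta>s = cdom X \<alpha>"
    using Cons.prems b by auto
  then have tA: "tdom X (cleft X \<alpha>) = A" and tr: "tdom X (cright X \<alpha>) = lsrc X (ccod X \<alpha>)"
    by (auto simp: glob_simps)
  \<comment> \<open>If \<open>\<beta>s\<close> is empty, the next block begins at
    \<open>tid X A\<close>. This is still the identity at the source of
    \<open>ccod X \<alpha>\<close>, as a nullary cell with identity boundaries has equal source and
    target.\<close>
  have "juxt X (tid X A) \<beta>s (tid X (lsrc X (ccod X \<alpha>)))"
    using sub_composable[of \<alpha> \<beta>s] a tA tr by (auto simp: composable_def glob_simps)
  from juxt_right[OF this]
  have "(if \<beta>s = [] then tid X A else cright X (last \<beta>s)) = tid X (lsrc X (ccod X \<alpha>))" by simp
  with b Cons tA show ?case by (simp add: sub_def)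
qed auto

lemma sub_sub:
  assumes "\<psi> \<in> Cell X" "set \<alpha>s \<subseteq> glob" "map (ccod X) \<alpha>s = cdom X \<psi>"
    "\<forall>\<beta>s\<in>set \<beta>ss. set \<beta>s \<subseteq> glob" "map (map (ccod X)) \<beta>ss = map (cdom X) \<alpha>s"
  shows "sub (sub \<psi> \<alpha>s) (concat \<beta>ss) = sub \<psi> (map2 sub \<alpha>s \<beta>ss)"
proof -
  let ?A = "tdom X (cleft X \<psi>)"
  have "concat (map (map (ccod X)) \<beta>ss) = cdom X (sub \<psi> \<alpha>s)"
    using assms by (simp add: sub_frame)
  then have "map (ccod X) (concat \<beta>ss) = cdom X (sub \<psi> \<alpha>s)"
    by (simp add: map_concat)
  moreover have "set (concat \<beta>ss) \<subseteq> glob" using assms(4) by auto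
  ultimately have "juxt X (tid X ?A) (concat \<beta>ss) (tid X (tdom X (cright X \<psi>)))"
    using sub_composable[of "sub \<psi> \<alpha>s" "concat \<beta>ss"] sub_frame[OF assms(1-3)]
    by (auto simp: composable_def)
  from ccomp_assoc[OF sub_composable[OF assms(1-3)] assms(5) this]
  have "sub (sub \<psi> \<alpha>s) (concat \<beta>ss) = sub \<psi> (ccomps X \<alpha>s (tid X ?A) \<beta>ss)"
    using assms(1) sub_frame[OF assms(1-3)] tcomp_tid(1)[of "tid X ?A"] by (simp add: sub_def)
  moreover have "ccomps X \<alpha>s (tid X ?A) \<beta>ss = map2 sub \<alpha>s \<beta>ss"
    using ccomps_glob[OF assms(2,4,5)] cdom_chain[OF assms(1)] unfolding assms(3) .
  ultimately show ?thesis by simp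
qed

lemma sub_cid: "\<psi> \<in> Cell X \<Longrightarrow> sub \<psi> (map (cid X) (cdom X \<psi>)) = \<psi>"
  by (simp add: sub_def ccomp_cid_right)

lemma cid_sub: "\<psi> \<in> glob \<Longrightarrow> sub (cid X (ccod X \<psi>)) [\<psi>] = \<psi>"
  using ccomp_cid_left[of \<psi>] by (simp add: sub_def glob_simps)

lemma vcomp_sub: "\<psi> \<in> glob \<Longrightarrow> tdom X (cleft X \<chi>) = ltgt X (ccod X \<psi>) \<Longrightarrow> vcomp X \<chi> \<psi> = sub \<chi> [\<psi>]"
  by (simp add: sub_def vcomp_def glob_simps)

lemma paste_sub: "paste X \<psi> ps \<phi> rs = sub \<psi> (map (cid X) ps @ [\<phi>] @ map (cid X) rs)"
  by (simp add: paste_def sub_def)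

lemma set_cid_glob: "set ps \<subseteq> Loose X \<Longrightarrow> set (map (cid X) ps) \<subseteq> glob"
  by (auto intro!: cells_glob[OF cid_cells])

lemma map_ccod_cid: "set ps \<subseteq> Loose X \<Longrightarrow> map (ccod X) (map (cid X) ps) = ps"
  and concat_cdom_cid: "set ps \<subseteq> Loose X \<Longrightarrow> concat (map (cdom X) (map (cid X) ps)) = ps"
  by (induction ps) auto

lemma Cell_Loose: "\<psi> \<in> Cell X \<Longrightarrow> set (cdom X \<psi>) \<subseteq> Loose X"
  by (meson cdom_chain chain_Loose)

lemma paste_frame:
  assumes "\<psi> \<in> Cell X" "cdom X \<psi> = ps @ [q] @ rs" "\<phi> \<in> cells X as q"
  shows "paste X \<psi> ps \<phi> rs \<in> Cell X" "cdom X (paste X \<psi> ps \<phi> rs) = ps @ as @ rs"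
    "ccod X (paste X \<psi> ps \<phi> rs) = ccod X \<psi>" "cleft X (paste X \<psi> ps \<phi> rs) = cleft X \<psi>"
    "cright X (paste X \<psi> ps \<phi> rs) = cright X \<psi>"
proof -
  have L: "set ps \<subseteq> Loose X" "set rs \<subseteq> Loose X" "q \<in> Loose X"
    using Cell_Loose[OF assms(1)] assms(2) by auto
  have "set (map (cid X) ps @ [\<phi>] @ map (cid X) rs) \<subseteq> glob"
    using set_cid_glob L assms(3) cells_glob by auto
  moreover have "map (ccod X) (map (cid X) ps @ [\<phi>] @ map (cid X) rs) = cdom X \<psi>"
    using assms map_ccod_cid L by (simp add: cells_simps)
  ultimately show "paste X \<psi> ps \<phi> rs \<in> Cell X" "cdom X (paste X \<psi> ps \<phi> rs) = ps @ as @ rs"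
    "ccod X (paste X \<psi> ps \<phi> rs) = ccod X \<psi>" "cleft X (paste X \<psi> ps \<phi> rs) = cleft X \<psi>"
    "cright X (paste X \<psi> ps \<phi> rs) = cright X \<psi>"
    using sub_frame[of \<psi> "map (cid X) ps @ [\<phi>] @ map (cid X) rs"] assms(1,3)
      concat_cdom_cid[OF L(1)] concat_cdom_cid[OF L(2)]
    by (simp_all only: paste_sub) (simp_all add: cells_simps)
qed

text \<open>Associativity with identities on both flanks and general tight boundaries in the middle.
  It is used for pasting 2-cells with a non-identity boundary, such as the units of companions and
  conjoints.\<close>

lemma ccomp_context:
  assumes "\<chi> \<in> Cell X" "cdom X \<chi> = ps @ map (ccod X) \<mu>s @ rs"
    and "juxt X f (map (cid X) ps) f'" "juxt X f' \<mu>s g'" "juxt X g' (map (cid X) rs) g"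
    and "tcod X f = tdom X (cleft X \<chi>)"
    and "map (map (ccod X)) \<nu>ss = map (cdom X) \<mu>s"
    and "juxt X h (map (cid X) ps) h'" "juxt X h' (concat \<nu>ss) k'" "juxt X k' (map (cid X) rs) k"
    and "tcod X h = tdom X f"
  shows "ccomp X (ccomp X \<chi> f (map (cid X) ps @ \<mu>s @ map (cid X) rs)) h
      (map (cid X) ps @ concat \<nu>ss @ map (cid X) rs)
    = ccomp X \<chi> (tcomp X f h) (map (cid X) ps @ ccomps X \<mu>s h' \<nu>ss @ map (cid X) rs)"
proof -
  let ?S = "\<lambda>ps. map (\<lambda>p. [cid X p]) ps"
  have S: "?S qs = map (\<lambda>\<psi>. [\<psi>]) (map (cid X) qs)" for qs by simp
  have C: "concat (?S qs) = map (cid X) qs" for qs by (induction qs) auto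
  have L: "set ps \<subseteq> Loose X" "set rs \<subseteq> Loose X"
    using Cell_Loose[OF assms(1)] assms(2) by auto
  have cc: "map (ccod X) (map (cid X) qs) = qs" if "set qs \<subseteq> Loose X" for qs
    using map_ccod_cid that by blast
  have comp: "composable X \<chi> f (map (cid X) ps @ \<mu>s @ map (cid X) rs) g"
    using assms(1-6) L cc unfolding composable_def by (auto simp: juxt_append simp del: map_map)
  have m: "map (map (ccod X)) (?S ps @ \<nu>ss @ ?S rs) = map (cdom X) (map (cid X) ps @ \<mu>s @ map (cid X) rs)"
    using assms(7) L by auto
  have j: "juxt X h (concat (?S ps @ \<nu>ss @ ?S rs)) k"
    using assms(8-10) by (auto simp: juxt_append C)
  have id: "ccomps X (map (cid X) qs) l (?S qs) = map (cid X) qs"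
    if "juxt X l (map (cid X) qs) l'" "set qs \<subseteq> Loose X" for l l' qs
    using ccomps_cid_left[OF that(1)] unfolding cc[OF that(2)] S[symmetric] .
  have len: "length (map (cid X) ps) = length (?S ps)" "length \<mu>s = length \<nu>ss"
    using arg_cong[OF assms(7), of length] by simp_all
  have "ccomps X (map (cid X) ps @ \<mu>s @ map (cid X) rs) h (?S ps @ \<nu>ss @ ?S rs)
    = map (cid X) ps @ ccomps X \<mu>s h' \<nu>ss @ map (cid X) rs"
    using ccomps_append[OF len(1), of h h'] ccomps_append[OF len(2), of h' k'] assms(8-10) C
      id[OF assms(8) L(1)] id[OF assms(10) L(2)] by simp
  with ccomp_assoc[OF comp m j assms(11)] show ?thesis by (simp add: C)
qed

section \<open>Existence and uniqueness of factorizations\<close>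

lemma opcartesian_cancel:
  assumes "opcartesian X \<phi>" "\<psi> \<in> Cell X" "\<psi>' \<in> Cell X"
    and "cdom X \<psi> = ps @ [ccod X \<phi>] @ rs" "cdom X \<psi>' = ps @ [ccod X \<phi>] @ rs"
    and "ccod X \<psi> = ccod X \<psi>'" "cleft X \<psi> = cleft X \<psi>'" "cright X \<psi> = cright X \<psi>'"
    and "paste X \<psi> ps \<phi> rs = paste X \<psi>' ps \<phi> rs"
  shows "\<psi> = \<psi>'"
proof -
  have \<phi>: "\<phi> \<in> cells X (cdom X \<phi>) (ccod X \<phi>)" using assms(1) by (auto simp: opcartesian_def)
  note fr = paste_frame[OF assms(2,4) \<phi>]
  have ch: "chain X (tdom X (cleft X (paste X \<psi> ps \<phi> rs))) (ps @ [ccod X \<phi>] @ rs)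
      (tdom X (cright X (paste X \<psi> ps \<phi> rs)))"
    using cdom_chain[OF assms(2)] assms(4) fr by simp
  have ex: "\<exists>!\<omega>. is_opfactor X \<phi> ps (paste X \<psi> ps \<phi> rs) rs \<omega>"
    using assms(1) fr(1,2) ch unfolding opcartesian_def by blast
  have "is_opfactor X \<phi> ps (paste X \<psi> ps \<phi> rs) rs \<psi>"
    unfolding is_opfactor_def using assms(2,4) fr by auto
  moreover have "is_opfactor X \<phi> ps (paste X \<psi> ps \<phi> rs) rs \<psi>'"
    unfolding is_opfactor_def using assms fr by auto
  ultimately show ?thesis using ex by blast
qed

lemma opfactor:
  assumes "opcartesian X \<phi>" "\<psi> \<in> Cell X" "cdom X \<psi> = ps @ cdom X \<phi> @ rs"
    and "chain X (tdom X (cleft X \<psi>)) (ps @ [ccod X \<phi>] @ rs) (tdom X (cright X \<psi>))"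
  shows "is_opfactor X \<phi> ps \<psi> rs (opfactor X \<phi> ps \<psi> rs)"
  unfolding opfactor_def using assms theI'[of "is_opfactor X \<phi> ps \<psi> rs"]
  by (auto simp: opcartesian_def)

lemma factor:
  assumes "cartesian X \<chi>" "\<psi> \<in> Cell X" "f' \<in> Tight X" "g' \<in> Tight X"
    "tcod X f' = tdom X (cleft X \<chi>)" "tcod X g' = tdom X (cright X \<chi>)" "ccod X \<psi> = ccod X \<chi>"
    "cleft X \<psi> = tcomp X (cleft X \<chi>) f'" "cright X \<psi> = tcomp X (cright X \<chi>) g'"
  shows "is_factor X \<chi> f' g' \<psi> (factor X \<chi> f' g' \<psi>)"
  unfolding factor_def using assms theI'[of "is_factor X \<chi> f' g' \<psi>"]
  by (auto simp: cartesian_def)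

lemma cartesian_cancel:
  assumes "cartesian X \<chi>" "\<psi> \<in> Cell X" "\<psi>' \<in> Cell X" "cdom X \<psi> = cdom X \<psi>'"
    "[ccod X \<psi>] = cdom X \<chi>" "[ccod X \<psi>'] = cdom X \<chi>" "cleft X \<psi> = cleft X \<psi>'"
    "cright X \<psi> = cright X \<psi>'" "vcomp X \<chi> \<psi> = vcomp X \<chi> \<psi>'"
  shows "\<psi> = \<psi>'"
proof -
  have \<chi>: "\<chi> \<in> Cell X" using assms(1) by (simp add: cartesian_def)
  have j: "juxt X (cleft X \<psi>) [\<psi>] (cright X \<psi>)" using assms(2) by simp
  have ch: "chain X (tdom X (cleft X \<chi>)) [ccod X \<psi>] (tdom X (cright X \<chi>))"
    using cdom_chain[OF \<chi>] assms(5) by simp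
  have t: "tcod X (cleft X \<psi>) = tdom X (cleft X \<chi>)" "tcod X (cright X \<psi>) = tdom X (cright X \<chi>)"
    using ch assms(2) by (auto simp: tcod_cleft tcod_cright)
  have c: "composable X \<chi> (cleft X \<psi>) [\<psi>] (cright X \<psi>)"
    using composable_chain[OF j \<chi>] assms(5) t by auto
  note fr = ccomp_in[OF c] ccomp_frame[OF c]
  have "is_factor X \<chi> (cleft X \<psi>) (cright X \<psi>) (vcomp X \<chi> \<psi>) \<psi>"
    "is_factor X \<chi> (cleft X \<psi>) (cright X \<psi>) (vcomp X \<chi> \<psi>) \<psi>'"
    unfolding is_factor_def using assms fr by (auto simp: vcomp_def)
  moreover have "\<exists>!\<omega>. is_factor X \<chi> (cleft X \<psi>) (cright X \<psi>) (vcomp X \<chi> \<psi>) \<omega>"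
    using assms(1,2) fr t unfolding cartesian_def by (auto simp: vcomp_def)
  ultimately show ?thesis by blast
qed

lemma sub_context:
  assumes "\<psi> \<in> Cell X" "cdom X \<psi> = ps @ map (ccod X) \<mu>s @ rs" "set \<mu>s \<subseteq> glob"
    "\<forall>\<nu>s\<in>set \<nu>ss. set \<nu>s \<subseteq> glob" "map (map (ccod X)) \<nu>ss = map (cdom X) \<mu>s"
  shows "sub (sub \<psi> (map (cid X) ps @ \<mu>s @ map (cid X) rs)) (map (cid X) ps @ concat \<nu>ss @ map (cid X) rs)
    = sub \<psi> (map (cid X) ps @ map2 sub \<mu>s \<nu>ss @ map (cid X) rs)"
proof -
  let ?S = "\<lambda>ps. map (\<lambda>p. [cid X p]) ps"
  have L: "set ps \<subseteq> Loose X" "set rs \<subseteq> Loose X"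
    using Cell_Loose[OF assms(1)] assms(2) by auto
  have C: "concat (?S qs) = map (cid X) qs" for qs by (induction qs) auto
  have len: "length \<mu>s = length \<nu>ss"
    using arg_cong[OF assms(5), of length] by simp_all
  have id: "map2 sub (map (cid X) qs) (?S qs) = map (cid X) qs" if "set qs \<subseteq> Loose X" for qs
    using that by (induction qs) (use cid_sub cells_glob[OF cid_cells] in force)+
  have "sub (sub \<psi> (map (cid X) ps @ \<mu>s @ map (cid X) rs)) (concat (?S ps @ \<nu>ss @ ?S rs))
    = sub \<psi> (map2 sub (map (cid X) ps @ \<mu>s @ map (cid X) rs) (?S ps @ \<nu>ss @ ?S rs))"
  proof (rule sub_sub)
    show "map (ccod X) (map (cid X) ps @ \<mu>s @ map (cid X) rs) = cdom X \<psi>"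
      using assms(2) map_ccod_cid[OF L(1)] map_ccod_cid[OF L(2)] by simp
    show "map (map (ccod X)) (?S ps @ \<nu>ss @ ?S rs) = map (cdom X) (map (cid X) ps @ \<mu>s @ map (cid X) rs)"
      using assms(5) L by auto
    show "\<forall>\<beta>s\<in>set (?S ps @ \<nu>ss @ ?S rs). set \<beta>s \<subseteq> glob"
      using L assms(4) cells_glob[OF cid_cells] by auto
    show "set (map (cid X) ps @ \<mu>s @ map (cid X) rs) \<subseteq> glob"
      using L assms(3) cells_glob[OF cid_cells] by auto
  qed (rule assms)
  with len id[OF L(1)] id[OF L(2)] C show ?thesis by simp
qed

lemma sub_context_cid:
  "\<psi> \<in> Cell X \<Longrightarrow> cdom X \<psi> = ps @ qs @ rs \<Longrightarrow>
    sub \<psi> (map (cid X) ps @ map (cid X) qs @ map (cid X) rs) = \<psi>"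
  using sub_cid[of \<psi>] by simp

end

section \<open>2-cells into loose-identities\<close>

context virtual_equipment
begin

lemma is_lid_cell: "A \<in> Ob X \<Longrightarrow> is_lid_cell X A (lid_cell X A)"
  unfolding lid_cell_def using someI_ex[OF loose_identities] .

lemma
  assumes "A \<in> Ob X"
  shows lid_cell_opcartesian: "opcartesian X (lid_cell X A)"
    and lid_cell_cells: "lid_cell X A \<in> cells X [] (lid X A)"
    and lid_Loose [simp]: "lid X A \<in> Loose X"
    and ltgt_lid [simp]: "ltgt X (lid X A) = A"
    and lsrc_lid [simp]: "lsrc X (lid X A) = A"
proof -
  from is_lid_cell[OF assms]
  have l: "opcartesian X (lid_cell X A)" "cdom X (lid_cell X A) = []" "cleft X (lid_cell X A) = tid X A"
    by (auto simp: is_lid_cell_def)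
  then have c: "lid_cell X A \<in> cells X [] (lid X A)" by (auto simp: opcartesian_def lid_def)
  then have cc: "lid_cell X A \<in> Cell X" "ccod X (lid_cell X A) = lid X A"
     "tid X (ltgt X (lid X A)) = tid X A" "cright X (lid_cell X A) = tid X (lsrc X (lid X A))"
    using l by (auto simp: cells_def)
  then have L: "lid X A \<in> Loose X" using ccod_in by metis
  from arg_cong[OF cc(3), of "tdom X"] have t: "ltgt X (lid X A) = A" using L assms by simp
  have "lsrc X (lid X A) = A" using cdom_chain[OF cc(1)] l(2,3) cc(4) L assms by simp
  with l c L t show "opcartesian X (lid_cell X A)" "lid_cell X A \<in> cells X [] (lid X A)"
    "lid X A \<in> Loose X" "ltgt X (lid X A) = A" "lsrc X (lid X A) = A" by auto
qed

lemma lid_cell_simps [simp]: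
  assumes "A \<in> Ob X"
  shows "lid_cell X A \<in> Cell X" "cdom X (lid_cell X A) = []" "ccod X (lid_cell X A) = lid X A"
    "cleft X (lid_cell X A) = tid X A" "cright X (lid_cell X A) = tid X A"
    "lid_cell X A \<in> glob"
  using lid_cell_cells[OF assms] assms cells_glob by (auto simp: cells_def)

lemma lid_cancel:
  assumes "A \<in> Ob X" "\<psi> \<in> Cell X" "\<psi>' \<in> Cell X"
    "cdom X \<psi> = ps @ lid X A # rs" "cdom X \<psi>' = ps @ lid X A # rs"
    "ccod X \<psi> = ccod X \<psi>'" "cleft X \<psi> = cleft X \<psi>'" "cright X \<psi> = cright X \<psi>'"
    "paste X \<psi> ps (lid_cell X A) rs = paste X \<psi>' ps (lid_cell X A) rs"
  shows "\<psi> = \<psi>'"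
  by (rule opcartesian_cancel[OF lid_cell_opcartesian[OF assms(1)], of _ _ ps rs])
    (use assms in auto)

text \<open>Mirror image of \<open>runit\<close>. Absorption on this side is what meets the unit of
  a companion.\<close>

definition lunit :: "'l \<Rightarrow> 'c" where
  "lunit q = opfactor X (lid_cell X (ltgt X q)) [] (cid X q) [q]"

lemma
  assumes "q \<in> Loose X"
  shows runit_cells: "runit X q \<in> cells X [q, lid X (lsrc X q)] q"
    and runit_lid: "sub (runit X q) [cid X q, lid_cell X (lsrc X q)] = cid X q"
    and lunit_cells: "lunit q \<in> cells X [lid X (ltgt X q), q] q"
    and lunit_lid: "sub (lunit q) [lid_cell X (ltgt X q), cid X q] = cid X q"
proof -
  have "is_opfactor X (lid_cell X (lsrc X q)) [q] (cid X q) [] (runit X q)"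
    unfolding runit_def by (rule opfactor[OF lid_cell_opcartesian]) (use assms in auto)
  then show "runit X q \<in> cells X [q, lid X (lsrc X q)] q"
    "sub (runit X q) [cid X q, lid_cell X (lsrc X q)] = cid X q"
    using assms by (auto simp: is_opfactor_def paste_sub cells_def)
  have "is_opfactor X (lid_cell X (ltgt X q)) [] (cid X q) [q] (lunit q)"
    unfolding lunit_def by (rule opfactor[OF lid_cell_opcartesian]) (use assms in auto)
  then show "lunit q \<in> cells X [lid X (ltgt X q), q] q"
    "sub (lunit q) [lid_cell X (ltgt X q), cid X q] = cid X q"
    using assms by (auto simp: is_opfactor_def paste_sub cells_def)
qed

lemma paste_paste:
  assumes "\<psi> \<in> Cell X" "cdom X \<psi> = ps @ [q] @ rs" "\<phi> \<in> cells X (map (ccod X) \<alpha>s) q" "set \<alpha>s \<subseteq> glob"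
  shows "sub (paste X \<psi> ps \<phi> rs) (map (cid X) ps @ \<alpha>s @ map (cid X) rs) = paste X \<psi> ps (sub \<phi> \<alpha>s) rs"
  using sub_context[of \<psi> ps "[\<phi>]" rs "[\<alpha>s]"] assms cells_glob[OF assms(3)]
  by (simp add: paste_sub cells_simps)

lemma paste_cid: "\<psi> \<in> Cell X \<Longrightarrow> cdom X \<psi> = ps @ [q] @ rs \<Longrightarrow> paste X \<psi> ps (cid X q) rs = \<psi>"
  using sub_context_cid[of \<psi> ps "[q]" rs] by (simp add: paste_sub)

text \<open>Pasting the unit of the loose-identity between \<open>q\<close> and \<open>q'\<close>
  turns both sides into \<open>\<psi>\<close>, and such a pasting is injective. This is the triangle
  law, by which a loose-identity passes from one neighbour to the other.\<close>

lemma unitor_exchange: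
  assumes "\<psi> \<in> Cell X" "cdom X \<psi> = ps @ q # q' # rs"
  shows "paste X \<psi> ps (runit X q) (q' # rs) = paste X \<psi> (ps @ [q]) (lunit q') rs"
proof -
  have L: "q \<in> Loose X" "q' \<in> Loose X" using Cell_Loose[OF assms(1)] assms(2) by auto
  have qq: "ltgt X q' = lsrc X q" using cdom_chain[OF assms(1)] assms(2) by (auto simp: chain_append)
  let ?L = "lid_cell X (lsrc X q)"
  have d: "cdom X \<psi> = ps @ [q] @ (q' # rs)" "cdom X \<psi> = (ps @ [q]) @ [q'] @ rs" using assms(2) by auto
  note f1 = paste_frame[OF assms(1) d(1) runit_cells[OF L(1)]]
    and f2 = paste_frame[OF assms(1) d(2) lunit_cells[OF L(2)]]
  have "paste X (paste X \<psi> ps (runit X q) (q' # rs)) (ps @ [q]) ?L (q' # rs) = \<psi>"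
    using paste_paste[OF assms(1) d(1), of "runit X q" "[cid X q, ?L]"] runit_cells[OF L(1)] L(1)
      runit_lid[OF L(1)] cells_glob[OF cid_cells[OF L(1)]] paste_cid[OF assms(1) d(1)]
    by (simp add: paste_sub)
  moreover have "paste X (paste X \<psi> (ps @ [q]) (lunit q') rs) (ps @ [q]) ?L (q' # rs) = \<psi>"
    using paste_paste[OF assms(1) d(2), of "lunit q'" "[?L, cid X q']"] lunit_cells[OF L(2)] L
      lunit_lid[OF L(2)] cells_glob[OF cid_cells[OF L(2)]] paste_cid[OF assms(1) d(2)] qq
    by (simp add: paste_sub)
  ultimately show ?thesis
    using f1 f2 L qq by - (rule lid_cancel[of "lsrc X q" _ _ "ps @ [q]" "q' # rs"], auto)
qed

section \<open>The product of 2-cells into loose-identities\<close>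

definition K :: "'t \<Rightarrow> 'l list \<Rightarrow> 't \<Rightarrow> 'c set" where
  "K x ps y = {\<psi> \<in> Cell X. cdom X \<psi> = ps \<and> ccod X \<psi> = lid X (tcod X x) \<and>
    cleft X \<psi> = x \<and> cright X \<psi> = y}"

definition hmul :: "'c \<Rightarrow> 'c \<Rightarrow> 'c"  (infixl \<open>\<star>\<close> 70) where
  "\<psi> \<star> \<chi> = ccomp X (lmult X (tcod X (cleft X \<psi>))) (cleft X \<psi>) [\<psi>, \<chi>]"

text \<open>The nullary form of the identity on \<open>x\<close>; it is the unit of the product at
  the boundary \<open>x\<close>.\<close>

definition hone :: "'t \<Rightarrow> 'c" where
  "hone x = ccomp X (lid_cell X (tcod X x)) x []"

lemma K_simps:
  assumes "\<psi> \<in> K x ps y"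
  shows "\<psi> \<in> Cell X" "cdom X \<psi> = ps" "ccod X \<psi> = lid X (tcod X x)" "cleft X \<psi> = x"
    "cright X \<psi> = y" "x \<in> Tight X" "y \<in> Tight X" "tcod X y = tcod X x"
    "chain X (tdom X x) ps (tdom X y)"
  using assms cdom_chain[of \<psi>] tcod_cright[of \<psi>] by (auto simp: K_def)

lemma K_Loose: "\<psi> \<in> K x ps y \<Longrightarrow> set ps \<subseteq> Loose X"
  using Cell_Loose K_simps by metis

lemma lmult_cells: "A \<in> Ob X \<Longrightarrow> lmult X A \<in> cells X [lid X A, lid X A] (lid X A)"
  using runit_cells[of "lid X A"] by (simp add: lmult_def)

lemma lmult_simps [simp]:
  assumes "A \<in> Ob X"
  shows "lmult X A \<in> Cell X" "cdom X (lmult X A) = [lid X A, lid X A]"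
    "ccod X (lmult X A) = lid X A" "cleft X (lmult X A) = tid X A" "cright X (lmult X A) = tid X A"
    "lmult X A \<in> glob"
  using lmult_cells[OF assms] assms cells_glob by (auto simp: cells_def)

lemma hmul_composable:
  assumes "\<psi> \<in> K x ps y" "\<chi> \<in> K y qs z"
  shows "composable X (lmult X (tcod X x)) x [\<psi>, \<chi>] z"
  using K_simps[OF assms(1)] K_simps[OF assms(2)] by (auto simp: composable_def)

lemma hmul_K:
  assumes "\<psi> \<in> K x ps y" "\<chi> \<in> K y qs z"
  shows "\<psi> \<star> \<chi> \<in> K x (ps @ qs) z"
  using ccomp_in[OF hmul_composable[OF assms]] ccomp_frame[OF hmul_composable[OF assms]]
    K_simps[OF assms(1)] K_simps[OF assms(2)] tcomp_tid(1)[of x] tcomp_tid(1)[of z]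
  by (auto simp: K_def hmul_def)

lemma hone_composable: "x \<in> Tight X \<Longrightarrow> composable X (lid_cell X (tcod X x)) x [] x"
  by (auto simp: composable_def)

lemma hone_K: "x \<in> Tight X \<Longrightarrow> hone x \<in> K x [] x"
  using ccomp_in[OF hone_composable] ccomp_frame[OF hone_composable]
  by (auto simp: K_def hone_def)

lemma sub_K:
  assumes "\<psi> \<in> K x (map (ccod X) \<alpha>s) y" "set \<alpha>s \<subseteq> glob"
  shows "sub \<psi> \<alpha>s \<in> K x (concat (map (cdom X) \<alpha>s)) y"
  using sub_frame[of \<psi> \<alpha>s] assms by (auto simp: K_def)

text \<open>Interchange in its general form: \<open>h'\<close> is the boundary between the two
  blocks and need not be an identity. The case of identity boundaries is \<open>sub_hmul\<close>;
  the general one serves the units of companions and conjoints.\<close>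

lemma hmul_ccomp:
  assumes "\<psi> \<in> K x (map (ccod X) \<alpha>s) y" "\<chi> \<in> K y (map (ccod X) \<beta>s) z"
    "juxt X h \<alpha>s h'" "juxt X h' \<beta>s k" "tcod X h = tdom X x"
  shows "ccomp X (\<psi> \<star> \<chi>) h (\<alpha>s @ \<beta>s) = ccomp X \<psi> h \<alpha>s \<star> ccomp X \<chi> h' \<beta>s"
proof -
  note k = K_simps[OF assms(1)] K_simps[OF assms(2)]
  have c: "composable X \<psi> h \<alpha>s h'" using k assms by (auto simp: composable_def)
  have "ccomp X (\<psi> \<star> \<chi>) h (concat [\<alpha>s, \<beta>s])
      = ccomp X (lmult X (tcod X x)) (tcomp X x h) (ccomps X [\<psi>, \<chi>] h [\<alpha>s, \<beta>s])"
    unfolding hmul_def k(4)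
    by (rule ccomp_assoc[OF hmul_composable[OF assms(1,2)]]) (use k assms juxt_append in auto)
  also have "ccomps X [\<psi>, \<chi>] h [\<alpha>s, \<beta>s] = [ccomp X \<psi> h \<alpha>s, ccomp X \<chi> h' \<beta>s]"
    using juxt_right[OF assms(3)] by auto
  finally show ?thesis
    using ccomp_frame[OF c] k juxt_Tight[OF assms(3)] assms(5) by (simp add: hmul_def tcod_tcomp)
qed

lemma sub_hmul:
  assumes "\<psi> \<in> K x (map (ccod X) \<alpha>s) y" "\<chi> \<in> K y (map (ccod X) \<beta>s) z"
    "set \<alpha>s \<subseteq> glob" "set \<beta>s \<subseteq> glob"
  shows "sub (\<psi> \<star> \<chi>) (\<alpha>s @ \<beta>s) = sub \<psi> \<alpha>s \<star> sub \<chi> \<beta>s"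
proof -
  note k = K_simps[OF assms(1)] K_simps[OF assms(2)]
  have "juxt X (tid X (tdom X x)) \<alpha>s (tid X (tdom X y))"
    "juxt X (tid X (tdom X y)) \<beta>s (tid X (tdom X z))"
    using k assms by (auto intro!: juxt_glob)
  from hmul_ccomp[OF assms(1,2) this] k K_simps(4)[OF hmul_K[OF assms(1,2)]]
  show ?thesis by (simp add: sub_def)
qed

text \<open>\<open>lmult\<close> is defined by its right unit law. After one more unit is pasted in,
  the left and right laws involve the same composite of \<open>lmult\<close> with two units, so the
  right law transfers to the left by cancelling that unit.\<close>

lemma lmult_lid_left:
  assumes "A \<in> Ob X"
  shows "sub (lmult X A) [lid_cell X A, cid X (lid X A)] = cid X (lid X A)"
proof -
  let ?l = "lid_cell X A" and ?m = "lmult X A" and ?i = "cid X (lid X A)"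
  have gi: "?i \<in> glob" using assms cells_glob[OF cid_cells] by simp
  have lr: "sub ?m [?i, ?l] = ?i" using runit_lid[of "lid X A"] assms by (simp add: lmult_def)
  have il: "sub ?i [?l] = ?l" using cid_sub[of ?l] assms by simp
  have ll: "sub ?l [] = ?l" using sub_cid[of ?l] assms by simp
  have "sub (sub ?m [?l, ?i]) [?l] = sub ?m [?l, ?l]"
    using sub_sub[of ?m "[?l, ?i]" "[[], [?l]]"] assms gi il ll by simp
  moreover have "sub (sub ?m [?i, ?l]) [?l] = sub ?m [?l, ?l]"
    using sub_sub[of ?m "[?i, ?l]" "[[?l], []]"] assms gi il ll by simp
  ultimately have "sub (sub ?m [?l, ?i]) [?l] = sub ?i [?l]" using lr by simp
  then show ?thesis
    using sub_frame[of ?m "[?l, ?i]"] gi assms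
    by - (rule lid_cancel[of A _ _ "[]" "[]"], auto simp: paste_sub)
qed

text \<open>Pasting a unit into the third position reduces either side to \<open>lmult\<close>, and
  the unit can be cancelled.\<close>

lemma lmult_assoc:
  assumes "A \<in> Ob X"
  shows "sub (lmult X A) [lmult X A, cid X (lid X A)] = sub (lmult X A) [cid X (lid X A), lmult X A]"
proof -
  let ?l = "lid_cell X A" and ?m = "lmult X A" and ?i = "cid X (lid X A)"
  have gi: "?i \<in> glob" using assms cells_glob[OF cid_cells] by simp
  have lr: "sub ?m [?i, ?l] = ?i" using runit_lid[of "lid X A"] assms by (simp add: lmult_def)
  have il: "sub ?i [?l] = ?l" "sub ?i [?i] = ?i" using cid_sub[of ?l] cid_sub[of ?i] assms gi by auto
  have mm: "sub ?m [?i, ?i] = ?m" using sub_cid[of ?m] assms by simp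
  have "sub (sub ?m [?m, ?i]) [?i, ?i, ?l] = sub ?m [?m, ?l]"
    using sub_sub[of ?m "[?m, ?i]" "[[?i, ?i], [?l]]"] assms gi il mm by simp
  also have "\<dots> = sub (sub ?m [?i, ?l]) [?m]"
    using sub_sub[of ?m "[?i, ?l]" "[[?m], []]"] assms gi sub_cid[of ?l] cid_sub[of ?m] by simp
  also have "\<dots> = ?m" using lr cid_sub[of ?m] assms by simp
  also have "\<dots> = sub (sub ?m [?i, ?m]) [?i, ?i, ?l]"
    using sub_sub[of ?m "[?i, ?m]" "[[?i], [?i, ?l]]"] assms gi il mm lr by simp
  finally show ?thesis
    using sub_frame[of ?m "[?m, ?i]"] sub_frame[of ?m "[?i, ?m]"] gi assms
    by - (rule lid_cancel[of A _ _ "[lid X A, lid X A]" "[]"], auto simp: paste_sub)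
qed

lemma ccomp_lid_K: "\<psi> \<in> K x ps y \<Longrightarrow> ccomp X (cid X (lid X (tcod X x))) x [\<psi>] = \<psi>"
  using ccomp_cid_left[of \<psi>] K_simps[of \<psi> x ps y] by simp

text \<open>Carries identities between substitutions into \<open>lmult\<close> over to
  juxtapositions with left boundary \<open>x\<close>. The unit and associativity laws of the product
  come from those of \<open>lmult\<close> in this way.\<close>

lemma ccomp_sub_lmult:
  assumes "A = tcod X x" "A \<in> Ob X" "set \<alpha>s \<subseteq> glob" "map (ccod X) \<alpha>s = [lid X A, lid X A]"
    "map (map (ccod X)) \<psi>ss = map (cdom X) \<alpha>s" "juxt X x (concat \<psi>ss) y"
  shows "ccomp X (sub (lmult X A) \<alpha>s) x (concat \<psi>ss) = ccomp X (lmult X A) x (ccomps X \<alpha>s x \<psi>ss)"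
proof -
  have "composable X (lmult X A) (tid X A) \<alpha>s (tid X A)"
    using sub_composable[of "lmult X A" \<alpha>s] assms by simp
  from ccomp_assoc[OF this assms(5,6)] show ?thesis
    using assms juxt_Tight[OF assms(6)] by (simp add: sub_def)
qed

lemma hmul_hone:
  assumes "\<psi> \<in> K x ps y"
  shows "\<psi> \<star> hone y = \<psi>" "hone x \<star> \<psi> = \<psi>"
proof -
  note k = K_simps[OF assms]
  let ?A = "tcod X x"
  have A: "?A \<in> Ob X" using k by simp
  have gi: "cid X (lid X ?A) \<in> glob" using A cells_glob[OF cid_cells] by simp
  note e = ccomp_sub_lmult[of ?A x]
  have "sub (lmult X ?A) [cid X (lid X ?A), lid_cell X ?A] = cid X (lid X ?A)"
    using runit_lid[of "lid X ?A"] A by (simp add: lmult_def)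
  with e[of "[cid X (lid X ?A), lid_cell X ?A]" "[[\<psi>], []]" y]
  show "\<psi> \<star> hone y = \<psi>" using k gi ccomp_lid_K[OF assms] by (simp add: hmul_def hone_def)
  have "sub (lmult X ?A) [lid_cell X ?A, cid X (lid X ?A)] = cid X (lid X ?A)"
    using lmult_lid_left A by simp
  with e[of "[lid_cell X ?A, cid X (lid X ?A)]" "[[], [\<psi>]]" y]
  show "hone x \<star> \<psi> = \<psi>"
    using k gi ccomp_lid_K[OF assms] K_simps(4)[OF hone_K, of x] by (simp add: hmul_def hone_def)
qed

lemma hmul_assoc:
  assumes "\<psi> \<in> K x ps y" "\<chi> \<in> K y qs z" "\<omega> \<in> K z rs w"
  shows "\<psi> \<star> \<chi> \<star> \<omega> = \<psi> \<star> (\<chi> \<star> \<omega>)"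
proof -
  note k = K_simps[OF assms(1)] K_simps[OF assms(2)] K_simps[OF assms(3)]
  let ?A = "tcod X x"
  let ?i = "cid X (lid X ?A)" and ?m = "lmult X ?A"
  have A: "?A \<in> Ob X" using k by simp
  have gi: "?i \<in> glob" using A cells_glob[OF cid_cells] by simp
  have "\<psi> \<star> \<chi> \<star> \<omega> = ccomp X (sub ?m [?m, ?i]) x [\<psi>, \<chi>, \<omega>]"
    using ccomp_sub_lmult[of ?A x "[?m, ?i]" "[[\<psi>, \<chi>], [\<omega>]]" w] k gi A
      K_simps(4)[OF hmul_K[OF assms(1,2)]] ccomp_lid_K[OF assms(3)]
    by (simp add: hmul_def)
  moreover have "\<psi> \<star> (\<chi> \<star> \<omega>) = ccomp X (sub ?m [?i, ?m]) x [\<psi>, \<chi>, \<omega>]"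
    using ccomp_sub_lmult[of ?A x "[?i, ?m]" "[[\<psi>], [\<chi>, \<omega>]]" w] k gi A
      ccomp_lid_K[OF assms(1)]
    by (simp add: hmul_def)
  ultimately show ?thesis using lmult_assoc[OF A] by simp
qed

section \<open>Restrictions of loose-identities\<close>

lemma rep_cell_restr:
  assumes "x \<in> Tight X" "y \<in> Tight X" "tcod X x = tcod X y"
  shows "is_restr_cell X (lid X (tcod X x)) x y (rep_cell X x y)"
  unfolding rep_cell_def restr_cell_def by (rule someI_ex, rule restrictions) (use assms in auto)

lemma
  assumes "x \<in> Tight X" "y \<in> Tight X" "tcod X x = tcod X y"
  shows rep_cell_cartesian: "cartesian X (rep_cell X x y)"
    and rep_cell_K: "rep_cell X x y \<in> K x [rep X x y] y"
    and rep_Loose: "rep X x y \<in> Loose X"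
    and ltgt_rep: "ltgt X (rep X x y) = tdom X x"
    and lsrc_rep: "lsrc X (rep X x y) = tdom X y"
proof -
  from rep_cell_restr[OF assms]
  have c: "cartesian X (rep_cell X x y)" "ccod X (rep_cell X x y) = lid X (tcod X x)"
    "cleft X (rep_cell X x y) = x" "cright X (rep_cell X x y) = y"
    by (auto simp: is_restr_cell_def)
  then have "rep_cell X x y \<in> Cell X" "cdom X (rep_cell X x y) = [rep X x y]"
    by (auto simp: cartesian_def rep_def rep_cell_def restr_def length_Suc_conv)
  with c show k: "rep_cell X x y \<in> K x [rep X x y] y" by (auto simp: K_def)
  show "cartesian X (rep_cell X x y)" by fact
  show "rep X x y \<in> Loose X" "ltgt X (rep X x y) = tdom X x" "lsrc X (rep X x y) = tdom X y"
    using K_simps(9)[OF k] by auto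
qed

lemmas rep_cell_simps = K_simps[OF rep_cell_K]

text \<open>The passage from \<open>K x ps y\<close> to 2-cells into \<open>E(x,y)\<close>, inverse
  to composing with the cartesian 2-cell. The cells \<open>frown\<close>, \<open>smile\<close>,
  \<open>rep_right\<close> and \<open>rep_left\<close> are all of this form.\<close>

definition sharp :: "'t \<Rightarrow> 't \<Rightarrow> 'c \<Rightarrow> 'c" where
  "sharp x y \<psi> = factor X (rep_cell X x y) (tid X (tdom X x)) (tid X (tdom X y)) \<psi>"

lemma rep_factor:
  assumes "x \<in> Tight X" "y \<in> Tight X" "f \<in> Tight X" "g \<in> Tight X"
    "tcod X f = tdom X x" "tcod X g = tdom X y" "\<psi> \<in> K (tcomp X x f) ps (tcomp X y g)"
    "tcod X x = tcod X y"
  shows "factor X (rep_cell X x y) f g \<psi> \<in> Cell X"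
    "cdom X (factor X (rep_cell X x y) f g \<psi>) = ps"
    "ccod X (factor X (rep_cell X x y) f g \<psi>) = rep X x y"
    "cleft X (factor X (rep_cell X x y) f g \<psi>) = f"
    "cright X (factor X (rep_cell X x y) f g \<psi>) = g"
    "ccomp X (rep_cell X x y) f [factor X (rep_cell X x y) f g \<psi>] = \<psi>"
proof -
  note k = K_simps[OF assms(7)] and r = rep_cell_simps[OF assms(1,2,8)]
  have "is_factor X (rep_cell X x y) f g \<psi> (factor X (rep_cell X x y) f g \<psi>)"
    by (rule factor[OF rep_cell_cartesian[OF assms(1,2,8)]])
      (use k(1-5) r(1-5) assms(1-6) in \<open>auto simp: tcod_tcomp\<close>)
  then show "factor X (rep_cell X x y) f g \<psi> \<in> Cell X"
    "cdom X (factor X (rep_cell X x y) f g \<psi>) = ps"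
    "ccod X (factor X (rep_cell X x y) f g \<psi>) = rep X x y"
    "cleft X (factor X (rep_cell X x y) f g \<psi>) = f"
    "cright X (factor X (rep_cell X x y) f g \<psi>) = g"
    "ccomp X (rep_cell X x y) f [factor X (rep_cell X x y) f g \<psi>] = \<psi>"
    using k r by (auto simp: is_factor_def vcomp_def)
qed

lemma
  assumes "\<psi> \<in> K x ps y"
  shows sharp_cells: "sharp x y \<psi> \<in> cells X ps (rep X x y)"
    and rep_cell_sharp: "sub (rep_cell X x y) [sharp x y \<psi>] = \<psi>"
proof -
  note k = K_simps[OF assms]
  have xy: "tcod X x = tcod X y" using k by simp
  note r = rep_cell_simps[OF k(6,7) xy]
  have "\<psi> \<in> K (tcomp X x (tid X (tdom X x))) ps (tcomp X y (tid X (tdom X y)))"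
    using assms k by simp
  from rep_factor[OF k(6,7) _ _ _ _ this xy]
  show "sharp x y \<psi> \<in> cells X ps (rep X x y)" "sub (rep_cell X x y) [sharp x y \<psi>] = \<psi>"
    using k r ltgt_rep[OF k(6,7) xy] lsrc_rep[OF k(6,7) xy]
    by (auto simp: sharp_def cells_def sub_def)
qed

lemma sub_rep_cell_K:
  assumes "x \<in> Tight X" "y \<in> Tight X" "tcod X x = tcod X y" "\<phi> \<in> cells X ps (rep X x y)"
  shows "sub (rep_cell X x y) [\<phi>] \<in> K x ps y"
  using sub_K[of "rep_cell X x y" x "[\<phi>]" y] rep_cell_K[OF assms(1-3)] assms(4) cells_glob[OF assms(4)]
  by (simp add: cells_simps)

lemma sub_rep_cell_cancel:
  assumes "x \<in> Tight X" "y \<in> Tight X" "tcod X x = tcod X y"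
    "\<phi> \<in> cells X ps (rep X x y)" "\<phi>' \<in> cells X ps (rep X x y)"
    "sub (rep_cell X x y) [\<phi>] = sub (rep_cell X x y) [\<phi>']"
  shows "\<phi> = \<phi>'"
  by (rule cartesian_cancel[OF rep_cell_cartesian[OF assms(1-3)]])
    (use assms(4-6) rep_cell_simps[OF assms(1-3)] ltgt_rep[OF assms(1-3)]
      in \<open>auto simp: cells_simps sub_def vcomp_def\<close>)

lemma sharp_eqI:
  assumes "\<phi> \<in> cells X ps (rep X x y)" "sub (rep_cell X x y) [\<phi>] = \<psi>" "\<psi> \<in> K x ps y"
  shows "sharp x y \<psi> = \<phi>"
  using sub_rep_cell_cancel[of x y "sharp x y \<psi>" ps \<phi>] assms K_simps[OF assms(3)]
    sharp_cells[OF assms(3)] rep_cell_sharp[OF assms(3)] by simp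

lemma hone_tid: "A \<in> Ob X \<Longrightarrow> hone (tid X A) = lid_cell X A"
  using sub_cid[of "lid_cell X A"] by (simp add: hone_def sub_def)

lemma cid_lid_K: "A \<in> Ob X \<Longrightarrow> cid X (lid X A) \<in> K (tid X A) [lid X A] (tid X A)"
  by (simp add: K_def)

lemma cids_K: "\<psi> \<in> K x ps y \<Longrightarrow> sub \<psi> (map (cid X) ps) = \<psi>"
  using sub_cid K_simps by metis

lemma K_glob_ctx: "\<psi> \<in> K x ps y \<Longrightarrow> set (map (cid X) ps) \<subseteq> glob \<and> map (ccod X) (map (cid X) ps) = ps"
  using K_Loose set_cid_glob map_ccod_cid by metis

text \<open>Both sides give \<open>\<chi>\<close> once the unit is pasted in at the right end, so
  they agree by cancellation. This translates unitors on loose-cells of the domain into the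
  product.\<close>

lemma paste_runit:
  assumes "\<chi> \<in> K x (ps @ [q]) (tid X A)" "A \<in> Ob X"
  shows "paste X \<chi> ps (runit X q) [] = \<chi> \<star> cid X (lid X A)"
proof -
  note k = K_simps[OF assms(1)]
  have q: "q \<in> Loose X" "lsrc X q = A" "tcod X x = A" using k assms(2) by (auto simp: chain_append)
  have c: "cid X (lid X A) \<in> K (tid X A) [lid X A] (tid X A)" using cid_lid_K assms(2) .
  note m = K_simps[OF hmul_K[OF assms(1) c]]
  have d: "cdom X \<chi> = ps @ [q] @ []" using k by simp
  note f = paste_frame[OF k(1) d runit_cells[OF q(1)]]
  have ccp: "set (map (cid X) (ps @ [q])) \<subseteq> glob \<and> map (ccod X) (map (cid X) (ps @ [q])) = ps @ [q]"
    using K_glob_ctx[OF assms(1)] .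
  have "sub (\<chi> \<star> cid X (lid X A)) (map (cid X) (ps @ [q]) @ [lid_cell X A])
      = sub \<chi> (map (cid X) (ps @ [q])) \<star> sub (cid X (lid X A)) [lid_cell X A]"
    by (rule sub_hmul[where y = "tid X A"]) (use assms ccp c in auto)
  also have "\<dots> = \<chi>"
    using cids_K[OF assms(1)] cid_sub[of "lid_cell X A"] assms(2) hmul_hone(1)[OF assms(1)] hone_tid by simp
  finally have "paste X (\<chi> \<star> cid X (lid X A)) (ps @ [q]) (lid_cell X A) [] = \<chi>"
    by (simp add: paste_sub)
  moreover have "paste X (paste X \<chi> ps (runit X q) []) (ps @ [q]) (lid_cell X A) [] = \<chi>"
    using paste_paste[OF k(1) d, of "runit X q" "[cid X q, lid_cell X A]"] runit_cells[OF q(1)] q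
      runit_lid[OF q(1)] cells_glob[OF cid_cells[OF q(1)]] paste_cid[OF k(1) d] assms(2)
    by (simp add: paste_sub)
  ultimately show ?thesis
    by - (rule lid_cancel[of A _ _ "ps @ [q]" "[]"], use f m k q assms(2) in auto)
qed

lemma paste_lunit:
  assumes "\<chi> \<in> K (tid X A) (q # rs) y" "A \<in> Ob X"
  shows "paste X \<chi> [] (lunit q) rs = cid X (lid X A) \<star> \<chi>"
proof -
  note k = K_simps[OF assms(1)]
  have q: "q \<in> Loose X" "ltgt X q = A" "tcod X y = A" using k assms(2) by auto
  have c: "cid X (lid X A) \<in> K (tid X A) [lid X A] (tid X A)" using cid_lid_K assms(2) .
  note m = K_simps[OF hmul_K[OF c assms(1)]]
  have d: "cdom X \<chi> = [] @ [q] @ rs" using k by simp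
  note f = paste_frame[OF k(1) d lunit_cells[OF q(1)]]
  have ccp: "set (map (cid X) (q # rs)) \<subseteq> glob \<and> map (ccod X) (map (cid X) (q # rs)) = q # rs"
    using K_glob_ctx[OF assms(1)] .
  have "sub (cid X (lid X A) \<star> \<chi>) ([lid_cell X A] @ map (cid X) (q # rs))
      = sub (cid X (lid X A)) [lid_cell X A] \<star> sub \<chi> (map (cid X) (q # rs))"
    by (rule sub_hmul[where y = "tid X A"]) (use assms ccp c in auto)
  also have "\<dots> = \<chi>"
    using cids_K[OF assms(1)] cid_sub[of "lid_cell X A"] assms(2) hmul_hone(2)[OF assms(1)] hone_tid by simp
  finally have "paste X (cid X (lid X A) \<star> \<chi>) [] (lid_cell X A) (q # rs) = \<chi>"
    by (simp add: paste_sub)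
  moreover have "paste X (paste X \<chi> [] (lunit q) rs) [] (lid_cell X A) (q # rs) = \<chi>"
    using paste_paste[OF k(1) d, of "lunit q" "[lid_cell X A, cid X q]"] lunit_cells[OF q(1)] q
      lunit_lid[OF q(1)] cells_glob[OF cid_cells[OF q(1)]] paste_cid[OF k(1) d] assms(2)
    by (simp add: paste_sub)
  ultimately show ?thesis
    by - (rule lid_cancel[of A _ _ "[]" "q # rs"], use f m k q assms(2) in auto)
qed

section \<open>Transposition along companions and conjoints\<close>

definition conjoint_unit :: "'t \<Rightarrow> 'c" where
  "conjoint_unit f = factor X (rep_cell X f (tid X (tcod X f))) (tid X (tdom X f)) f (hone f)"

lemma
  assumes "f \<in> Tight X"
  shows companion_unit:
    "companion_unit X f \<in> Cell X" "cdom X (companion_unit X f) = []"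
    "ccod X (companion_unit X f) = companion X f" "cleft X (companion_unit X f) = f"
    "cright X (companion_unit X f) = tid X (tdom X f)"
    "ccomp X (rep_cell X (tid X (tcod X f)) f) f [companion_unit X f] = hone f"
    and conjoint_unit:
    "conjoint_unit f \<in> Cell X" "cdom X (conjoint_unit f) = []"
    "ccod X (conjoint_unit f) = conjoint X f" "cright X (conjoint_unit f) = f"
    "cleft X (conjoint_unit f) = tid X (tdom X f)"
    "ccomp X (rep_cell X f (tid X (tcod X f))) (tid X (tdom X f)) [conjoint_unit f] = hone f"
proof -
  have E: "tcod X f \<in> Ob X" using assms by simp
  have c: "hone f \<in> K (tcomp X (tid X (tcod X f)) f) [] (tcomp X f (tid X (tdom X f)))"
    "hone f \<in> K (tcomp X f (tid X (tdom X f))) [] (tcomp X (tid X (tcod X f)) f)"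
    using hone_K assms by simp_all
  show "companion_unit X f \<in> Cell X" "cdom X (companion_unit X f) = []"
    "ccod X (companion_unit X f) = companion X f" "cleft X (companion_unit X f) = f"
    "cright X (companion_unit X f) = tid X (tdom X f)"
    "ccomp X (rep_cell X (tid X (tcod X f)) f) f [companion_unit X f] = hone f"
    using rep_factor[OF _ _ _ _ _ _ c(1)] assms E by (auto simp: companion_unit_def hone_def)
  show "conjoint_unit f \<in> Cell X" "cdom X (conjoint_unit f) = []"
    "ccod X (conjoint_unit f) = conjoint X f" "cright X (conjoint_unit f) = f"
    "cleft X (conjoint_unit f) = tid X (tdom X f)"
    "ccomp X (rep_cell X f (tid X (tcod X f))) (tid X (tdom X f)) [conjoint_unit f] = hone f"
    using rep_factor[OF _ _ _ _ _ _ c(2)] assms E by (auto simp: conjoint_unit_def)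
qed

lemma companion_rep:
  assumes "f \<in> Tight X"
  shows "rep_cell X (tid X (tcod X f)) f \<in> K (tid X (tcod X f)) [companion X f] f"
    "companion X f \<in> Loose X" "ltgt X (companion X f) = tcod X f" "lsrc X (companion X f) = tdom X f"
  using rep_cell_K[of "tid X (tcod X f)" f] rep_Loose[of "tid X (tcod X f)" f]
    ltgt_rep[of "tid X (tcod X f)" f] lsrc_rep[of "tid X (tcod X f)" f] assms by auto

lemma conjoint_rep:
  assumes "f \<in> Tight X"
  shows "rep_cell X f (tid X (tcod X f)) \<in> K f [conjoint X f] (tid X (tcod X f))"
    "conjoint X f \<in> Loose X" "ltgt X (conjoint X f) = tdom X f" "lsrc X (conjoint X f) = tcod X f"
  using rep_cell_K[of f "tid X (tcod X f)"] rep_Loose[of f "tid X (tcod X f)"]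
    ltgt_rep[of f "tid X (tcod X f)"] lsrc_rep[of f "tid X (tcod X f)"] assms by auto

lemma ccomp_rep_cell:
  assumes "x \<in> Tight X" "y \<in> Tight X" "tcod X x = tcod X y" "\<phi> \<in> cells X (map (ccod X) \<mu>s) (rep X x y)"
    "juxt X (tid X (tdom X x)) \<mu>s g"
  shows "ccomp X (rep_cell X x y) (tid X (tdom X x)) [ccomp X \<phi> (tid X (tdom X x)) \<mu>s]
    = ccomp X (sub (rep_cell X x y) [\<phi>]) (tid X (tdom X x)) \<mu>s"
proof -
  note r = rep_cell_simps[OF assms(1-3)] and lr = ltgt_rep[OF assms(1-3)] lsrc_rep[OF assms(1-3)]
  have c: "composable X (rep_cell X x y) (tid X (tdom X x)) [\<phi>] (tid X (tdom X y))"
    using assms(1,2,4) r lr by (simp add: composable_def cells_simps)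
  have A: "tdom X x \<in> Ob X" using assms(1) by simp
  show ?thesis
    using ccomp_assoc[OF c, of "[\<mu>s]" "tid X (tdom X x)" g] assms(4,5) A r tcomp_tid(1)[of "tid X (tdom X x)"]
    by (simp add: cells_simps sub_def)
qed

text \<open>After composition with the cartesian 2-cell, \<open>lunit\<close> becomes multiplication
  by the identity on the loose-identity, and the companion unit becomes \<open>hone f\<close>, which
  is neutral. The cartesian 2-cell is then cancelled.\<close>

lemma companion_zigzag:
  assumes "f \<in> Tight X"
  shows "ccomp X (lunit (companion X f)) (tid X (tcod X f))
    [rep_cell X (tid X (tcod X f)) f, companion_unit X f] = cid X (companion X f)"
proof -
  let ?E = "tcod X f" and ?q = "companion X f"
  let ?e = "rep_cell X (tid X ?E) f" and ?c = "companion_unit X f"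
  have E: "?E \<in> Ob X" using assms by simp
  note cr = companion_rep[OF assms] and cu = companion_unit[OF assms]
  note k = K_simps[OF cr(1)]
  have lu: "lunit ?q \<in> cells X (map (ccod X) [?e, ?c]) ?q" using lunit_cells[OF cr(2)] k cr cu E by simp
  have j: "juxt X (tid X ?E) [?e, ?c] (tid X (tdom X f))" using k cu assms by simp
  have cc: "composable X (lunit ?q) (tid X ?E) [?e, ?c] (tid X (tdom X f))"
    using lu j cr E assms by (simp add: composable_def cells_simps)
  have cl: "ccomp X (lunit ?q) (tid X ?E) [?e, ?c] \<in> cells X [?q] ?q"
    using ccomp_in[OF cc] ccomp_frame[OF cc] lu cr cu k E assms tcomp_tid(1)[of "tid X ?E"]
      tcomp_tid(1)[of "tid X (tdom X f)"] by (simp add: cells_def)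
  have "ccomp X ?e (tid X ?E) [ccomp X (lunit ?q) (tid X ?E) [?e, ?c]]
      = ccomp X (sub ?e [lunit ?q]) (tid X ?E) [?e, ?c]"
    using ccomp_rep_cell[OF _ _ _ lu] E assms j by simp
  also have "\<dots> = ccomp X (cid X (lid X ?E) \<star> ?e) (tid X ?E) ([?e] @ [?c])"
    using paste_lunit[of ?e ?E ?q "[]" f] cr(1) E by (simp add: paste_sub)
  also have "\<dots>
      = ccomp X (cid X (lid X ?E)) (tid X ?E) [?e] \<star> ccomp X ?e f [?c]"
    by (rule hmul_ccomp[where k = "tid X (tdom X f)"]) (use cid_lid_K[OF E] cr(1) E k cu assms in auto)
  also have "\<dots> = ?e" using ccomp_lid_K[OF cr(1)] cu(6) hmul_hone[OF cr(1)] E by simp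
  finally have "sub ?e [ccomp X (lunit ?q) (tid X ?E) [?e, ?c]] = sub ?e [cid X ?q]"
    using cids_K[OF cr(1)] k E by (simp add: sub_def)
  then show ?thesis
    using sub_rep_cell_cancel[OF _ _ _ cl cid_cells[OF cr(2)]] E assms by simp
qed

lemma conjoint_zigzag:
  assumes "f \<in> Tight X"
  shows "ccomp X (runit X (conjoint X f)) (tid X (tdom X f))
    [conjoint_unit f, rep_cell X f (tid X (tcod X f))] = cid X (conjoint X f)"
proof -
  let ?E = "tcod X f" and ?A = "tdom X f" and ?q = "conjoint X f"
  let ?e = "rep_cell X f (tid X ?E)" and ?c = "conjoint_unit f"
  have E: "?E \<in> Ob X" "?A \<in> Ob X" using assms by simp_all
  note cr = conjoint_rep[OF assms] and cu = conjoint_unit[OF assms]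
  note k = K_simps[OF cr(1)]
  have lu: "runit X ?q \<in> cells X (map (ccod X) [?c, ?e]) ?q" using runit_cells[OF cr(2)] k cr cu E by simp
  have j: "juxt X (tid X ?A) [?c, ?e] (tid X ?E)" using k cu assms by simp
  have cc: "composable X (runit X ?q) (tid X ?A) [?c, ?e] (tid X ?E)"
    using lu j cr E assms by (simp add: composable_def cells_simps)
  have cl: "ccomp X (runit X ?q) (tid X ?A) [?c, ?e] \<in> cells X [?q] ?q"
    using ccomp_in[OF cc] ccomp_frame[OF cc] lu cr cu k E assms tcomp_tid(1)[of "tid X ?E"]
      tcomp_tid(1)[of "tid X ?A"] by (simp add: cells_def)
  have "ccomp X ?e (tid X ?A) [ccomp X (runit X ?q) (tid X ?A) [?c, ?e]]
      = ccomp X (sub ?e [runit X ?q]) (tid X ?A) [?c, ?e]"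
    using ccomp_rep_cell[OF _ _ _ lu] E assms j by simp
  also have "\<dots> = ccomp X (?e \<star> cid X (lid X ?E)) (tid X ?A) ([?c] @ [?e])"
    using paste_runit[of ?e f "[]" ?q ?E] cr(1) E by (simp add: paste_sub)
  also have "\<dots>
      = ccomp X ?e (tid X ?A) [?c] \<star> ccomp X (cid X (lid X ?E)) f [?e]"
    by (rule hmul_ccomp[where k = "tid X ?E"]) (use cid_lid_K[OF E(1)] cr(1) E k cu assms in auto)
  also have "\<dots> = ?e" using ccomp_lid_K[OF cr(1)] cu(6) hmul_hone[OF cr(1)] E by simp
  finally have "sub ?e [ccomp X (runit X ?q) (tid X ?A) [?c, ?e]] = sub ?e [cid X ?q]"
    using cids_K[OF cr(1)] k E by (simp add: sub_def)
  then show ?thesis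
    using sub_rep_cell_cancel[OF _ _ _ cl cid_cells[OF cr(2)]] E assms by simp
qed

text \<open>The companion unit turns the first factor into \<open>hone x\<close>. Pasting it in is
  thus a left inverse of multiplication by that factor.\<close>

lemma companion_retract:
  assumes "\<psi> \<in> K x ps y"
  shows "ccomp X (rep_cell X (tid X (tcod X x)) x \<star> \<psi>) x (companion_unit X x # map (cid X) ps) = \<psi>"
proof -
  note k = K_simps[OF assms] and cr = companion_rep[OF k(6)] and cu = companion_unit[OF k(6)]
  have "ccomp X (rep_cell X (tid X (tcod X x)) x \<star> \<psi>) x ([companion_unit X x] @ map (cid X) ps)
      = ccomp X (rep_cell X (tid X (tcod X x)) x) x [companion_unit X x]
        \<star> ccomp X \<psi> (tid X (tdom X x)) (map (cid X) ps)"
  proof (rule hmul_ccomp[where x = "tid X (tcod X x)" and y = x and z = y and k = "tid X (tdom X y)"])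
    show "\<psi> \<in> K x (map (ccod X) (map (cid X) ps)) y" using assms K_glob_ctx[OF assms] by metis
  qed (use cu cr(1) k(6,7) juxt_cid[OF k(9)] in simp_all)
  also have "\<dots> = \<psi>" using cids_K[OF assms] hmul_hone[OF assms] by (simp add: sub_def k(4) cu(6))
  finally show ?thesis by simp
qed

lemma companion_transpose_inj:
  assumes "\<psi> \<in> K x ps y" "\<psi>' \<in> K x ps y"
    "rep_cell X (tid X (tcod X x)) x \<star> \<psi> = rep_cell X (tid X (tcod X x)) x \<star> \<psi>'"
  shows "\<psi> = \<psi>'"
  using companion_retract[OF assms(1)] companion_retract[OF assms(2)] assms(3) by metis

text \<open>The other round trip: the product is rewritten so that \<open>rep_cell\<close> and the
  companion unit lie under one \<open>lunit\<close>, where the zigzag identity applies. Both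
  directions together trade \<open>E(1,x)\<close> at the head of a domain for the left boundary
  \<open>x\<close>.\<close>

lemma companion_transpose_surj:
  assumes "\<chi> \<in> K (tid X (tcod X x)) (companion X x # ps) y" "x \<in> Tight X"
  shows "ccomp X \<chi> x (companion_unit X x # map (cid X) ps) \<in> K x ps y"
    "rep_cell X (tid X (tcod X x)) x \<star> ccomp X \<chi> x (companion_unit X x # map (cid X) ps) = \<chi>"
proof -
  note k = K_simps[OF assms(1)] and cr = companion_rep[OF assms(2)] and cu = companion_unit[OF assms(2)]
  note kr = K_simps[OF cr(1)]
  let ?E = "tcod X x" and ?q = "companion X x"
  let ?e = "rep_cell X (tid X ?E) x" and ?c = "companion_unit X x"
  have E: "?E \<in> Ob X" using assms by simp
  have ch: "chain X (tdom X x) ps (tdom X y)" using k(9) cr by auto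
  have L: "set ps \<subseteq> Loose X" using K_Loose[OF assms(1)] by simp
  have jc: "juxt X (tid X (tdom X x)) (map (cid X) ps) (tid X (tdom X y))" using juxt_cid[OF ch] .
  have j: "juxt X x (?c # map (cid X) ps) (tid X (tdom X y))" using jc cu by simp
  have c: "composable X \<chi> x (?c # map (cid X) ps) (tid X (tdom X y))"
    using j k cu map_ccod_cid[OF L] E by (simp add: composable_def)
  show K: "ccomp X \<chi> x (?c # map (cid X) ps) \<in> K x ps y"
    using ccomp_in[OF c] ccomp_frame[OF c] k cu concat_cdom_cid[OF L] assms(2) E by (simp add: K_def)
  have "?e \<star> ccomp X \<chi> x (?c # map (cid X) ps)
      = ccomp X (cid X (lid X ?E)) (tid X ?E) [?e] \<star> ccomp X \<chi> x (?c # map (cid X) ps)"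
    using ccomp_lid_K[OF cr(1)] E by simp
  also have "\<dots> = ccomp X (cid X (lid X ?E) \<star> \<chi>) (tid X ?E) ([?e] @ ?c # map (cid X) ps)"
    by (rule hmul_ccomp[OF _ _ _ j, where x = "tid X ?E" and y = "tid X ?E" and z = y, symmetric])
      (use cid_lid_K[OF E] assms E kr cu map_ccod_cid[OF L] in auto)
  also have "\<dots> = ccomp X (ccomp X \<chi> (tid X ?E) (map (cid X) [] @ [lunit ?q] @ map (cid X) ps))
      (tid X ?E) ([?e] @ ?c # map (cid X) ps)"
    using paste_lunit[OF assms(1) E] k E by (simp add: paste_def)
  also have "\<dots>
      = ccomp X \<chi> (tid X ?E) (cid X ?q # map (cid X) ps)"
    using ccomp_context[OF k(1), of "[]" "[lunit ?q]" ps "tid X ?E" "tid X ?E" "tid X (tdom X x)"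
        "tid X (tdom X y)" "[[?e, ?c]]" "tid X ?E" "tid X ?E" "tid X (tdom X x)" "tid X (tdom X y)"]
      k E kr cu jc lunit_cells[OF cr(2)] cr companion_zigzag[OF assms(2)] assms(2)
      tcomp_tid(1)[of "tid X ?E"]
    by (simp add: cells_simps)
  also have "\<dots> = \<chi>" using cids_K[OF assms(1)] k E by (simp add: sub_def)
  finally show "?e \<star> ccomp X \<chi> x (?c # map (cid X) ps) = \<chi>" .
qed

lemma conjoint_retract:
  assumes "\<psi> \<in> K x ps y"
  shows "ccomp X (\<psi> \<star> rep_cell X y (tid X (tcod X y))) (tid X (tdom X x))
    (map (cid X) ps @ [conjoint_unit y]) = \<psi>"
proof -
  note k = K_simps[OF assms] and cr = conjoint_rep[OF k(7)] and cu = conjoint_unit[OF k(7)]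
  have "ccomp X (\<psi> \<star> rep_cell X y (tid X (tcod X y))) (tid X (tdom X x))
      (map (cid X) ps @ [conjoint_unit y])
    = ccomp X \<psi> (tid X (tdom X x)) (map (cid X) ps) \<star>
      ccomp X (rep_cell X y (tid X (tcod X y))) (tid X (tdom X y)) [conjoint_unit y]"
  proof (rule hmul_ccomp[where x = x and y = y and z = "tid X (tcod X y)" and k = y])
    show "\<psi> \<in> K x (map (ccod X) (map (cid X) ps)) y" using assms K_glob_ctx[OF assms] by metis
  qed (use cu cr(1) k(6,7) juxt_cid[OF k(9)] in simp_all)
  also have "\<dots> = \<psi>" using cids_K[OF assms] hmul_hone[OF assms] by (simp add: sub_def k(4) cu(6))
  finally show ?thesis by simp
qed

lemma conjoint_transpose_inj:
  assumes "\<psi> \<in> K x ps y" "\<psi>' \<in> K x ps y"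
    "\<psi> \<star> rep_cell X y (tid X (tcod X y)) = \<psi>' \<star> rep_cell X y (tid X (tcod X y))"
  shows "\<psi> = \<psi>'"
  using conjoint_retract[OF assms(1)] conjoint_retract[OF assms(2)] assms(3) by metis

text \<open>Mirror image for conjoints: \<open>E(y,1)\<close> at the end of a domain is traded for
  the right boundary \<open>y\<close>.\<close>

lemma conjoint_transpose_surj:
  assumes "\<chi> \<in> K x (ps @ [conjoint X y]) (tid X (tcod X y))" "y \<in> Tight X"
  shows "ccomp X \<chi> (tid X (tdom X x)) (map (cid X) ps @ [conjoint_unit y]) \<in> K x ps y"
    "ccomp X \<chi> (tid X (tdom X x)) (map (cid X) ps @ [conjoint_unit y]) \<star> rep_cell X y (tid X (tcod X y)) = \<chi>"
proof -
  note k = K_simps[OF assms(1)] and cr = conjoint_rep[OF assms(2)] and cu = conjoint_unit[OF assms(2)]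
  note kr = K_simps[OF cr(1)]
  let ?E = "tcod X y" and ?q = "conjoint X y" and ?A = "tdom X x" and ?B = "tdom X y"
  let ?e = "rep_cell X y (tid X ?E)" and ?c = "conjoint_unit y"
  have E: "?E \<in> Ob X" "?A \<in> Ob X" "?B \<in> Ob X" "tcod X x = ?E" using assms k by simp_all
  have ch: "chain X ?A ps ?B" using k(9) cr by (auto simp: chain_append)
  have L: "set ps \<subseteq> Loose X" using K_Loose[OF assms(1)] by simp
  have jc: "juxt X (tid X ?A) (map (cid X) ps) (tid X ?B)" using juxt_cid[OF ch] .
  have j: "juxt X (tid X ?A) (map (cid X) ps @ [?c]) y" using jc cu assms(2) by (auto simp: juxt_append)
  have c: "composable X \<chi> (tid X ?A) (map (cid X) ps @ [?c]) y"
    using j k cu map_ccod_cid[OF L] E by (simp add: composable_def)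
  show K: "ccomp X \<chi> (tid X ?A) (map (cid X) ps @ [?c]) \<in> K x ps y"
    using ccomp_in[OF c] ccomp_frame[OF c] k cu concat_cdom_cid[OF L] assms(2) E by (simp add: K_def)
  have "ccomp X \<chi> (tid X ?A) (map (cid X) ps @ [?c]) \<star> ?e
      = ccomp X \<chi> (tid X ?A) (map (cid X) ps @ [?c]) \<star> ccomp X (cid X (lid X ?E)) y [?e]"
    using ccomp_lid_K[OF cr(1)] E by simp
  also have "\<dots> = ccomp X (\<chi> \<star> cid X (lid X ?E)) (tid X ?A) ((map (cid X) ps @ [?c]) @ [?e])"
    by (rule hmul_ccomp[OF _ _ j, where x = x and y = "tid X ?E" and z = "tid X ?E" and k = "tid X ?E", symmetric])
      (use cid_lid_K[OF E(1)] assms E(1-3) kr cu map_ccod_cid[OF L] in auto)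
  also have "\<dots> = ccomp X (ccomp X \<chi> (tid X ?A) (map (cid X) ps @ [runit X ?q] @ map (cid X) []))
      (tid X ?A) ((map (cid X) ps @ [?c]) @ [?e])"
    using paste_runit[OF assms(1) E(1)] k by (simp add: paste_def)
  also have "\<dots>
      = ccomp X \<chi> (tid X ?A) (map (cid X) ps @ [cid X ?q])"
    using ccomp_context[OF k(1), of ps "[runit X ?q]" "[]" "tid X ?A" "tid X ?B" "tid X ?E"
        "tid X ?E" "[[?c, ?e]]" "tid X ?A" "tid X ?B" "tid X ?E" "tid X ?E"]
      k E kr cu jc runit_cells[OF cr(2)] cr conjoint_zigzag[OF assms(2)] assms(2)
      tcomp_tid(1)[of "tid X ?A"]
    by (simp add: cells_simps)
  also have "\<dots> = \<chi>" using cids_K[OF assms(1)] k E by (simp add: sub_def)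
  finally show "ccomp X \<chi> (tid X ?A) (map (cid X) ps @ [?c]) \<star> ?e = \<chi>" .
qed

section \<open>Composites of conjoints with companions, and density\<close>

lemma smile_sharp:
  assumes "x \<in> Tight X" "t \<in> Tight X" "tcod X t = tcod X x"
  shows "smile X t x y = sharp x y (rep_cell X x t \<star> rep_cell X t y)"
  using rep_cell_simps(4)[OF assms(1,2)] assms(3) by (simp add: smile_def sharp_def hmul_def)

lemma
  assumes "x \<in> Tight X" "t \<in> Tight X" "y \<in> Tight X" "tcod X t = tcod X x" "tcod X y = tcod X x"
  shows smile_cells: "smile X t x y \<in> cells X [rep X x t, rep X t y] (rep X x y)"
    and rep_cell_smile: "sub (rep_cell X x y) [smile X t x y] = rep_cell X x t \<star> rep_cell X t y"
proof -
  have "rep_cell X x t \<star> rep_cell X t y \<in> K x ([rep X x t] @ [rep X t y]) y"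
    using hmul_K[of "rep_cell X x t" x "[rep X x t]" t] rep_cell_K assms by simp
  from sharp_cells[OF this] rep_cell_sharp[OF this] smile_sharp[OF assms(1,2,4)]
  show "smile X t x y \<in> cells X [rep X x t, rep X t y] (rep X x y)"
    "sub (rep_cell X x y) [smile X t x y] = rep_cell X x t \<star> rep_cell X t y" by simp_all
qed

text \<open>Pasting with \<open>smile\<close> is inverted by pasting with the cartesian 2-cell \<open>E(x,y) \<Rightarrow> E(x,1)\<close> next to
  the companion unit of \<open>y\<close>.\<close>

lemma opcartesian_smile:
  assumes "x \<in> Tight X" "y \<in> Tight X" "tcod X x = E" "tcod X y = E"
  shows "opcartesian X (smile X (tid X E) x y)"
proof -
  let ?q = "rep X x (tid X E)" and ?q' = "rep X (tid X E) y" and ?A = "tdom X x" and ?B = "tdom X y"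
  let ?e = "rep_cell X x (tid X E)" and ?e' = "rep_cell X (tid X E) y" and ?c = "companion_unit X y"
  let ?\<theta> = "smile X (tid X E) x y" and ?\<kappa> = "factor X (rep_cell X x (tid X E)) (tid X (tdom X x)) y (rep_cell X x y)"
  have E: "E \<in> Ob X" "?A \<in> Ob X" "?B \<in> Ob X" "tid X E \<in> Tight X" "tcod X (tid X E) = E"
    using assms tcod_in[OF assms(1)] by simp_all
  have xy: "tcod X x = tcod X y" using assms by simp
  have cr: "?e' \<in> K (tid X E) [?q'] y" "?q' \<in> Loose X" "ltgt X ?q' = E" "lsrc X ?q' = ?B"
    using companion_rep[OF assms(2)] assms(4) by simp_all
  have cj: "?e \<in> K x [?q] (tid X E)" "?q \<in> Loose X" "ltgt X ?q = ?A" "lsrc X ?q = E"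
    using conjoint_rep[OF assms(1)] assms(3) by simp_all
  have cu: "?c \<in> Cell X" "cdom X ?c = []" "ccod X ?c = ?q'" "cleft X ?c = y" "cright X ?c = tid X ?B"
    "ccomp X ?e' y [?c] = hone y"
    using companion_unit[OF assms(2)] assms(4) by simp_all
  have zz: "ccomp X (lunit ?q') (tid X E) [?e', ?c] = cid X ?q'"
    using companion_zigzag[OF assms(2)] assms(4) by simp
  note k = K_simps[OF cj(1)] and k' = K_simps[OF cr(1)]
  note r = rep_cell_K[OF assms(1,2) xy] rep_Loose[OF assms(1,2) xy] ltgt_rep[OF assms(1,2) xy]
    lsrc_rep[OF assms(1,2) xy]
  have rK: "rep_cell X x y \<in> K (tcomp X x (tid X ?A)) [rep X x y] (tcomp X (tid X E) y)"
    using r(1) assms(1,2,4) tcomp_tid(1)[OF assms(2)] by simp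
  have \<kappa>: "?\<kappa> \<in> Cell X" "cdom X ?\<kappa> = [rep X x y]" "ccod X ?\<kappa> = ?q" "cleft X ?\<kappa> = tid X ?A"
    "cright X ?\<kappa> = y" "ccomp X ?e (tid X ?A) [?\<kappa>] = rep_cell X x y"
    using rep_factor[OF assms(1) E(4) _ assms(2) _ _ rK] E assms by simp_all
  have \<theta>: "?\<theta> \<in> cells X [?q, ?q'] (rep X x y)" "sub (rep_cell X x y) [?\<theta>] = ?e \<star> ?e'"
    using smile_cells[OF assms(1) E(4) assms(2)] rep_cell_smile[OF assms(1) E(4) assms(2)] assms E by simp_all
  note \<theta>s = cells_simps[OF \<theta>(1)]
  have \<theta>g: "juxt X (tid X ?A) [?\<theta>] (tid X ?B)" using \<theta>s r E by simp
  have ru: "runit X ?q \<in> cells X [?q, lid X E] ?q" using runit_cells[OF cj(2)] cj by simp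
  note rus = cells_simps[OF ru]
  have jr: "juxt X (tid X ?A) [cid X ?q, ?e'] y" using cj k' assms by simp

  have cK1: "composable X ?e (tid X ?A) [?\<kappa>] y"
    using k(1-5) \<kappa>(1-5) E assms by (simp add: composable_def)
  have cK2: "composable X ?\<kappa> (tid X ?A) [?\<theta>] (tid X ?B)"
    using \<kappa>(1-5) \<theta>s r(2-4) E by (simp add: composable_def)
  have cK3: "composable X (runit X ?q) (tid X ?A) [cid X ?q, ?e'] y"
    using k'(1-5) E assms cj(2-4) rus by (simp add: composable_def)
  have cK4: "composable X ?e (tid X ?A) [runit X ?q] (tid X E)"
    using k(1-5) E cj(2-4) rus by (simp add: composable_def)
  have cK5: "composable X ?\<theta> (tid X ?A) [?\<kappa>, ?c] (tid X ?B)"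
    using \<kappa>(1-5) \<theta>s r(2-4) cu(1-5) E by (simp add: composable_def)
  note cK = cK1 cK2 cK3 cK4 cK5
  note fr = ccomp_frame[OF cK(2)] ccomp_frame[OF cK(3)] ccomp_frame[OF cK(5)]

  \<comment> \<open>\<open>L1\<close> and \<open>L2\<close> compute the two sides of
    \<open>\<kappa>\<theta>\<close> after the cartesian 2-cell of \<open>E(x,1)\<close>, where both
    become the product \<open>?e \<star> ?e'\<close>.\<close>
  have L1: "ccomp X ?e (tid X ?A) [ccomp X ?\<kappa> (tid X ?A) [?\<theta>]] = ?e \<star> ?e'"
  proof -
    have "ccomp X (ccomp X ?e (tid X ?A) [?\<kappa>]) (tid X ?A) (concat [[?\<theta>]])
        = ccomp X ?e (tcomp X (tid X ?A) (tid X ?A)) (ccomps X [?\<kappa>] (tid X ?A) [[?\<theta>]])"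
      by (rule ccomp_assoc[OF cK(1), where k = "tid X ?B"]) (use \<theta>g \<theta>s \<kappa> E in auto)
    then show ?thesis using \<kappa>(6) \<theta>(2) rep_cell_simps(4)[OF assms(1,2) xy] E tcomp_tid(1)[of "tid X ?A"]
      by (simp add: sub_def)
  qed
  have L2: "ccomp X ?e (tid X ?A) [ccomp X (runit X ?q) (tid X ?A) [cid X ?q, ?e']] = ?e \<star> ?e'"
  proof -
    have "ccomp X (ccomp X ?e (tid X ?A) [runit X ?q]) (tid X ?A) (concat [[cid X ?q, ?e']])
        = ccomp X ?e (tcomp X (tid X ?A) (tid X ?A)) (ccomps X [runit X ?q] (tid X ?A) [[cid X ?q, ?e']])"
      by (rule ccomp_assoc[OF cK(4), where k = y]) (use jr rus cj k' assms E in auto)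
    moreover have "ccomp X ?e (tid X ?A) [runit X ?q] = ?e \<star> cid X (lid X E)"
      using paste_runit[of ?e x "[]" ?q E] cj(1) E k by (simp add: paste_def)
    moreover have "ccomp X (?e \<star> cid X (lid X E)) (tid X ?A) ([cid X ?q] @ [?e'])
        = ccomp X ?e (tid X ?A) [cid X ?q] \<star> ccomp X (cid X (lid X E)) (tid X E) [?e']"
      by (rule hmul_ccomp[where x = x and y = "tid X E" and z = "tid X E" and k = y])
        (use cj cr(1) k' cid_lid_K[OF E(1)] E assms in simp_all)
    moreover have "ccomp X (cid X (lid X E)) (tid X E) [?e'] = ?e'" using ccomp_lid_K[OF cr(1)] E by simp
    moreover have "ccomp X ?e (tid X ?A) [cid X ?q] = ?e" using cids_K[OF cj(1)] k(4) by (simp add: sub_def)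
    ultimately show ?thesis using E tcomp_tid(1)[of "tid X ?A"] by simp
  qed
  \<comment> \<open>Without the companion unit beside it, this round trip is not yet an identity: it
    turns \<open>E(1,y)\<close> into a loose-identity that is absorbed by
    \<open>E(x,1)\<close>.\<close>
  have \<kappa>\<theta>: "ccomp X ?\<kappa> (tid X ?A) [?\<theta>] = ccomp X (runit X ?q) (tid X ?A) [cid X ?q, ?e']"
  proof (rule cartesian_cancel[OF rep_cell_cartesian[OF assms(1) E(4)]])
    have t: "cleft X (ccomp X ?\<kappa> (tid X ?A) [?\<theta>]) = tid X ?A"
      "cleft X (ccomp X (runit X ?q) (tid X ?A) [cid X ?q, ?e']) = tid X ?A"
      using fr \<kappa>(4) rus cj E tcomp_tid(1)[of "tid X ?A"] by simp_all
    then show "vcomp X ?e (ccomp X ?\<kappa> (tid X ?A) [?\<theta>])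
      = vcomp X ?e (ccomp X (runit X ?q) (tid X ?A) [cid X ?q, ?e'])"
      using L1 L2 unfolding vcomp_def by simp
    show "cleft X (ccomp X ?\<kappa> (tid X ?A) [?\<theta>])
      = cleft X (ccomp X (runit X ?q) (tid X ?A) [cid X ?q, ?e'])" using t by simp
    show "cright X (ccomp X ?\<kappa> (tid X ?A) [?\<theta>])
      = cright X (ccomp X (runit X ?q) (tid X ?A) [cid X ?q, ?e'])"
      using fr \<kappa>(5) rus cj E tcomp_tid(1)[OF assms(2)] tcomp_tid(2)[OF assms(2)] assms(4) by simp
  qed (use fr ccomp_in[OF cK(2)] ccomp_in[OF cK(3)] \<kappa>(3) \<theta>s rus k k' cj E assms(3) in simp_all)

  have \<theta>\<kappa>: "ccomp X ?\<theta> (tid X ?A) [?\<kappa>, ?c] = cid X (rep X x y)"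
  proof (rule sub_rep_cell_cancel[OF assms(1,2) xy])
    show cl: "ccomp X ?\<theta> (tid X ?A) [?\<kappa>, ?c] \<in> cells X [rep X x y] (rep X x y)"
      using ccomp_in[OF cK(5)] fr \<theta>s \<kappa>(2) cu(2) r E tcomp_tid(1)[of "tid X ?A"] tcomp_tid(1)[of "tid X ?B"]
      by (simp add: cells_def)
    show "cid X (rep X x y) \<in> cells X [rep X x y] (rep X x y)" using cid_cells r by simp
    have "sub (rep_cell X x y) [ccomp X ?\<theta> (tid X ?A) [?\<kappa>, ?c]]
        = ccomp X (sub (rep_cell X x y) [?\<theta>]) (tid X ?A) [?\<kappa>, ?c]"
      using ccomp_rep_cell[OF assms(1,2) xy, of ?\<theta> "[?\<kappa>, ?c]" "tid X ?B"] \<theta>(1) \<kappa>(1-5) cu(1-5) E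
        rep_cell_simps(4)[OF assms(1,2) xy] by (simp add: sub_def)
    also have "\<dots> = ccomp X (?e \<star> ?e') (tid X ?A) ([?\<kappa>] @ [?c])" using \<theta>(2) by simp
    also have "\<dots> = ccomp X ?e (tid X ?A) [?\<kappa>] \<star> ccomp X ?e' y [?c]"
      by (rule hmul_ccomp[where x = x and y = "tid X E" and z = y and k = "tid X ?B"])
        (use cj(1) cr(1) \<kappa>(1-5) cu(1-5) E assms in simp_all)
    also have "\<dots> = rep_cell X x y" using \<kappa>(6) cu(6) hmul_hone[OF r(1)] by simp
    also have "\<dots> = sub (rep_cell X x y) [cid X (rep X x y)]" using cids_K[OF r(1)] by simp
    finally show "sub (rep_cell X x y) [ccomp X ?\<theta> (tid X ?A) [?\<kappa>, ?c]]
      = sub (rep_cell X x y) [cid X (rep X x y)]" .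
  qed

  have "\<exists>!\<psi>'. is_opfactor X ?\<theta> ps \<psi> rs \<psi>'"
    if \<psi>: "\<psi> \<in> Cell X" "cdom X \<psi> = ps @ [?q, ?q'] @ rs" for \<psi> ps rs
  proof -
    let ?L = "tdom X (cleft X \<psi>)" and ?R = "tdom X (cright X \<psi>)"
    have O: "?L \<in> Ob X" "?R \<in> Ob X" using \<psi> by simp_all
    have ch: "chain X ?L ps ?A" "chain X ?B rs ?R"
      using cdom_chain[OF \<psi>(1)] \<psi>(2) cj cr by (auto simp: chain_append)
    note j = juxt_cid[OF ch(1)] juxt_cid[OF ch(2)]
    have L: "set ps \<subseteq> Loose X" "set rs \<subseteq> Loose X" using Cell_Loose[OF \<psi>(1)] \<psi>(2) by auto
    have j\<kappa>: "juxt X (tid X ?A) [?\<kappa>, ?c] (tid X ?B)" using \<kappa> cu E by simp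
    let ?w = "map (cid X) ps @ [?\<kappa>, ?c] @ map (cid X) rs"
    let ?\<psi>' = "ccomp X \<psi> (tid X ?L) ?w"
    have c: "composable X \<psi> (tid X ?L) ?w (tid X ?R)"
      unfolding composable_def
    proof (intro conjI)
      show "juxt X (tid X ?L) ?w (tid X ?R)" using j j\<kappa> juxt_append by blast
      show "map (ccod X) ?w = cdom X \<psi>"
        using map_ccod_cid[OF L(1)] map_ccod_cid[OF L(2)] \<psi>(2) \<kappa>(3) cu(3) by simp
    qed (use \<psi> O in simp_all)
    note f = ccomp_in[OF c] ccomp_frame[OF c]
    have fr': "?\<psi>' \<in> Cell X" "cdom X ?\<psi>' = ps @ [rep X x y] @ rs" "ccod X ?\<psi>' = ccod X \<psi>"
      "cleft X ?\<psi>' = cleft X \<psi>" "cright X ?\<psi>' = cright X \<psi>"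
      using f \<psi> concat_cdom_cid[OF L(1)] concat_cdom_cid[OF L(2)] \<kappa>(2) cu(2) by simp_all
    have tt: "tcomp X (tid X ?L) (tid X ?L) = tid X ?L" using tcomp_tid(1)[of "tid X ?L"] O by simp
    \<comment> \<open>The companion unit is nullary, so its block in the associativity law is
      empty.\<close>
    have cc: "ccomp X ?c (tid X ?B) [] = ?c" using ccomp_cid_right[OF cu(1)] cu(2,4) by simp
    have d: "cdom X \<psi> = ps @ ?q # ?q' # rs" using \<psi>(2) by simp
    have gs: "ccod X ?\<theta> = rep X x y" "cdom X ?\<theta> = [?q, ?q']" using \<theta>s by auto
    have lu: "lunit ?q' \<in> cells X [lid X E, ?q'] ?q'" using lunit_cells[OF cr(2)] cr(3) by simp
    note lus = cells_simps[OF lu]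
    have "paste X ?\<psi>' ps ?\<theta> rs
        = ccomp X ?\<psi>' (tid X ?L) (map (cid X) ps @ concat [[?\<theta>], []] @ map (cid X) rs)"
      using fr' by (simp add: paste_def)
    also have "\<dots> = ccomp X \<psi> (tcomp X (tid X ?L) (tid X ?L))
        (map (cid X) ps @ ccomps X [?\<kappa>, ?c] (tid X ?A) [[?\<theta>], []] @ map (cid X) rs)"
      by (rule ccomp_context[OF \<psi>(1) _ j(1) j\<kappa> j(2) _ _ j(1) _ j(2)])
        (use \<psi>(2) \<kappa> cu \<theta>g O gs in auto)
    also have "\<dots> = ccomp X \<psi> (tcomp X (tid X ?L) (tid X ?L)) (map (cid X) ps @
        [ccomp X (runit X ?q) (tid X ?A) [cid X ?q, ?e'], ?c] @ map (cid X) rs)"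
      using \<kappa>\<theta> cc \<theta>s(5) r by simp
    also have "\<dots> = ccomp X \<psi> (tcomp X (tid X ?L) (tid X ?L)) (map (cid X) ps @
        ccomps X [runit X ?q, cid X ?q'] (tid X ?A) [[cid X ?q, ?e'], [?c]] @ map (cid X) rs)"
      using ccomp_cid_left[OF cu(1)] cu(3,4) k'(5) by simp
    also have "\<dots> = ccomp X (ccomp X \<psi> (tid X ?L) (map (cid X) ps @ [runit X ?q, cid X ?q'] @ map (cid X) rs))
        (tid X ?L) (map (cid X) ps @ concat [[cid X ?q, ?e'], [?c]] @ map (cid X) rs)"
      by (rule ccomp_context[OF \<psi>(1) _ j(1) _ j(2) _ _ j(1) _ j(2), symmetric])
        (use \<psi>(2) rus cj cr(2-4) k' cu(1-5) O E assms in simp_all)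
    \<comment> \<open>The loose-identity between \<open>?q\<close> and \<open>?q'\<close> is now
      absorbed by \<open>?q'\<close> instead, so that \<open>?e'\<close> and the companion unit come
      to lie under a single \<open>lunit\<close> and cancel by \<open>zz\<close>.\<close>
    also have "ccomp X \<psi> (tid X ?L) (map (cid X) ps @ [runit X ?q, cid X ?q'] @ map (cid X) rs)
        = ccomp X \<psi> (tid X ?L) (map (cid X) (ps @ [?q]) @ [lunit ?q'] @ map (cid X) rs)"
      using unitor_exchange[OF \<psi>(1) d] by (simp add: paste_def)
    also have "ccomp X (ccomp X \<psi> (tid X ?L) (map (cid X) (ps @ [?q]) @ [lunit ?q'] @ map (cid X) rs))
        (tid X ?L) (map (cid X) ps @ concat [[cid X ?q, ?e'], [?c]] @ map (cid X) rs)
      = ccomp X (ccomp X \<psi> (tid X ?L) (map (cid X) (ps @ [?q]) @ [lunit ?q'] @ map (cid X) rs))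
        (tid X ?L) (map (cid X) (ps @ [?q]) @ concat [[?e', ?c]] @ map (cid X) rs)" by simp
    also have "\<dots> = ccomp X \<psi> (tcomp X (tid X ?L) (tid X ?L)) (map (cid X) (ps @ [?q]) @
        ccomps X [lunit ?q'] (tid X E) [[?e', ?c]] @ map (cid X) rs)"
    proof (rule ccomp_context[OF \<psi>(1) _ _ _ j(2) _ _ _ _ j(2)])
      have "chain X ?L (ps @ [?q]) E" using ch(1) cj E by (auto simp: chain_append)
      from juxt_cid[OF this] juxt_cid[OF this] show "juxt X (tid X ?L) (map (cid X) (ps @ [?q])) (tid X E)"
        "juxt X (tid X ?L) (map (cid X) (ps @ [?q])) (tid X E)" .
    qed (use \<psi>(2) lus cr(2-4) k' cu(1-5) O E assms in simp_all)
    also have "\<dots> = \<psi>" using zz ccomp_cid_right[OF \<psi>(1)] \<psi>(2) tt by simp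
    finally have ex: "is_opfactor X ?\<theta> ps \<psi> rs ?\<psi>'"
      using fr' \<theta>s(3) by (simp add: is_opfactor_def)
    \<comment> \<open>A factorization is recovered from \<open>\<psi>\<close> by pasting in
      \<open>?\<kappa>\<close> and the companion unit, since \<open>\<theta>\<kappa>\<close> is an
      identity.\<close>
    have "\<psi>'' = ?\<psi>'" if "is_opfactor X ?\<theta> ps \<psi> rs \<psi>''" for \<psi>''
    proof -
      have f'': "\<psi>'' \<in> Cell X" "cdom X \<psi>'' = ps @ [rep X x y] @ rs" "cleft X \<psi>'' = cleft X \<psi>"
        "paste X \<psi>'' ps ?\<theta> rs = \<psi>"
        using that \<theta>s(3) by (auto simp: is_opfactor_def)
      have "?\<psi>' = ccomp X (ccomp X \<psi>'' (tid X ?L) (map (cid X) ps @ [?\<theta>] @ map (cid X) rs))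
          (tid X ?L) (map (cid X) ps @ concat [[?\<kappa>, ?c]] @ map (cid X) rs)"
        using f''(3,4) by (simp add: paste_def)
      also have "\<dots> = ccomp X \<psi>'' (tcomp X (tid X ?L) (tid X ?L)) (map (cid X) ps @
          ccomps X [?\<theta>] (tid X ?A) [[?\<kappa>, ?c]] @ map (cid X) rs)"
        by (rule ccomp_context[OF f''(1) _ j(1) \<theta>g j(2) _ _ j(1) _ j(2)])
          (use f'' \<theta>s j\<kappa> \<kappa>(3) cu(3) O E in simp_all)
      also have "\<dots> = \<psi>''" using \<theta>\<kappa> tt ccomp_cid_right[OF f''(1)] f''(2,3) by simp
      finally show ?thesis by simp
    qed
    with ex show ?thesis by blast
  qed
  then show ?thesis using \<theta>(1) \<theta>s(2,3) by (simp add: opcartesian_def)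
qed

lemma paste_K: "\<psi> \<in> K x (ps @ [q] @ rs) y \<Longrightarrow> \<phi> \<in> cells X as q \<Longrightarrow> paste X \<psi> ps \<phi> rs \<in> K x (ps @ as @ rs) y"
  using paste_frame[of \<psi> ps q rs \<phi> as] by (auto simp: K_def)

section \<open>Density as invertibility of multiplication by \<open>rep_cell X j g\<close>\<close>

context
  fixes j :: 't and A E :: 'o
  assumes j: "j \<in> tights X A E" and dense: "dense X j"
begin

text \<open>Composing with the cartesian 2-cell of \<open>E(j,1)\<close> turns the map in the
  definition of density into left multiplication by that cell, because \<open>runit\<close> becomes
  a product by \<open>paste_runit\<close>.\<close>

lemma dense_base:
  assumes "chain X E rs E"
  shows "\<chi> \<in> K j (conjoint X j # rs) (tid X E) \<Longrightarrow> \<exists>\<phi>\<in>K (tid X E) rs (tid X E). rep_cell X j (tid X E) \<star> \<phi> = \<chi>"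
    and "\<phi> \<in> K (tid X E) rs (tid X E) \<Longrightarrow> \<phi>' \<in> K (tid X E) rs (tid X E) \<Longrightarrow>
      rep_cell X j (tid X E) \<star> \<phi> = rep_cell X j (tid X E) \<star> \<phi>' \<Longrightarrow> \<phi> = \<phi>'"
proof -
  have jt: "j \<in> Tight X" "tdom X j = A" "tcod X j = E" using j by (auto simp: tights_def)
  let ?e = "rep_cell X j (tid X E)" and ?q = "rep X j (tid X E)"
  have E: "E \<in> Ob X" "A \<in> Ob X" using jt tcod_in[OF jt(1)] tdom_in[OF jt(1)] by auto
  have cj: "?e \<in> K j [?q] (tid X E)" "?q \<in> Loose X" "ltgt X ?q = A" "lsrc X ?q = E"
    using conjoint_rep[OF jt(1)] jt by simp_all
  have KK: "cells X rs (lid X E) = K (tid X E) rs (tid X E)" using E by (auto simp: cells_def K_def)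
  let ?f = "\<lambda>\<phi>. sub (runit X ?q) [cid X ?q, \<phi>]"
  have ru: "runit X ?q \<in> cells X [?q, lid X E] ?q" using runit_cells[OF cj(2)] cj by simp
  note rus = cells_simps[OF ru]
  have f: "ccomp X (runit X ?q) (tid X A) [cid X ?q, \<phi>] = ?f \<phi>" for \<phi>
    using rus cj(3) E by (simp add: sub_def)
  have bij: "bij_betw ?f (K (tid X E) rs (tid X E)) (cells X (?q # rs) ?q)"
  proof -
    have "bij_betw (\<lambda>\<phi>. ccomp X (runit X ?q) (tid X A) [cid X ?q, \<phi>]) (cells X rs (lid X E)) (cells X (?q # rs) ?q)"
      using dense assms by (simp add: dense_def jt)
    then show ?thesis unfolding f KK .
  qed
  have star: "sub ?e [?f \<phi>] = ?e \<star> \<phi>" if \<phi>: "\<phi> \<in> K (tid X E) rs (tid X E)" for \<phi>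
  proof -
    have g: "\<phi> \<in> glob" using \<phi> KK cells_glob by blast
    have cg: "cid X ?q \<in> glob" "runit X ?q \<in> glob" using cells_glob[OF cid_cells[OF cj(2)]] cells_glob[OF ru] .
    note ks = K_simps[OF cj(1)] and kp = K_simps[OF \<phi>]
    have "sub (sub ?e [runit X ?q]) (concat [[cid X ?q, \<phi>]]) = sub ?e (map2 sub [runit X ?q] [[cid X ?q, \<phi>]])"
      by (rule sub_sub) (use ks kp cg g rus cj E in auto)
    moreover have "sub ?e [runit X ?q] = ?e \<star> cid X (lid X E)"
      using paste_runit[of ?e j "[]" ?q E] cj(1) E by (simp add: paste_sub)
    moreover have "sub (?e \<star> cid X (lid X E)) ([cid X ?q] @ [\<phi>]) = sub ?e [cid X ?q] \<star> sub (cid X (lid X E)) [\<phi>]"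
      by (rule sub_hmul) (use cj cid_lid_K[OF E(1)] kp cg g E in auto)
    moreover have "sub (cid X (lid X E)) [\<phi>] = \<phi>" using cid_sub[OF g] kp E by simp
    moreover have "sub ?e [cid X ?q] = ?e" using cids_K[OF cj(1)] by simp
    ultimately show ?thesis by simp
  qed
  show "\<exists>\<phi>\<in>K (tid X E) rs (tid X E). ?e \<star> \<phi> = \<chi>" if \<chi>: "\<chi> \<in> K j (conjoint X j # rs) (tid X E)" for \<chi>
  proof -
    have "sharp j (tid X E) \<chi> \<in> cells X (?q # rs) ?q" using sharp_cells[OF \<chi>] jt by simp
    then have "sharp j (tid X E) \<chi> \<in> ?f ` K (tid X E) rs (tid X E)"
      using bij by (simp add: bij_betw_def)
    then obtain \<phi> where \<phi>: "sharp j (tid X E) \<chi> = ?f \<phi>" "\<phi> \<in> K (tid X E) rs (tid X E)"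
      by (rule imageE)
    have "?e \<star> \<phi> = \<chi>" using star[OF \<phi>(2)] rep_cell_sharp[OF \<chi>] \<phi>(1) by simp
    with \<phi>(2) show ?thesis by blast
  qed
  show "\<phi> = \<phi>'" if "\<phi> \<in> K (tid X E) rs (tid X E)" "\<phi>' \<in> K (tid X E) rs (tid X E)"
    "?e \<star> \<phi> = ?e \<star> \<phi>'" for \<phi> \<phi>'
  proof -
    have "?f \<phi> \<in> cells X (?q # rs) ?q" "?f \<phi>' \<in> cells X (?q # rs) ?q"
      using bij that unfolding bij_betw_def by blast+
    moreover have "sub ?e [?f \<phi>] = sub ?e [?f \<phi>']" using star that by metis
    ultimately have "?f \<phi> = ?f \<phi>'"
      using sub_rep_cell_cancel[OF jt(1) tid_Tight[OF E(1)]] jt(3) tcod_tid[OF E(1)] by presburger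
    then show ?thesis using bij that by (auto simp: bij_betw_def inj_on_def)
  qed
qed

text \<open>Transposition along the companion of \<open>g\<close> and the conjoint of \<open>h\<close> (the map \<open>T\<close>), together with
  \<open>E(j,g) = E(j,1) \<odot> E(1,g)\<close> (the map \<open>P\<close>), reduces these to the definition of density.\<close>

lemma
  assumes "g \<in> Tight X" "h \<in> Tight X" "tcod X g = E" "tcod X h = E" "chain X (tdom X g) rs (tdom X h)"
  shows dense_surj: "\<chi> \<in> K j (rep X j g # rs) h \<Longrightarrow> \<exists>\<phi>\<in>K g rs h. rep_cell X j g \<star> \<phi> = \<chi>"
    and dense_inj: "\<phi> \<in> K g rs h \<Longrightarrow> \<phi>' \<in> K g rs h \<Longrightarrow>
      rep_cell X j g \<star> \<phi> = rep_cell X j g \<star> \<phi>' \<Longrightarrow> \<phi> = \<phi>'"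
proof -
  have jt: "j \<in> Tight X" "tdom X j = A" "tcod X j = E" using j by (auto simp: tights_def)
  have E: "E \<in> Ob X" "A \<in> Ob X" "tid X E \<in> Tight X" "tcod X (tid X E) = E"
    using jt tcod_in[OF jt(1)] tdom_in[OF jt(1)] by auto
  let ?ej = "rep_cell X j (tid X E)" and ?e = "rep_cell X j g" and ?eg = "rep_cell X (tid X E) g"
    and ?eh = "rep_cell X h (tid X E)" and ?qj = "rep X j (tid X E)" and ?q = "rep X j g"
    and ?qg = "rep X (tid X E) g" and ?qh = "rep X h (tid X E)"
  have eg: "?eg \<in> K (tid X E) [?qg] g" "?qg \<in> Loose X" "ltgt X ?qg = E" "lsrc X ?qg = tdom X g"
    using companion_rep[OF assms(1)] assms(3) by simp_all
  have eh: "?eh \<in> K h [?qh] (tid X E)" "?qh \<in> Loose X" "ltgt X ?qh = tdom X h" "lsrc X ?qh = E"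
    using conjoint_rep[OF assms(2)] assms(4) by simp_all
  have ej: "?ej \<in> K j [?qj] (tid X E)" using conjoint_rep[OF jt(1)] jt by simp_all
  have jg: "tcod X j = tcod X g" using jt assms by simp
  note e = rep_cell_K[OF jt(1) assms(1) jg]
  have sm: "smile X (tid X E) j g \<in> cells X [?qj, ?qg] ?q"
    "sub ?e [smile X (tid X E) j g] = ?ej \<star> ?eg"
    using smile_cells[OF jt(1) E(3) assms(1)] rep_cell_smile[OF jt(1) E(3) assms(1)] jt E assms by simp_all
  define T where "T \<phi> = ?eg \<star> (\<phi> \<star> ?eh)" for \<phi>
  define P where "P \<chi> = paste X (\<chi> \<star> ?eh) [] (smile X (tid X E) j g) (rs @ [?qh])" for \<chi>
  have ch: "chain X E (?qg # rs @ [?qh]) E" using assms(5) eg eh E by (auto simp: chain_append)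
  have TK: "T \<phi> \<in> K (tid X E) (?qg # rs @ [?qh]) (tid X E)" if "\<phi> \<in> K g rs h" for \<phi>
    using hmul_K[OF eg(1) hmul_K[OF that eh(1)]] by (simp add: T_def)
  have T_inj: "\<phi> = \<phi>'" if "\<phi> \<in> K g rs h" "\<phi>' \<in> K g rs h" "T \<phi> = T \<phi>'" for \<phi> \<phi>'
  proof -
    have "\<phi> \<star> ?eh = \<phi>' \<star> ?eh"
      using companion_transpose_inj[OF hmul_K[OF that(1) eh(1)] hmul_K[OF that(2) eh(1)]] that(3) assms(3)
      by (simp add: T_def)
    then show ?thesis using conjoint_transpose_inj[OF that(1,2)] assms(4) by simp
  qed
  have T_surj: "\<exists>\<phi>\<in>K g rs h. T \<phi> = \<omega>" if \<omega>: "\<omega> \<in> K (tid X E) (?qg # rs @ [?qh]) (tid X E)" for \<omega>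
  proof -
    obtain \<omega>' where 1: "\<omega>' \<in> K g (rs @ [?qh]) (tid X E)" "?eg \<star> \<omega>' = \<omega>"
      using companion_transpose_surj[of \<omega> g "rs @ [?qh]"] \<omega> assms(1,3) by auto
    moreover obtain \<phi> where "\<phi> \<in> K g rs h" "\<phi> \<star> ?eh = \<omega>'"
      using conjoint_transpose_surj[of \<omega>' g rs h] 1 assms(2,4) by auto
    ultimately show ?thesis by (auto simp: T_def)
  qed
  \<comment> \<open>\<open>P\<close> and \<open>T\<close> intertwine multiplication by
    \<open>?e\<close> with multiplication by \<open>?ej\<close>, because pasting
    \<open>smile\<close> into \<open>?e\<close> yields \<open>?ej \<star> ?eg\<close>.\<close>
  have PT: "P (?e \<star> \<phi>) = ?ej \<star> T \<phi>" if \<phi>: "\<phi> \<in> K g rs h" for \<phi>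
  proof -
    have \<phi>h: "\<phi> \<star> ?eh \<in> K g (rs @ [?qh]) (tid X E)" using hmul_K[OF \<phi> eh(1)] .
    have "P (?e \<star> \<phi>) = sub (?e \<star> (\<phi> \<star> ?eh)) ([smile X (tid X E) j g] @ map (cid X) (rs @ [?qh]))"
      using hmul_assoc[OF e \<phi> eh(1)] by (simp add: P_def paste_sub)
    also have "\<dots> = sub ?e [smile X (tid X E) j g] \<star> sub (\<phi> \<star> ?eh) (map (cid X) (rs @ [?qh]))"
    proof (rule sub_hmul)
      show "\<phi> \<star> ?eh \<in> K g (map (ccod X) (map (cid X) (rs @ [?qh]))) (tid X E)"
        using \<phi>h K_glob_ctx[OF \<phi>h] by metis
    qed (use e cells_simps[OF sm(1)] cells_glob[OF sm(1)] K_glob_ctx[OF \<phi>h] in simp_all)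
    also have "\<dots> = ?ej \<star> T \<phi>" using sm(2) cids_K[OF \<phi>h] hmul_assoc[OF ej eg(1) \<phi>h] by (simp add: T_def)
    finally show ?thesis .
  qed
  have PK: "P \<chi> \<in> K j (?qj # ?qg # rs @ [?qh]) (tid X E)" if "\<chi> \<in> K j (?q # rs) h" for \<chi>
    using paste_K[OF _ sm(1), of "\<chi> \<star> ?eh" j "[]" "rs @ [?qh]" "tid X E"] hmul_K[OF that eh(1)] by (simp add: P_def)
  have P_inj: "\<chi> = \<chi>'" if "\<chi> \<in> K j (?q # rs) h" "\<chi>' \<in> K j (?q # rs) h" "P \<chi> = P \<chi>'" for \<chi> \<chi>'
  proof -
    note k = K_simps[OF hmul_K[OF that(1) eh(1)]] and k' = K_simps[OF hmul_K[OF that(2) eh(1)]]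
    have "\<chi> \<star> ?eh = \<chi>' \<star> ?eh"
      by (rule opcartesian_cancel[OF opcartesian_smile[OF jt(1) assms(1) jt(3) assms(3)], of _ _ "[]" "rs @ [?qh]"])
        (use k k' that(3) cells_simps(3)[OF sm(1)] P_def in auto)
    then show ?thesis using conjoint_transpose_inj[OF that(1,2)] assms(4) by simp
  qed
  show "\<phi> = \<phi>'" if "\<phi> \<in> K g rs h" "\<phi>' \<in> K g rs h" "?e \<star> \<phi> = ?e \<star> \<phi>'" for \<phi> \<phi>'
    using T_inj dense_base(2)[OF ch TK TK] PT that by metis
  \<comment> \<open>\<open>P \<chi>\<close> is reached by density over chains from \<open>E\<close>
    to \<open>E\<close>, the preimage is pulled back along \<open>T\<close>, and injectivity of
    \<open>P\<close> leads back to \<open>\<chi>\<close>.\<close>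
  show "\<exists>\<phi>\<in>K g rs h. ?e \<star> \<phi> = \<chi>" if \<chi>: "\<chi> \<in> K j (?q # rs) h" for \<chi>
  proof -
    obtain \<omega> where 1: "\<omega> \<in> K (tid X E) (?qg # rs @ [?qh]) (tid X E)" "?ej \<star> \<omega> = P \<chi>"
      using dense_base(1)[OF ch] PK[OF \<chi>] jt by metis
    then obtain \<phi> where 2: "\<phi> \<in> K g rs h" "T \<phi> = \<omega>" using T_surj by blast
    then have "P (?e \<star> \<phi>) = P \<chi>" using PT 1 by simp
    moreover have "?e \<star> \<phi> \<in> K j (?q # rs) h" using hmul_K[OF e 2(1)] by simp
    ultimately show ?thesis using P_inj \<chi> 2(1) by blast
  qed
qed

end

end

section \<open>Categories presented over a base category\<close>

text \<open>A category with a faithful functor to \<open>B\<close> is determined by its objects \<open>F\<close>, their images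
  \<open>p x\<close> in \<open>B\<close>, and the subsets \<open>H x y\<close> of the hom-sets of \<open>B\<close>; the maps \<open>f\<close> and \<open>g x y\<close> name its objects
  and its morphisms.\<close>

definition presents where
  "presents B F p H C U f g \<longleftrightarrow> category B \<and>
    bij_betw f F (Obj C) \<and>
    (\<forall>x\<in>F. p x \<in> Obj B \<and> fob U (f x) = p x \<and> Idn B (p x) \<in> H x x \<and> Idn C (f x) = g x x (Idn B (p x))) \<and>
    (\<forall>x\<in>F. \<forall>y\<in>F. H x y \<subseteq> Hom B (p x) (p y) \<and> Hom C (f x) (f y) = g x y ` H x y \<and>
      (\<forall>\<tau>\<in>H x y. farr U (f x) (f y) (g x y \<tau>) = \<tau>)) \<and>
    (\<forall>x\<in>F. \<forall>y\<in>F. \<forall>z\<in>F. \<forall>\<tau>\<in>H x y. \<forall>\<sigma>\<in>H y z.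
      Comp B (p x) (p y) (p z) \<sigma> \<tau> \<in> H x z \<and>
      Comp C (f x) (f y) (f z) (g y z \<sigma>) (g x y \<tau>) = g x z (Comp B (p x) (p y) (p z) \<sigma> \<tau>))"

lemma presentsD:
  assumes "presents B F p H C U f g"
  shows "x \<in> F \<Longrightarrow> p x \<in> Obj B" "x \<in> F \<Longrightarrow> fob U (f x) = p x" "x \<in> F \<Longrightarrow> f x \<in> Obj C"
    "x \<in> F \<Longrightarrow> Idn B (p x) \<in> H x x" "x \<in> F \<Longrightarrow> Idn C (f x) = g x x (Idn B (p x))"
    "x \<in> F \<Longrightarrow> y \<in> F \<Longrightarrow> \<tau> \<in> H x y \<Longrightarrow> \<tau> \<in> Hom B (p x) (p y)"
    "x \<in> F \<Longrightarrow> y \<in> F \<Longrightarrow> Hom C (f x) (f y) = g x y ` H x y"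
    "x \<in> F \<Longrightarrow> y \<in> F \<Longrightarrow> \<tau> \<in> H x y \<Longrightarrow> farr U (f x) (f y) (g x y \<tau>) = \<tau>"
    "x \<in> F \<Longrightarrow> y \<in> F \<Longrightarrow> z \<in> F \<Longrightarrow> \<tau> \<in> H x y \<Longrightarrow> \<sigma> \<in> H y z \<Longrightarrow>
      Comp B (p x) (p y) (p z) \<sigma> \<tau> \<in> H x z"
    "x \<in> F \<Longrightarrow> y \<in> F \<Longrightarrow> z \<in> F \<Longrightarrow> \<tau> \<in> H x y \<Longrightarrow> \<sigma> \<in> H y z \<Longrightarrow>
      Comp C (f x) (f y) (f z) (g y z \<sigma>) (g x y \<tau>) = g x z (Comp B (p x) (p y) (p z) \<sigma> \<tau>)"
    "x \<in> F \<Longrightarrow> inv_into F f (f x) = x"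
proof -
  note P = assms[unfolded presents_def]
  then have b: "bij_betw f F (Obj C)" by simp
  show "x \<in> F \<Longrightarrow> f x \<in> Obj C" "x \<in> F \<Longrightarrow> inv_into F f (f x) = x"
    using b bij_betw_inv_into_left[OF b] by (auto simp: bij_betw_def)
  show "x \<in> F \<Longrightarrow> y \<in> F \<Longrightarrow> \<tau> \<in> H x y \<Longrightarrow> \<tau> \<in> Hom B (p x) (p y)" using P by blast
qed (use assms in \<open>auto simp: presents_def\<close>)

text \<open>Every morphism of \<open>C\<close> is some \<open>g x y \<tau>\<close>, and
  \<open>g\<close> carries identities and composites of \<open>B\<close> to those of
  \<open>C\<close>, so the laws are inherited from \<open>B\<close>.\<close>

lemma presents_category:
  assumes "presents B F p H C U f g"
  shows "category C"
proof -
  note P = assms[unfolded presents_def]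
  interpret B: category B using P by blast
  have O: "Obj C = f ` F" using P by (auto simp: bij_betw_def)
  have H: "\<tau> \<in> Hom B (p x) (p y)" if "x \<in> F" "y \<in> F" "\<tau> \<in> H x y" for x y \<tau>
    using P that by blast
  show ?thesis
  proof
    fix a assume "a \<in> Obj C"
    then show "Idn C a \<in> Hom C a a" using P O by auto
  next
    fix a b c \<phi> \<psi>
    assume "a \<in> Obj C" "b \<in> Obj C" "c \<in> Obj C" and h: "\<phi> \<in> Hom C a b" "\<psi> \<in> Hom C b c"
    then obtain x y z where xyz: "x \<in> F" "y \<in> F" "z \<in> F" "a = f x" "b = f y" "c = f z" using O by auto
    with h P obtain \<tau> \<sigma> where t: "\<tau> \<in> H x y" "\<sigma> \<in> H y z" "\<phi> = g x y \<tau>" "\<psi> = g y z \<sigma>" by auto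
    then have "Comp B (p x) (p y) (p z) \<sigma> \<tau> \<in> H x z"
      "Comp C a b c \<psi> \<phi> = g x z (Comp B (p x) (p y) (p z) \<sigma> \<tau>)" using P xyz by blast+
    then show "Comp C a b c \<psi> \<phi> \<in> Hom C a c" using P xyz by auto
  next
    fix a b \<phi>
    assume "a \<in> Obj C" "b \<in> Obj C" and h: "\<phi> \<in> Hom C a b"
    then obtain x y where xy: "x \<in> F" "y \<in> F" "a = f x" "b = f y" using O by auto
    with h P obtain \<tau> where t: "\<tau> \<in> H x y" "\<phi> = g x y \<tau>" by auto
    have px: "p x \<in> Obj B" "p y \<in> Obj B" "Idn B (p x) \<in> H x x" "Idn B (p y) \<in> H y y"
      "Idn C (f x) = g x x (Idn B (p x))" "Idn C (f y) = g y y (Idn B (p y))"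
      using P xy by auto
    have "Comp C (f x) (f y) (f y) (g y y (Idn B (p y))) (g x y \<tau>) = g x y (Comp B (p x) (p y) (p y) (Idn B (p y)) \<tau>)"
      "Comp C (f x) (f x) (f y) (g x y \<tau>) (g x x (Idn B (p x))) = g x y (Comp B (p x) (p x) (p y) \<tau> (Idn B (p x)))"
      using P xy(1,2) t(1) px(3,4) by blast+
    then show "Comp C a b b (Idn C b) \<phi> = \<phi>" "Comp C a a b \<phi> (Idn C a) = \<phi>"
      using B.Comp_Idn_left[OF px(1,2) H] B.Comp_Idn_right[OF px(1,2) H] xy t px by auto
  next
    fix a b c d \<phi> \<psi> \<chi>
    assume "a \<in> Obj C" "b \<in> Obj C" "c \<in> Obj C" "d \<in> Obj C"
      and h: "\<phi> \<in> Hom C a b" "\<psi> \<in> Hom C b c" "\<chi> \<in> Hom C c d"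
    then obtain x y z w where xyz: "x \<in> F" "y \<in> F" "z \<in> F" "w \<in> F" "a = f x" "b = f y" "c = f z" "d = f w"
      using O by auto
    with h P obtain \<tau> \<sigma> \<upsilon> where t: "\<tau> \<in> H x y" "\<sigma> \<in> H y z" "\<upsilon> \<in> H z w"
      "\<phi> = g x y \<tau>" "\<psi> = g y z \<sigma>" "\<chi> = g z w \<upsilon>" by auto
    have px: "p x \<in> Obj B" "p y \<in> Obj B" "p z \<in> Obj B" "p w \<in> Obj B" using P xyz by auto
    have C: "Comp B (p x') (p y') (p z') \<sigma>' \<tau>' \<in> H x' z' \<and>
      Comp C (f x') (f y') (f z') (g y' z' \<sigma>') (g x' y' \<tau>') = g x' z' (Comp B (p x') (p y') (p z') \<sigma>' \<tau>')"
      if "x' \<in> F" "y' \<in> F" "z' \<in> F" "\<tau>' \<in> H x' y'" "\<sigma>' \<in> H y' z'" for x' y' z' \<tau>' \<sigma>'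
      using P that by blast
    show "Comp C a c d \<chi> (Comp C a b c \<psi> \<phi>) = Comp C a b d (Comp C b c d \<chi> \<psi>) \<phi>"
      using B.Comp_assoc[OF px H H H, of \<tau> \<sigma> \<upsilon>] C xyz t by simp
  qed
qed

lemma presents_functor:
  assumes "presents B F p H C U f g"
  shows "is_functor C B U"
proof -
  note P = assms[unfolded presents_def]
  have O: "Obj C = f ` F" using P by (auto simp: bij_betw_def)
  show ?thesis unfolding is_functor_def O
  proof (intro conjI ballI)
    show "category C" using presents_category[OF assms] .
    show "category B" using P by blast
  next
    fix a assume "a \<in> f ` F"
    then show "fob U a \<in> Obj B" "farr U a a (Idn C a) = Idn B (fob U a)" by (auto simp: presentsD[OF assms])
  next
    fix a b \<phi> assume "a \<in> f ` F" "b \<in> f ` F" "\<phi> \<in> Hom C a b"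
    then show "farr U a b \<phi> \<in> Hom B (fob U a) (fob U b)" by (auto simp: presentsD[OF assms])
  next
    fix a b c \<phi> \<psi>
    assume "a \<in> f ` F" "b \<in> f ` F" "c \<in> f ` F" and h: "\<phi> \<in> Hom C a b" "\<psi> \<in> Hom C b c"
    then obtain x y z where xyz: "x \<in> F" "y \<in> F" "z \<in> F" "a = f x" "b = f y" "c = f z" by auto
    with h P obtain \<tau> \<sigma> where t: "\<tau> \<in> H x y" "\<sigma> \<in> H y z" "\<phi> = g x y \<tau>" "\<psi> = g y z \<sigma>" by auto
    then have c: "Comp B (p x) (p y) (p z) \<sigma> \<tau> \<in> H x z"
      "Comp C a b c \<psi> \<phi> = g x z (Comp B (p x) (p y) (p z) \<sigma> \<tau>)" using P xyz by blast+
    then show "farr U a c (Comp C a b c \<psi> \<phi>) =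
        Comp B (fob U a) (fob U b) (fob U c) (farr U b c \<psi>) (farr U a b \<phi>)"
      using xyz t c(1) by (simp add: presentsD[OF assms])
  qed
qed

text \<open>Objects are matched through their common index in \<open>F\<close>. On morphisms
  \<open>U\<close> undoes the naming by \<open>g\<close>, so the comparison applies
  \<open>farr U\<close> and renames by \<open>g'\<close>. The left inverse is the same construction
  with the two presentations exchanged, so using the lemma twice gives an isomorphism.\<close>

lemma presents_compare:
  assumes C: "presents B F p H C U f g" and D: "presents B F p H D V f' g'"
  defines "G \<equiv> \<lparr>fob = f' \<circ> inv_into F f,
    farr = (\<lambda>a b \<phi>. g' (inv_into F f a) (inv_into F f b) (farr U a b \<phi>))\<rparr>"
  shows "is_functor C D G" and "is_left_inverse C G
      \<lparr>fob = f \<circ> inv_into F f', farr = (\<lambda>a b \<phi>. g (inv_into F f' a) (inv_into F f' b) (farr V a b \<phi>))\<rparr>"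
    and "a \<in> Obj C \<Longrightarrow> fob V (fob G a) = fob U a"
    and "a \<in> Obj C \<Longrightarrow> b \<in> Obj C \<Longrightarrow> \<phi> \<in> Hom C a b \<Longrightarrow> farr V (fob G a) (fob G b) (farr G a b \<phi>) = farr U a b \<phi>"
proof -
  note P = C[unfolded presents_def] and Q = D[unfolded presents_def]
  have O: "Obj C = f ` F" "Obj D = f' ` F" using P Q by (auto simp: bij_betw_def)
  show "is_functor C D G" unfolding is_functor_def O(1)
  proof (intro conjI ballI)
    show "category C" "category D" using presents_category C D by blast+
  next
    fix a assume "a \<in> f ` F"
    then show "fob G a \<in> Obj D" "farr G a a (Idn C a) = Idn D (fob G a)"
      by (auto simp: G_def presentsD[OF C] presentsD[OF D])
  next
    fix a b \<phi> assume "a \<in> f ` F" "b \<in> f ` F" "\<phi> \<in> Hom C a b"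
    then show "farr G a b \<phi> \<in> Hom D (fob G a) (fob G b)"
      by (auto simp: G_def presentsD[OF C] presentsD[OF D])
  next
    fix a b c \<phi> \<psi>
    assume "a \<in> f ` F" "b \<in> f ` F" "c \<in> f ` F" and h: "\<phi> \<in> Hom C a b" "\<psi> \<in> Hom C b c"
    then obtain x y z where xyz: "x \<in> F" "y \<in> F" "z \<in> F" "a = f x" "b = f y" "c = f z" by auto
    with h P obtain \<tau> \<sigma> where t: "\<tau> \<in> H x y" "\<sigma> \<in> H y z" "\<phi> = g x y \<tau>" "\<psi> = g y z \<sigma>" by auto
    have "Comp B (p x) (p y) (p z) \<sigma> \<tau> \<in> H x z"
      "Comp C a b c \<psi> \<phi> = g x z (Comp B (p x) (p y) (p z) \<sigma> \<tau>)"
      "Comp D (f' x) (f' y) (f' z) (g' y z \<sigma>) (g' x y \<tau>) = g' x z (Comp B (p x) (p y) (p z) \<sigma> \<tau>)"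
      using xyz t by (simp_all add: presentsD[OF C] presentsD(10)[OF D])
    then show "farr G a c (Comp C a b c \<psi> \<phi>) =
        Comp D (fob G a) (fob G b) (fob G c) (farr G b c \<psi>) (farr G a b \<phi>)"
      using xyz t by (simp add: G_def presentsD[OF C] presentsD[OF D])
  qed
  show "is_left_inverse C G
      \<lparr>fob = f \<circ> inv_into F f', farr = (\<lambda>a b \<phi>. g (inv_into F f' a) (inv_into F f' b) (farr V a b \<phi>))\<rparr>"
    unfolding is_left_inverse_def O(1)
    by (auto simp: G_def presentsD[OF C] presentsD[OF D])
  show "a \<in> Obj C \<Longrightarrow> fob V (fob G a) = fob U a"
    by (auto simp: O G_def presentsD[OF C] presentsD[OF D])
  show "a \<in> Obj C \<Longrightarrow> b \<in> Obj C \<Longrightarrow> \<phi> \<in> Hom C a b \<Longrightarrow> farr V (fob G a) (fob G b) (farr G a b \<phi>) = farr U a b \<phi>"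
    by (auto simp: O G_def presentsD[OF C] presentsD[OF D])
qed

lemma presents_isomorphic_over:
  assumes C: "presents B F p H C U f g" and D: "presents B F p H D V f' g'"
  shows "isomorphic_over B C U D V"
  unfolding isomorphic_over_def is_isomorphism_def
  using presents_functor[OF C] presents_functor[OF D] presents_compare[OF C D] presents_compare[OF D C]
  by blast

section \<open>Substitution of cells with identity boundaries\<close>

context virtual_equipment
begin

text \<open>A typing judgement for lists of cells with identity boundaries. It collects the side
  conditions of the laws of \<open>sub\<close>, which are then met by the introduction rules
  below.\<close>

definition substs :: "'c list \<Rightarrow> 'l list \<Rightarrow> 'l list \<Rightarrow> bool" where
  "substs \<alpha>s ps qs \<longleftrightarrow> set \<alpha>s \<subseteq> glob \<and> map (ccod X) \<alpha>s = qs \<and> concat (map (cdom X) \<alpha>s) = ps"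

lemma substs_cid: "set ps \<subseteq> Loose X \<Longrightarrow> substs (map (cid X) ps) ps ps"
  using set_cid_glob map_ccod_cid concat_cdom_cid by (simp add: substs_def)

lemma substs_Nil: "substs [] [] []"
  by (simp add: substs_def)

lemma substs_Cons: "\<alpha> \<in> cells X ps q \<Longrightarrow> substs \<alpha>s ps' qs \<Longrightarrow> substs (\<alpha> # \<alpha>s) (ps @ ps') (q # qs)"
  using cells_glob cells_simps by (auto simp: substs_def)

lemma substs1: "\<alpha> \<in> cells X ps q \<Longrightarrow> substs [\<alpha>] ps [q]"
  using substs_Cons[OF _ substs_Nil] by simp

lemma substs2: "\<alpha> \<in> cells X ps q \<Longrightarrow> \<beta> \<in> cells X ps' q' \<Longrightarrow> substs [\<alpha>, \<beta>] (ps @ ps') [q, q']"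
  using substs_Cons[OF _ substs1] by simp

lemma sub_K': "\<psi> \<in> K x qs y \<Longrightarrow> substs \<alpha>s ps qs \<Longrightarrow> sub \<psi> \<alpha>s \<in> K x ps y"
  using sub_K[of \<psi> x \<alpha>s y] by (auto simp: substs_def)

lemma sub_cells': "\<phi> \<in> cells X qs q \<Longrightarrow> substs \<alpha>s ps qs \<Longrightarrow> sub \<phi> \<alpha>s \<in> cells X ps q"
  using sub_cells[of \<phi> \<alpha>s q] by (auto simp: substs_def)

lemma sub_sub1:
  assumes "\<psi> \<in> K x [q] y" "\<phi> \<in> cells X qs q" "substs \<alpha>s ps qs"
  shows "sub \<psi> [sub \<phi> \<alpha>s] = sub (sub \<psi> [\<phi>]) \<alpha>s"
  using sub_sub[of \<psi> "[\<phi>]" "[\<alpha>s]"] assms K_simps[OF assms(1)] cells_simps[OF assms(2)]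
    cells_glob[OF assms(2)] by (simp add: substs_def)

lemma sub_hmul':
  assumes "\<psi> \<in> K x qs y" "\<chi> \<in> K y qs' z" "substs \<alpha>s ps qs" "substs \<beta>s ps' qs'"
  shows "sub (\<psi> \<star> \<chi>) (\<alpha>s @ \<beta>s) = sub \<psi> \<alpha>s \<star> sub \<chi> \<beta>s"
  using sub_hmul[of \<psi> x \<alpha>s y \<chi> \<beta>s z] assms by (simp add: substs_def)

lemma sub_hmul_left:
  assumes "\<psi> \<in> K x qs y" "\<chi> \<in> K y qs' z" "substs \<alpha>s ps qs"
  shows "sub (\<psi> \<star> \<chi>) (\<alpha>s @ map (cid X) qs') = sub \<psi> \<alpha>s \<star> \<chi>"
  using sub_hmul'[OF assms substs_cid[OF K_Loose[OF assms(2)]]] cids_K[OF assms(2)] by simp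

lemma sub_hmul_right:
  assumes "\<psi> \<in> K x qs y" "\<chi> \<in> K y qs' z" "substs \<beta>s ps' qs'"
  shows "sub (\<psi> \<star> \<chi>) (map (cid X) qs @ \<beta>s) = \<psi> \<star> sub \<chi> \<beta>s"
  using sub_hmul'[OF assms(1,2) substs_cid[OF K_Loose[OF assms(1)]] assms(3)] cids_K[OF assms(1)] by simp

lemma cells_eq_iff:
  assumes "x \<in> Tight X" "y \<in> Tight X" "tcod X x = tcod X y"
    "\<phi> \<in> cells X ps (rep X x y)" "\<phi>' \<in> cells X ps (rep X x y)"
  shows "\<phi> = \<phi>' \<longleftrightarrow> sub (rep_cell X x y) [\<phi>] = sub (rep_cell X x y) [\<phi>']"
  using sub_rep_cell_cancel[OF assms] by auto

lemma sharp_rep_cell: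
  "x \<in> Tight X \<Longrightarrow> y \<in> Tight X \<Longrightarrow> tcod X x = tcod X y \<Longrightarrow> \<phi> \<in> cells X ps (rep X x y) \<Longrightarrow>
    sharp x y (sub (rep_cell X x y) [\<phi>]) = \<phi>"
  using sharp_eqI sub_rep_cell_K by metis

end

section \<open>The category of relative monads in terms of 2-cells into the loose-identity\<close>

locale tight_cell = virtual_equipment X for X :: "('o, 't, 'l, 'c) vdc" +
  fixes j :: 't and A E :: 'o
  assumes j: "j \<in> tights X A E"
begin

abbreviation \<epsilon> :: "'t \<Rightarrow> 't \<Rightarrow> 'c" where "\<epsilon> \<equiv> rep_cell X"
abbreviation one :: "'t" where "one \<equiv> tid X E"
abbreviation T :: "'t set" where "T \<equiv> tights X A E"

text \<open>Besides the tight-cells in \<open>T\<close>, this has to include \<open>one\<close>,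
  whose domain is \<open>E\<close>, since companions and conjoints are restrictions along
  it.\<close>

definition over :: "'t set" where "over = {x \<in> Tight X. tcod X x = E}"

lemma j_simps [simp]: "j \<in> Tight X" "tdom X j = A" "tcod X j = E" "A \<in> Ob X" "E \<in> Ob X"
  using j tdom_in[of j] tcod_in[of j] by (auto simp: tights_def)

lemma over_simps [simp]: "j \<in> over" "one \<in> over" "t \<in> T \<Longrightarrow> t \<in> over"
  by (auto simp: over_def tights_def)

lemma overD: "x \<in> over \<Longrightarrow> x \<in> Tight X" "x \<in> over \<Longrightarrow> tcod X x = E"
  by (auto simp: over_def)

lemma T_simps: "t \<in> T \<Longrightarrow> t \<in> Tight X" "t \<in> T \<Longrightarrow> tdom X t = A" "t \<in> T \<Longrightarrow> tcod X t = E"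
  by (auto simp: tights_def)

lemma \<epsilon>_K [simp]: "x \<in> over \<Longrightarrow> y \<in> over \<Longrightarrow> \<epsilon> x y \<in> K x [rep X x y] y"
  using rep_cell_K by (simp add: over_def)

lemma rep_over [simp]:
  "x \<in> over \<Longrightarrow> y \<in> over \<Longrightarrow> rep X x y \<in> Loose X"
  "x \<in> over \<Longrightarrow> y \<in> over \<Longrightarrow> ltgt X (rep X x y) = tdom X x"
  "x \<in> over \<Longrightarrow> y \<in> over \<Longrightarrow> lsrc X (rep X x y) = tdom X y"
  using rep_Loose ltgt_rep lsrc_rep by (simp_all add: over_def)

lemma cid_rep [simp]: "x \<in> over \<Longrightarrow> y \<in> over \<Longrightarrow> cid X (rep X x y) \<in> cells X [rep X x y] (rep X x y)"
  by (simp add: cid_cells)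

lemma \<epsilon>_cid [simp]: "x \<in> over \<Longrightarrow> y \<in> over \<Longrightarrow> sub (\<epsilon> x y) [cid X (rep X x y)] = \<epsilon> x y"
  using cids_K[OF \<epsilon>_K] by simp

lemma smile_over:
  assumes "x \<in> over" "t \<in> over" "y \<in> over"
  shows "smile X t x y \<in> cells X [rep X x t, rep X t y] (rep X x y)"
    and "sub (\<epsilon> x y) [smile X t x y] = \<epsilon> x t \<star> \<epsilon> t y"
  using smile_cells rep_cell_smile assms by (simp_all add: over_def)

lemma flat_K: "x \<in> over \<Longrightarrow> y \<in> over \<Longrightarrow> \<phi> \<in> cells X ps (rep X x y) \<Longrightarrow> sub (\<epsilon> x y) [\<phi>] \<in> K x ps y"
  using sub_K'[OF \<epsilon>_K substs1] .

lemma flat_eq_iff: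
  "x \<in> over \<Longrightarrow> y \<in> over \<Longrightarrow> \<phi> \<in> cells X ps (rep X x y) \<Longrightarrow> \<phi>' \<in> cells X ps (rep X x y) \<Longrightarrow>
    \<phi> = \<phi>' \<longleftrightarrow> sub (\<epsilon> x y) [\<phi>] = sub (\<epsilon> x y) [\<phi>']"
  using cells_eq_iff by (simp add: over_def)

lemma flat_sub:
  "x \<in> over \<Longrightarrow> y \<in> over \<Longrightarrow> \<phi> \<in> cells X qs (rep X x y) \<Longrightarrow> substs \<alpha>s ps qs \<Longrightarrow>
    sub (\<epsilon> x y) [sub \<phi> \<alpha>s] = sub (sub (\<epsilon> x y) [\<phi>]) \<alpha>s"
  using sub_sub1[OF \<epsilon>_K] .

lemma sharp_flat: "x \<in> over \<Longrightarrow> y \<in> over \<Longrightarrow> \<phi> \<in> cells X ps (rep X x y) \<Longrightarrow> sharp x y (sub (\<epsilon> x y) [\<phi>]) = \<phi>"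
  using sharp_rep_cell by (simp add: over_def)

text \<open>Cancellation comes from companion transposition here; with \<open>\<epsilon> j t\<close>
  in place of \<open>\<epsilon> one x\<close> it takes density.\<close>

lemma one_\<epsilon>_cancel:
  "\<psi> \<in> K x ps y \<Longrightarrow> \<psi>' \<in> K x ps y \<Longrightarrow> x \<in> over \<Longrightarrow> \<epsilon> one x \<star> \<psi> = \<epsilon> one x \<star> \<psi>' \<longleftrightarrow> \<psi> = \<psi>'"
  using companion_transpose_inj[of \<psi> x ps y \<psi>'] by (auto simp: over_def)

lemma sub_Nil: "\<psi> \<in> K x [] y \<Longrightarrow> sub \<psi> [] = \<psi>"
  using cids_K by force

lemma sub_hmul_nullary:
  assumes "\<psi> \<in> K x qs y" "\<chi> \<in> K y [] z" "substs \<alpha>s ps qs"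
  shows "sub (\<psi> \<star> \<chi>) \<alpha>s = sub \<psi> \<alpha>s \<star> \<chi>"
  using sub_hmul_left[OF assms] by simp

lemma sub_nullary_hmul:
  assumes "\<psi> \<in> K x [] y" "\<chi> \<in> K y qs z" "substs \<alpha>s ps qs"
  shows "sub (\<psi> \<star> \<chi>) \<alpha>s = \<psi> \<star> sub \<chi> \<alpha>s"
  using sub_hmul_right[OF assms] by simp

lemma vcomp_cells:
  assumes "\<psi> \<in> cells X [q] r" "\<phi> \<in> cells X ps q"
  shows "vcomp X \<psi> \<phi> = sub \<psi> [\<phi>]" and "vcomp X \<psi> \<phi> \<in> cells X ps r"
proof -
  have "tdom X (cleft X \<psi>) = ltgt X q" using cdom_chain[of \<psi>] assms by (auto simp: cells_def)
  then show e: "vcomp X \<psi> \<phi> = sub \<psi> [\<phi>]"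
    using vcomp_sub[OF cells_glob[OF assms(2)]] cells_simps[OF assms(2)] by simp
  show "vcomp X \<psi> \<phi> \<in> cells X ps r" unfolding e using sub_cells'[OF assms(1) substs1[OF assms(2)]] .
qed

section \<open>2-cells between tight-cells in nullary form\<close>

lemma companion_T: "t \<in> T \<Longrightarrow> companion X t = rep X one t"
  by (simp add: T_simps)

text \<open>\<open>nullary\<close> pastes the companion unit of \<open>s\<close> into the flattened
  \<open>\<tau>\<close>, which is inverse to multiplication by \<open>\<epsilon> one s\<close>.
  Later computations use the resulting characterization in place of the definition.\<close>

lemma
  assumes "s \<in> T" "t \<in> T" "\<tau> \<in> cells X [rep X one s] (rep X one t)"
  shows nullary_K: "nullary X s t \<tau> \<in> K s [] t"
    and flat_tau: "sub (\<epsilon> one t) [\<tau>] = \<epsilon> one s \<star> nullary X s t \<tau>"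
proof -
  note s = T_simps[OF assms(1)] and t = T_simps[OF assms(2)]
  have ot: "s \<in> over" "t \<in> over" using assms by auto
  have k: "sub (\<epsilon> one t) [\<tau>] \<in> K one [companion X s] t" using flat_K[OF _ ot(2) assms(3)] s by simp
  note \<epsilon>s = K_simps[OF \<epsilon>_K[OF over_simps(2) ot(2)]]
  note cu = companion_unit[OF s(1), unfolded s]
  have c: "composable X (\<epsilon> one t) one [\<tau>] (tid X (tdom X t))"
    using cells_simps[OF assms(3)] \<epsilon>s ot t by (simp add: composable_def)
  have c2: "composable X \<tau> s [companion_unit X s] (tid X A)"
    using cells_simps[OF assms(3)] cu ot s t by (simp add: composable_def)
  have "ccomp X (ccomp X (\<epsilon> one t) one [\<tau>]) s (concat [[companion_unit X s]])
      = ccomp X (\<epsilon> one t) (tcomp X one s) (ccomps X [\<tau>] s [[companion_unit X s]])"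
    by (rule ccomp_assoc[OF c, where k = "tid X A"]) (use cells_simps[OF assms(3)] cu s in auto)
  then have "nullary X s t \<tau> = ccomp X (sub (\<epsilon> one t) [\<tau>]) s [companion_unit X s]"
    using ccomp_frame[OF c2] cells_simps[OF assms(3)] cu ot s t \<epsilon>s tcomp_tid(1)[OF s(1)]
    by (simp add: nullary_def vcomp_def sub_def)
  with companion_transpose_surj[of "sub (\<epsilon> one t) [\<tau>]" s "[]" t] k s
  show "nullary X s t \<tau> \<in> K s [] t" "sub (\<epsilon> one t) [\<tau>] = \<epsilon> one s \<star> nullary X s t \<tau>" by simp_all
qed

lemma nullary_eqI:
  assumes "s \<in> T" "t \<in> T" "\<tau> \<in> cells X [rep X one s] (rep X one t)" "N \<in> K s [] t"
    "sub (\<epsilon> one t) [\<tau>] = \<epsilon> one s \<star> N"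
  shows "nullary X s t \<tau> = N"
  using one_\<epsilon>_cancel[OF nullary_K[OF assms(1-3)] assms(4)] flat_tau[OF assms(1-3)] assms by simp

text \<open>Inverse of \<open>nullary X s t\<close>.\<close>

definition tau :: "'t \<Rightarrow> 't \<Rightarrow> 'c \<Rightarrow> 'c" where
  "tau s t N = sharp one t (\<epsilon> one s \<star> N)"

lemma
  assumes "s \<in> T" "t \<in> T" "N \<in> K s [] t"
  shows tau_cells: "tau s t N \<in> cells X [rep X one s] (rep X one t)"
    and flat_tau_N: "sub (\<epsilon> one t) [tau s t N] = \<epsilon> one s \<star> N"
    and nullary_tau: "nullary X s t (tau s t N) = N"
proof -
  have k: "\<epsilon> one s \<star> N \<in> K one [rep X one s] t" using hmul_K[OF \<epsilon>_K assms(3)] assms by simp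
  show "tau s t N \<in> cells X [rep X one s] (rep X one t)" "sub (\<epsilon> one t) [tau s t N] = \<epsilon> one s \<star> N"
    unfolding tau_def using sharp_cells[OF k] rep_cell_sharp[OF k] .
  from nullary_eqI[OF assms(1,2) this(1) assms(3) this(2)]
  show "nullary X s t (tau s t N) = N" .
qed

lemma tau_nullary:
  assumes "s \<in> T" "t \<in> T" "\<tau> \<in> cells X [rep X one s] (rep X one t)"
  shows "tau s t (nullary X s t \<tau>) = \<tau>"
  using flat_tau[OF assms] sharp_flat[OF _ _ assms(3)] assms by (simp add: tau_def)

lemma nullary_cid: "t \<in> T \<Longrightarrow> nullary X t t (cid X (rep X one t)) = hone t"
  using nullary_eqI[of t t "cid X (rep X one t)" "hone t"] hone_K[of t] hmul_hone(1)[OF \<epsilon>_K, of one t]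
  by (simp add: T_simps)

text \<open>Substituting \<open>\<tau>\<close> into
  \<open>\<epsilon> one s \<star> nullary X s t \<sigma>\<close> affects the first factor only, as
  the second is nullary. Hence composition turns into the product in diagrammatic order.\<close>

lemma nullary_vcomp:
  assumes "r \<in> T" "s \<in> T" "t \<in> T" "\<tau> \<in> cells X [rep X one r] (rep X one s)"
    "\<sigma> \<in> cells X [rep X one s] (rep X one t)"
  shows "nullary X r t (vcomp X \<sigma> \<tau>) = nullary X r s \<tau> \<star> nullary X s t \<sigma>"
proof (rule nullary_eqI[OF assms(1,3)])
  show "vcomp X \<sigma> \<tau> \<in> cells X [rep X one r] (rep X one t)" using vcomp_cells(2)[OF assms(5,4)] .
  note N = nullary_K[OF assms(1,2,4)] and N' = nullary_K[OF assms(2,3,5)]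
  show "nullary X r s \<tau> \<star> nullary X s t \<sigma> \<in> K r [] t" using hmul_K[OF N N'] by simp
  have "sub (\<epsilon> one t) [vcomp X \<sigma> \<tau>] = sub (\<epsilon> one s \<star> nullary X s t \<sigma>) [\<tau>]"
    using flat_sub[OF _ _ assms(5) substs1[OF assms(4)]] vcomp_cells(1)[OF assms(5,4)] assms
      flat_tau[OF assms(2,3,5)] by simp
  also have "\<dots> = \<epsilon> one r \<star> nullary X r s \<tau> \<star> nullary X s t \<sigma>"
    using sub_hmul_nullary[OF \<epsilon>_K N' substs1[OF assms(4)]] flat_tau[OF assms(1,2,4)] assms by simp
  also have "\<dots> = \<epsilon> one r \<star> (nullary X r s \<tau> \<star> nullary X s t \<sigma>)"
    using hmul_assoc[OF \<epsilon>_K N N'] assms by simp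
  finally show "sub (\<epsilon> one t) [vcomp X \<sigma> \<tau>] = \<epsilon> one r \<star> (nullary X r s \<tau> \<star> nullary X s t \<sigma>)" .
qed

lemma tight_hom_category: "category (tight_hom_cat X A E)"
proof
  fix a b c f g
  assume "a \<in> Obj (tight_hom_cat X A E)" "b \<in> Obj (tight_hom_cat X A E)" "c \<in> Obj (tight_hom_cat X A E)"
    "f \<in> Hom (tight_hom_cat X A E) a b" "g \<in> Hom (tight_hom_cat X A E) b c"
  then show "Comp (tight_hom_cat X A E) a b c g f \<in> Hom (tight_hom_cat X A E) a c"
    using vcomp_cells(2) by (auto simp: tight_hom_cat_def)
next
  fix a assume "a \<in> Obj (tight_hom_cat X A E)"
  then show "Idn (tight_hom_cat X A E) a \<in> Hom (tight_hom_cat X A E) a a"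
    by (simp add: tight_hom_cat_def companion_T)
next
  fix a b f
  assume "a \<in> Obj (tight_hom_cat X A E)" "b \<in> Obj (tight_hom_cat X A E)"
    "f \<in> Hom (tight_hom_cat X A E) a b"
  then have h: "a \<in> T" "b \<in> T" and f: "f \<in> cells X [rep X one a] (rep X one b)"
    by (auto simp: tight_hom_cat_def T_simps)
  show "Comp (tight_hom_cat X A E) a b b (Idn (tight_hom_cat X A E) b) f = f"
    using vcomp_cells(1)[OF cid_rep f] cid_sub[OF cells_glob[OF f]] h cells_simps[OF f]
    by (simp add: tight_hom_cat_def T_simps)
  show "Comp (tight_hom_cat X A E) a a b f (Idn (tight_hom_cat X A E) a) = f"
    using vcomp_cells(1)[OF f cid_rep] sub_cid[of f] h cells_simps[OF f]
    by (simp add: tight_hom_cat_def T_simps)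
next
  fix a b c d f g h
  assume "a \<in> Obj (tight_hom_cat X A E)" "b \<in> Obj (tight_hom_cat X A E)" "c \<in> Obj (tight_hom_cat X A E)"
    "d \<in> Obj (tight_hom_cat X A E)"
    "f \<in> Hom (tight_hom_cat X A E) a b" "g \<in> Hom (tight_hom_cat X A E) b c"
    "h \<in> Hom (tight_hom_cat X A E) c d"
  then have f: "f \<in> cells X [companion X a] (companion X b)" and g: "g \<in> cells X [companion X b] (companion X c)"
    and h: "h \<in> cells X [companion X c] (companion X d)"
    by (auto simp: tight_hom_cat_def)
  show "Comp (tight_hom_cat X A E) a c d h (Comp (tight_hom_cat X A E) a b c g f)
    = Comp (tight_hom_cat X A E) a b d (Comp (tight_hom_cat X A E) b c d h g) f"
    using vcomp_cells[OF g f] vcomp_cells[OF h g] vcomp_cells(1)[OF h vcomp_cells(2)[OF g f]]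
      vcomp_cells(1)[OF vcomp_cells(2)[OF h g] f]
      sub_sub[of h "[g]" "[[f]]"] cells_simps[OF h] cells_simps[OF g] cells_simps[OF f]
      cells_glob[OF f] cells_glob[OF g]
    by (simp add: tight_hom_cat_def)
qed

text \<open>The data are kept apart from the laws: each of the three structures is first matched
  with these data, and its axioms are then translated into \<open>flat_law\<close>.\<close>

definition flat_data :: "('t \<times> 'c \<times> 'c) set" where
  "flat_data = {(t, U, D). t \<in> T \<and> U \<in> K j [] t \<and> D \<in> K t [rep X j t] t}"

definition flat_law :: "'t \<times> 'c \<times> 'c \<Rightarrow> bool" where
  "flat_law = (\<lambda>(t, U, D). U \<star> D = \<epsilon> j t \<and> sub D [sharp j t U] = hone t \<and>
    D \<star> D = sub D [sharp j t (\<epsilon> j t \<star> D)])"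

text \<open>\<open>N\<close> is the nullary form of a 2-cell \<open>\<tau>\<close>, and
  \<open>sharp j t' (\<epsilon> j t \<star> N)\<close> is \<open>E(j,\<tau>)\<close>. The second
  equation is compatibility with the extension operators, after \<open>E(t,\<tau>)\<close> and
  \<open>E(\<tau>,t')\<close> have become products with \<open>N\<close>.\<close>

definition flat_hom_law :: "'t \<times> 'c \<times> 'c \<Rightarrow> 't \<times> 'c \<times> 'c \<Rightarrow> 'c \<Rightarrow> bool" where
  "flat_hom_law = (\<lambda>(t, U, D) (t', U', D') N. U \<star> N = U' \<and>
    D \<star> N = N \<star> sub D' [sharp j t' (\<epsilon> j t \<star> N)])"

definition flat_monads :: "('t \<times> 'c \<times> 'c) set" where
  "flat_monads = {S \<in> flat_data. flat_law S}"

definition flat_hom :: "'t \<times> 'c \<times> 'c \<Rightarrow> 't \<times> 'c \<times> 'c \<Rightarrow> 'c set" where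
  "flat_hom S S' = {\<tau> \<in> cells X [rep X one (fst S)] (rep X one (fst S')).
    flat_hom_law S S' (nullary X (fst S) (fst S') \<tau>)}"

text \<open>This cell has two main instances: \<open>E(j,\<tau>)\<close> if \<open>\<psi>\<close> is
  the nullary form of \<open>\<tau>\<close>, and the multiplication
  \<open>E(j,t), E(j,t) \<Rightarrow> E(j,t)\<close> if \<open>\<psi>\<close> is
  \<open>D\<close>.\<close>

lemma \<epsilon>_hmul_sharp:
  assumes "t \<in> over" "u \<in> over" "\<psi> \<in> K t ps u"
  shows "sharp j u (\<epsilon> j t \<star> \<psi>) \<in> cells X (rep X j t # ps) (rep X j u)"
    and "sub (\<epsilon> j u) [sharp j u (\<epsilon> j t \<star> \<psi>)] = \<epsilon> j t \<star> \<psi>"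
proof -
  have k: "\<epsilon> j t \<star> \<psi> \<in> K j (rep X j t # ps) u" using hmul_K[OF \<epsilon>_K assms(3), of j] assms by simp
  show "sharp j u (\<epsilon> j t \<star> \<psi>) \<in> cells X (rep X j t # ps) (rep X j u)"
    "sub (\<epsilon> j u) [sharp j u (\<epsilon> j t \<star> \<psi>)] = \<epsilon> j t \<star> \<psi>"
    using sharp_cells[OF k] rep_cell_sharp[OF k] .
qed

lemma sharp_\<epsilon>: "x \<in> over \<Longrightarrow> y \<in> over \<Longrightarrow> sharp x y (\<epsilon> x y) = cid X (rep X x y)"
  using sharp_flat[OF _ _ cid_rep] by simp

text \<open>Functoriality of \<open>E(j,-)\<close> in nullary form.\<close>

lemma sharp_comp:
  assumes "r \<in> over" "s \<in> over" "t \<in> over" "N \<in> K r [] s" "N' \<in> K s [] t"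
  shows "sub (sharp j t (\<epsilon> j s \<star> N')) [sharp j s (\<epsilon> j r \<star> N)] = sharp j t (\<epsilon> j r \<star> (N \<star> N'))"
proof -
  note a = \<epsilon>_hmul_sharp[OF assms(1,2,4)] and b = \<epsilon>_hmul_sharp[OF assms(2,3,5)]
  note NN = hmul_K[OF assms(4,5), simplified]
  have c: "sub (sharp j t (\<epsilon> j s \<star> N')) [sharp j s (\<epsilon> j r \<star> N)] \<in> cells X [rep X j r] (rep X j t)"
    using sub_cells'[OF b(1) substs1[OF a(1)]] .
  have "sub (\<epsilon> j t) [sub (sharp j t (\<epsilon> j s \<star> N')) [sharp j s (\<epsilon> j r \<star> N)]]
      = sub (\<epsilon> j s \<star> N') [sharp j s (\<epsilon> j r \<star> N)]"
    using flat_sub[OF _ assms(3) b(1) substs1[OF a(1)]] b(2) by simp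
  also have "\<dots> = \<epsilon> j r \<star> N \<star> N'"
    using sub_hmul_nullary[OF \<epsilon>_K assms(5) substs1[OF a(1)]] a(2) assms by simp
  also have "\<dots> = \<epsilon> j r \<star> (N \<star> N')" using hmul_assoc[OF \<epsilon>_K assms(4,5)] assms by simp
  finally show ?thesis using sharp_flat[OF _ assms(3) c] by simp
qed

lemma flat_hom_law_id:
  assumes "(t, U, D) \<in> flat_data"
  shows "flat_hom_law (t, U, D) (t, U, D) (hone t)"
proof -
  have t: "t \<in> T" "t \<in> over" and k: "U \<in> K j [] t" "D \<in> K t [rep X j t] t" using assms by (auto simp: flat_data_def)
  have "sharp j t (\<epsilon> j t \<star> hone t) = cid X (rep X j t)"
    using hmul_hone(1)[OF \<epsilon>_K, of j t] sharp_\<epsilon>[of j t] t by simp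
  then show ?thesis using hmul_hone[OF k(1)] hmul_hone[OF k(2)] cids_K[OF k(2)] by (simp add: flat_hom_law_def)
qed

text \<open>As \<open>N'\<close> is nullary, a substitution into \<open>D'\<close> is also one into
  \<open>D' \<star> N'\<close>, to which the law for \<open>N'\<close> applies. Then
  \<open>N'\<close> stands to the left of \<open>D''\<close>, and the two substitutions into
  \<open>D''\<close> merge by functoriality of \<open>E(j,-)\<close>.\<close>

lemma flat_hom_law_comp:
  assumes "(t, U, D) \<in> flat_data" "(t', U', D') \<in> flat_data" "(t'', U'', D'') \<in> flat_data"
    "N \<in> K t [] t'" "N' \<in> K t' [] t''"
    and "flat_hom_law (t, U, D) (t', U', D') N" "flat_hom_law (t', U', D') (t'', U'', D'') N'"
  shows "flat_hom_law (t, U, D) (t'', U'', D'') (N \<star> N')"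
proof -
  have t: "t \<in> over" "t' \<in> over" "t'' \<in> over" and U: "U \<in> K j [] t" "U' \<in> K j [] t'"
    and D: "D \<in> K t [rep X j t] t" "D' \<in> K t' [rep X j t'] t'" "D'' \<in> K t'' [rep X j t''] t''"
    using assms by (auto simp: flat_data_def)
  let ?s = "sharp j t' (\<epsilon> j t \<star> N)" and ?s' = "sharp j t'' (\<epsilon> j t' \<star> N')"
  note s = substs1[OF \<epsilon>_hmul_sharp(1)[OF t(1,2) assms(4)]] and s' = substs1[OF \<epsilon>_hmul_sharp(1)[OF t(2,3) assms(5)]]
  have h: "U \<star> N = U'" "U' \<star> N' = U''" "D \<star> N = N \<star> sub D' [?s]" "D' \<star> N' = N' \<star> sub D'' [?s']"
    using assms(6,7) by (auto simp: flat_hom_law_def)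
  have "D \<star> (N \<star> N') = N \<star> sub D' [?s] \<star> N'"
    using hmul_assoc[OF D(1) assms(4,5)] h by simp
  also have "\<dots> = N \<star> sub (D' \<star> N') [?s]"
    using hmul_assoc[OF assms(4) sub_K'[OF D(2) s] assms(5)] sub_hmul_nullary[OF D(2) assms(5) s] by simp
  also have "\<dots> = N \<star> (N' \<star> sub (sub D'' [?s']) [?s])"
    using sub_nullary_hmul[OF assms(5) sub_K'[OF D(3) s'] s] h by simp
  also have "sub (sub D'' [?s']) [?s] = sub D'' [sub ?s' [?s]]"
    using sub_sub1[OF D(3) \<epsilon>_hmul_sharp(1)[OF t(2,3) assms(5)] s] by simp
  also have "sub ?s' [?s] = sharp j t'' (\<epsilon> j t \<star> (N \<star> N'))" using sharp_comp[OF t assms(4,5)] .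
  also have "N \<star> (N' \<star> sub D'' [\<dots>]) = N \<star> N' \<star> sub D'' [\<dots>]"
    using hmul_assoc[OF assms(4,5) sub_K'[OF D(3) substs1[OF \<epsilon>_hmul_sharp(1)[OF t(1,3) hmul_K[OF assms(4,5)]]]]] by simp
  finally show ?thesis using h hmul_assoc[OF U(1) assms(4,5)] by (simp add: flat_hom_law_def)
qed

text \<open>Closure of \<open>flat_hom\<close> under identities and composition is settled here
  once, so that each kind of structure has to supply only the naming of objects and morphisms and
  its compatibility with identities, composition and the forgetful functor.\<close>

lemma flat_presents:
  assumes "bij_betw f flat_monads (Obj C)"
    and "\<And>S. S \<in> flat_monads \<Longrightarrow> fob V (f S) = fst S \<and> Idn C (f S) = g S S (cid X (rep X one (fst S)))"
    and "\<And>S S'. S \<in> flat_monads \<Longrightarrow> S' \<in> flat_monads \<Longrightarrow> Hom C (f S) (f S') = g S S' ` flat_hom S S' \<and>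
      (\<forall>\<tau>\<in>flat_hom S S'. farr V (f S) (f S') (g S S' \<tau>) = \<tau>)"
    and "\<And>S S' S'' \<tau> \<sigma>. S \<in> flat_monads \<Longrightarrow> S' \<in> flat_monads \<Longrightarrow> S'' \<in> flat_monads \<Longrightarrow>
      \<tau> \<in> flat_hom S S' \<Longrightarrow> \<sigma> \<in> flat_hom S' S'' \<Longrightarrow>
      Comp C (f S) (f S') (f S'') (g S' S'' \<sigma>) (g S S' \<tau>) = g S S'' (vcomp X \<sigma> \<tau>)"
  shows "presents (tight_hom_cat X A E) flat_monads fst flat_hom C V f g"
proof -
  have T: "fst S \<in> T" if "S \<in> flat_monads" for S
    using that by (auto simp: flat_monads_def flat_data_def)
  have c: "vcomp X \<sigma> \<tau> \<in> flat_hom S S''"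
    if "S \<in> flat_monads" "S' \<in> flat_monads" "S'' \<in> flat_monads" "\<tau> \<in> flat_hom S S'" "\<sigma> \<in> flat_hom S' S''"
    for S S' S'' \<tau> \<sigma>
  proof -
    have \<tau>: "\<tau> \<in> cells X [rep X one (fst S)] (rep X one (fst S'))"
      "\<sigma> \<in> cells X [rep X one (fst S')] (rep X one (fst S''))" using that by (auto simp: flat_hom_def)
    have "flat_hom_law S S'' (nullary X (fst S) (fst S') \<tau> \<star> nullary X (fst S') (fst S'') \<sigma>)"
      using that flat_hom_law_comp[of "fst S" "fst (snd S)" "snd (snd S)" "fst S'" "fst (snd S')" "snd (snd S')"
          "fst S''" "fst (snd S'')" "snd (snd S'')"] nullary_K[OF T T \<tau>(1)] nullary_K[OF T T \<tau>(2)]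
      by (auto simp: flat_monads_def flat_hom_def)
    then show ?thesis
      using nullary_vcomp[OF T T T \<tau>] vcomp_cells(2)[OF \<tau>(2,1)] that by (simp add: flat_hom_def)
  qed
  have i: "cid X (rep X one (fst S)) \<in> flat_hom S S" if "S \<in> flat_monads" for S
    using that flat_hom_law_id[of "fst S" "fst (snd S)" "snd (snd S)"] nullary_cid[OF T[OF that]] T[OF that]
    by (simp add: flat_monads_def flat_hom_def)
  have b: "Hom (tight_hom_cat X A E) s t = cells X [companion X s] (companion X t)"
    "Obj (tight_hom_cat X A E) = T" "Idn (tight_hom_cat X A E) s = cid X (companion X s)"
    "Comp (tight_hom_cat X A E) r s t \<sigma> \<tau> = vcomp X \<sigma> \<tau>" for r s t \<sigma> \<tau>
    by (auto simp: tight_hom_cat_def)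
  show ?thesis unfolding presents_def b
  proof (intro conjI ballI tight_hom_category assms(1))
    fix S S' assume S: "S \<in> flat_monads" "S' \<in> flat_monads"
    show "flat_hom S S' \<subseteq> cells X [companion X (fst S)] (companion X (fst S'))"
      using T[OF S(1)] T[OF S(2)] by (auto simp: flat_hom_def T_simps)
  qed (use assms(2-4) T i c T_simps in auto)
qed

section \<open>Relative monads\<close>

lemma rep_right_sharp:
  "x \<in> over \<Longrightarrow> s \<in> T \<Longrightarrow> rep_right X x s t \<tau> = sharp x t (\<epsilon> x s \<star> nullary X s t \<tau>)"
  using K_simps(4)[OF \<epsilon>_K[of x s]] by (simp add: rep_right_def sharp_def hmul_def overD)

lemma rep_left_sharp:
  assumes "s \<in> T" "t \<in> T" "\<tau> \<in> cells X [rep X one s] (rep X one t)" "y \<in> over"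
  shows "rep_left X s t \<tau> y = sharp s y (nullary X s t \<tau> \<star> \<epsilon> t y)"
  using K_simps(4)[OF nullary_K[OF assms(1-3)]] assms by (simp add: rep_left_def sharp_def hmul_def overD T_simps)

lemma rep_right_cells:
  assumes "x \<in> over" "s \<in> T" "t \<in> T" "\<tau> \<in> cells X [rep X one s] (rep X one t)"
  shows "rep_right X x s t \<tau> \<in> cells X [rep X x s] (rep X x t)"
    "sub (\<epsilon> x t) [rep_right X x s t \<tau>] = \<epsilon> x s \<star> nullary X s t \<tau>"
proof -
  have k: "\<epsilon> x s \<star> nullary X s t \<tau> \<in> K x [rep X x s] t"
    using hmul_K[OF \<epsilon>_K nullary_K[OF assms(2-4)]] assms by simp
  show "rep_right X x s t \<tau> \<in> cells X [rep X x s] (rep X x t)"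
    "sub (\<epsilon> x t) [rep_right X x s t \<tau>] = \<epsilon> x s \<star> nullary X s t \<tau>"
    using sharp_cells[OF k] rep_cell_sharp[OF k] rep_right_sharp[OF assms(1,2)] by simp_all
qed

lemma rep_left_cells:
  assumes "s \<in> T" "t \<in> T" "\<tau> \<in> cells X [rep X one s] (rep X one t)" "y \<in> over"
  shows "rep_left X s t \<tau> y \<in> cells X [rep X t y] (rep X s y)"
    "sub (\<epsilon> s y) [rep_left X s t \<tau> y] = nullary X s t \<tau> \<star> \<epsilon> t y"
proof -
  have k: "nullary X s t \<tau> \<star> \<epsilon> t y \<in> K s [rep X t y] y"
    using hmul_K[OF nullary_K[OF assms(1-3)] \<epsilon>_K] assms by simp
  show "rep_left X s t \<tau> y \<in> cells X [rep X t y] (rep X s y)"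
    "sub (\<epsilon> s y) [rep_left X s t \<tau> y] = nullary X s t \<tau> \<star> \<epsilon> t y"
    using sharp_cells[OF k] rep_cell_sharp[OF k] rep_left_sharp[OF assms] by simp_all
qed

lemma frown_cells:
  assumes "t \<in> T"
  shows "frown X t \<in> cells X [] (rep X t t)" "sub (\<epsilon> t t) [frown X t] = hone t"
proof -
  have k: "hone t \<in> K t [] t" using hone_K T_simps(1)[OF assms] .
  have "frown X t = sharp t t (hone t)" by (simp add: frown_def sharp_def hone_def)
  then show "frown X t \<in> cells X [] (rep X t t)" "sub (\<epsilon> t t) [frown X t] = hone t"
    using sharp_cells[OF k] rep_cell_sharp[OF k] by simp_all
qed

lemma jT [simp]: "j \<in> T" by (rule j)

text \<open>Surjectivity asks only for raw data mapped to \<open>R\<close>; the equivalence of the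
  laws then places these data in \<open>flat_monads\<close>.\<close>

lemma bij_flat_monads:
  assumes "\<And>S. S \<in> flat_data \<Longrightarrow> k (f S) = S" "\<And>S. S \<in> flat_data \<Longrightarrow> Q (f S) \<longleftrightarrow> flat_law S"
    "\<And>R. Q R \<Longrightarrow> \<exists>S\<in>flat_data. f S = R"
  shows "bij_betw f flat_monads {R. Q R}"
proof (rule bij_betw_imageI)
  show "inj_on f flat_monads"
    by (rule inj_on_inverseI[where g = k]) (simp add: assms(1) flat_monads_def)
  show "f ` flat_monads = {R. Q R}"
    using assms(2,3) unfolding flat_monads_def by blast
qed

definition rmnd_of :: "'t \<times> 'c \<times> 'c \<Rightarrow> 't \<times> 'c \<times> 'c" where
  "rmnd_of = (\<lambda>(t, U, D). (t, sharp t t D, tau j t U))"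

text \<open>Flattening both sides exposes a common factor \<open>\<epsilon> one j\<close>, which
  cancels. The unit condition on morphisms has this form for relative monads and for skew monoids
  alike.\<close>

lemma unit_iff:
  assumes "t \<in> T" "t' \<in> T" "U \<in> K j [] t" "U' \<in> K j [] t'" "\<tau> \<in> cells X [rep X one t] (rep X one t')"
  shows "sub \<tau> [tau j t U] = tau j t' U' \<longleftrightarrow> U \<star> nullary X t t' \<tau> = U'"
proof -
  let ?N = "nullary X t t' \<tau>"
  note N = nullary_K[OF assms(1,2,5)]
  note u = tau_cells[OF jT assms(1,3)] and u' = tau_cells[OF jT assms(2,4)]
  note s = substs1[OF u]
  have "sub (\<epsilon> one t') [sub \<tau> [tau j t U]] = \<epsilon> one j \<star> U \<star> ?N"
    using flat_sub[OF _ _ assms(5) s] sub_hmul_nullary[OF \<epsilon>_K N s] flat_tau[OF assms(1,2,5)]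
      flat_tau_N[OF jT assms(1,3)] assms by simp
  also have "\<dots> = \<epsilon> one j \<star> (U \<star> ?N)" using hmul_assoc[OF \<epsilon>_K assms(3) N] by simp
  finally have "sub \<tau> [tau j t U] = tau j t' U' \<longleftrightarrow> \<epsilon> one j \<star> (U \<star> ?N) = \<epsilon> one j \<star> U'"
    using flat_eq_iff[OF _ _ sub_cells'[OF assms(5) s] u'] flat_tau_N[OF jT assms(2,4)] assms(2) by simp
  then show ?thesis using one_\<epsilon>_cancel[OF _ assms(4), of "U \<star> ?N"] hmul_K[OF assms(3) N] by simp
qed

text \<open>Each axiom equates 2-cells into some \<open>E(x,y)\<close> and can be tested after
  composition with \<open>\<epsilon> x y\<close>. There \<open>rep_left\<close>,
  \<open>rep_right\<close> and \<open>smile\<close> become products, and the three axioms become the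
  three equations of \<open>flat_law\<close>, in the same order.\<close>

lemma rmnd_of_law:
  assumes "(t, U, D) \<in> flat_data"
  shows "is_rel_monad X j (rmnd_of (t, U, D)) \<longleftrightarrow> flat_law (t, U, D)"
proof -
  have t: "t \<in> T" "t \<in> over" and U: "U \<in> K j [] t" and D: "D \<in> K t [rep X j t] t"
    using assms by (auto simp: flat_data_def)
  let ?d = "sharp t t D" and ?\<eta> = "tau j t U" and ?U = "sharp j t U" and ?w = "sharp j t (\<epsilon> j t \<star> D)"
  have d: "?d \<in> cells X [rep X j t] (rep X t t)" "sub (\<epsilon> t t) [?d] = D"
    using sharp_cells[OF D] rep_cell_sharp[OF D] .
  have \<eta>: "?\<eta> \<in> cells X [rep X one j] (rep X one t)" "nullary X j t ?\<eta> = U"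
    using tau_cells[OF jT t(1) U] nullary_tau[OF jT t(1) U] .
  have Us: "?U \<in> cells X [] (rep X j t)" "sub (\<epsilon> j t) [?U] = U" using sharp_cells[OF U] rep_cell_sharp[OF U] .
  note w = \<epsilon>_hmul_sharp[OF t(2,2) D]
  note rl = rep_left_cells[OF jT t(1) \<eta>(1) t(2), unfolded \<eta>(2)]
  note rr = rep_right_cells[OF over_simps(1) jT t(1) \<eta>(1), unfolded \<eta>(2)]
  note sd = substs1[OF d(1)]

  have "vcomp X (rep_left X j t ?\<eta> t) ?d = cid X (rep X j t) \<longleftrightarrow> U \<star> D = \<epsilon> j t"
  proof -
    have "sub (\<epsilon> j t) [sub (rep_left X j t ?\<eta> t) [?d]] = U \<star> D"
      using flat_sub[OF _ t(2) rl(1) sd] sub_nullary_hmul[OF U \<epsilon>_K[OF t(2,2)] sd] rl(2) d(2) by simp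
    then show ?thesis
      using flat_eq_iff[OF _ t(2) vcomp_cells(2)[OF rl(1) d(1)] cid_rep] vcomp_cells(1)[OF rl(1) d(1)] t by simp
  qed
  moreover have "vcomp X ?d (vcomp X (rep_right X j j t ?\<eta>) (frown X j)) = frown X t \<longleftrightarrow> sub D [?U] = hone t"
  proof -
    note fj = frown_cells[OF jT] and ft = frown_cells[OF t(1)]
    note v = vcomp_cells[OF rr(1) fj(1)]
    \<comment> \<open>\<open>E(j,\<eta>)\<close> composed with \<open>frown X j\<close> is
      \<open>U\<close> itself, seen as a 2-cell into \<open>E(j,t)\<close>: \<open>frown X j\<close>
      flattens to \<open>hone j\<close>, which is neutral.\<close>
    have "sub (\<epsilon> j t) [sub (rep_right X j j t ?\<eta>) [frown X j]] = U"
      using flat_sub[OF _ t(2) rr(1) substs1[OF fj(1)]] rr(2) fj(2) hmul_hone[OF U]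
        sub_hmul_nullary[OF \<epsilon>_K U substs1[OF fj(1)]] by simp
    then have "vcomp X (rep_right X j j t ?\<eta>) (frown X j) = ?U"
      using sharp_flat[OF _ t(2) v(2)] v(1) by simp
    then show ?thesis
      using vcomp_cells[OF d(1) Us(1)] flat_eq_iff[OF t(2,2) _ ft(1)] flat_sub[OF t(2,2) d(1) substs1[OF Us(1)]]
        ft(2) d(2) by simp
  qed
  moreover have "ccomp X (smile X t t t) (tid X A) [?d, ?d] =
       vcomp X ?d (ccomp X (smile X t j t) (tid X A) [cid X (rep X j t), ?d]) \<longleftrightarrow> D \<star> D = sub D [?w]"
  proof -
    have cj: "j \<in> over" "cid X (rep X j t) \<in> cells X [rep X j t] (rep X j t)" using t by simp_all
    note sm = smile_over[OF t(2,2,2)] and sj = smile_over[OF cj(1) t(2,2)]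
    note dd = substs2[OF d(1) d(1)] and cd = substs2[OF cj(2) d(1)]
    have c: "ccomp X (smile X t t t) (tid X A) [?d, ?d] = sub (smile X t t t) [?d, ?d]"
      "ccomp X (smile X t j t) (tid X A) [cid X (rep X j t), ?d] = sub (smile X t j t) [cid X (rep X j t), ?d]"
      using cells_simps(4)[OF sm(1)] cells_simps(4)[OF sj(1)] t by (simp_all add: sub_def T_simps)
    note c1 = sub_cells'[OF sm(1) dd[simplified]] and c2 = sub_cells'[OF sj(1) cd[simplified]]
    have "sub (\<epsilon> t t) [sub (smile X t t t) [?d, ?d]] = D \<star> D"
      using flat_sub[OF t(2,2) sm(1) dd[simplified]] sm(2) d(2) sub_hmul'[OF \<epsilon>_K \<epsilon>_K sd sd] t by simp
    \<comment> \<open>Applying \<open>?d\<close> in the second position and then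
      \<open>smile X t j t\<close> flattens to \<open>\<epsilon> j t \<star> D\<close>, so the cell
      to which \<open>?d\<close> is applied last is \<open>?w\<close>.\<close>
    moreover have "sub (\<epsilon> j t) [sub (smile X t j t) [cid X (rep X j t), ?d]] = \<epsilon> j t \<star> D"
      using flat_sub[OF cj(1) t(2) sj(1) cd[simplified]] sj(2) d(2)
        sub_hmul_right[OF \<epsilon>_K \<epsilon>_K sd, of j] t by simp
    then have "sub (smile X t j t) [cid X (rep X j t), ?d] = ?w"
      using sharp_flat[OF cj(1) t(2) c2] by simp
    ultimately show ?thesis
      using c vcomp_cells[OF d(1) w(1)] flat_eq_iff[OF t(2,2) c1 vcomp_cells(2)[OF d(1) w(1), simplified]]
        flat_sub[OF t(2,2) d(1) substs1[OF w(1)]] d(2) by simp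
  qed
  ultimately show ?thesis using t d(1) \<eta>(1)
    by (simp add: is_rel_monad_def rmnd_of_def flat_law_def T_simps)
qed

lemma rmnd_of_hom:
  assumes S: "(t, U, D) \<in> flat_data" and S': "(t', U', D') \<in> flat_data"
  shows "is_rel_monad_morphism X j (rmnd_of (t, U, D)) (rmnd_of (t', U', D')) \<tau> \<longleftrightarrow>
    \<tau> \<in> flat_hom (t, U, D) (t', U', D')"
proof (cases "\<tau> \<in> cells X [rep X one t] (rep X one t')")
  \<comment> \<open>Both sides contain the frame condition on \<open>\<tau>\<close>, so they fail
    together.\<close>
  case False
  then show ?thesis using assms by (auto simp: is_rel_monad_morphism_def rmnd_of_def flat_hom_def flat_data_def T_simps)
next
  case \<tau>: True
  have t: "t \<in> T" "t \<in> over" and U: "U \<in> K j [] t" and D: "D \<in> K t [rep X j t] t"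
    using S by (auto simp: flat_data_def)
  have t': "t' \<in> T" "t' \<in> over" and U': "U' \<in> K j [] t'" and D': "D' \<in> K t' [rep X j t'] t'"
    using S' by (auto simp: flat_data_def)
  let ?N = "nullary X t t' \<tau>"
  let ?d = "sharp t t D" and ?d' = "sharp t' t' D'" and ?r = "sharp j t' (\<epsilon> j t \<star> ?N)"
  note N = nullary_K[OF t(1) t'(1) \<tau>]
  have d: "?d \<in> cells X [rep X j t] (rep X t t)" "sub (\<epsilon> t t) [?d] = D"
    using sharp_cells[OF D] rep_cell_sharp[OF D] .
  have d': "?d' \<in> cells X [rep X j t'] (rep X t' t')" "sub (\<epsilon> t' t') [?d'] = D'"
    using sharp_cells[OF D'] rep_cell_sharp[OF D'] .
  note rl = rep_left_cells[OF t(1) t'(1) \<tau> t'(2)]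
  note rr = rep_right_cells[OF t(2,1) t'(1) \<tau>]
  note rj = rep_right_cells[OF over_simps(1) t(1) t'(1) \<tau>] rep_right_sharp[OF over_simps(1) t(1), of t' \<tau>]
  note sd = substs1[OF d(1)] and sj = substs1[OF rj(1)]
  note v = vcomp_cells[OF rr(1) d(1)] and v' = vcomp_cells[OF d'(1) rj(1)]
  note v'' = vcomp_cells[OF rl(1) v'(2)]
  have 1: "sub (\<epsilon> t t') [vcomp X (rep_right X t t t' \<tau>) ?d] = D \<star> ?N"
    using flat_sub[OF t(2) t'(2) rr(1) sd] v(1) sub_hmul_nullary[OF \<epsilon>_K[OF t(2,2)] N sd] rr(2) d(2) by simp
  have 2: "sub (\<epsilon> t' t') [vcomp X ?d' (rep_right X j t t' \<tau>)] = sub D' [?r]"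
    using flat_sub[OF t'(2,2) d'(1) sj] v'(1) d'(2) rj(3) by simp
  have "sub (\<epsilon> t t') [vcomp X (rep_left X t t' \<tau> t') (vcomp X ?d' (rep_right X j t t' \<tau>))] = ?N \<star> sub D' [?r]"
    using flat_sub[OF t(2) t'(2) rl(1) substs1[OF v'(2)]] v''(1) rl(2)
      sub_nullary_hmul[OF N \<epsilon>_K[OF t'(2,2)] substs1[OF v'(2)]] 2 by simp
  then have "vcomp X (rep_right X t t t' \<tau>) ?d = vcomp X (rep_left X t t' \<tau> t') (vcomp X ?d' (rep_right X j t t' \<tau>))
      \<longleftrightarrow> D \<star> ?N = ?N \<star> sub D' [?r]"
    using flat_eq_iff[OF t(2) t'(2) v(2) v''(2)] 1 by simp
  moreover have "vcomp X \<tau> (tau j t U) = tau j t' U' \<longleftrightarrow> U \<star> ?N = U'"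
    using unit_iff[OF t(1) t'(1) U U' \<tau>] vcomp_cells(1)[OF \<tau> tau_cells[OF jT t(1) U]] by simp
  ultimately show ?thesis using \<tau> t t'
    by (simp add: is_rel_monad_morphism_def rmnd_of_def flat_hom_def flat_hom_law_def T_simps)
qed

lemma rmnd_presents:
  "presents (tight_hom_cat X A E) flat_monads fst flat_hom (RMnd X j) RMnd_forget rmnd_of (\<lambda>_ _ \<tau>. \<tau>)"
proof (rule flat_presents)
  let ?k = "\<lambda>(t, d, \<eta>). (t, nullary X j t \<eta>, sub (\<epsilon> t t) [d])"
  have "bij_betw rmnd_of flat_monads {R. is_rel_monad X j R}"
  proof (rule bij_flat_monads[where k = ?k])
    fix S assume "S \<in> flat_data"
    then show "?k (rmnd_of S) = S"
      using nullary_tau[OF jT] rep_cell_sharp by (auto simp: rmnd_of_def flat_data_def)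
  next
    fix S assume "S \<in> flat_data"
    then show "is_rel_monad X j (rmnd_of S) \<longleftrightarrow> flat_law S" using rmnd_of_law by (cases S) auto
  next
    fix R assume R: "is_rel_monad X j R"
    obtain t d \<eta> where [simp]: "R = (t, d, \<eta>)" by (cases R)
    from R have t: "t \<in> T" and d: "d \<in> cells X [rep X j t] (rep X t t)" and
      \<eta>: "\<eta> \<in> cells X [rep X one j] (rep X one t)"
      by (auto simp: is_rel_monad_def T_simps)
    show "\<exists>S\<in>flat_data. rmnd_of S = R"
      using nullary_K[OF jT t \<eta>] flat_K[OF _ _ d] tau_nullary[OF jT t \<eta>] sharp_flat[OF _ _ d] t
      by (intro bexI[where x = "?k R"]) (auto simp: rmnd_of_def flat_data_def)
  qed
  then show "bij_betw rmnd_of flat_monads (Obj (RMnd X j))" by (simp add: RMnd_def)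
next
  fix S assume "S \<in> flat_monads"
  then show "fob RMnd_forget (rmnd_of S) = fst S \<and> Idn (RMnd X j) (rmnd_of S) = cid X (rep X one (fst S))"
    by (auto simp: RMnd_def RMnd_forget_def rmnd_of_def flat_monads_def flat_data_def T_simps)
next
  fix S S' assume "S \<in> flat_monads" "S' \<in> flat_monads"
  then show "Hom (RMnd X j) (rmnd_of S) (rmnd_of S') = (\<lambda>\<tau>. \<tau>) ` flat_hom S S' \<and>
      (\<forall>\<tau>\<in>flat_hom S S'. farr RMnd_forget (rmnd_of S) (rmnd_of S') \<tau> = \<tau>)"
    using rmnd_of_hom by (cases S, cases S') (auto simp: RMnd_def RMnd_forget_def flat_monads_def)
qed (simp add: RMnd_def)

section \<open>Monoids in the skew-multicategory\<close>

text \<open>The opcartesian 2-cell that composes \<open>E(j,1)\<close> with \<open>E(1,t)\<close>.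
  Through it, two adjacent loose-cells in \<open>skew_dom\<close> are read as the single loose-cell
  \<open>E(j,t)\<close>.\<close>

abbreviation smile_j :: "'t \<Rightarrow> 'c" where
  "smile_j t \<equiv> smile X one j t"

lemma smile_j:
  assumes "t \<in> over"
  shows "smile_j t \<in> cells X [rep X j one, rep X one t] (rep X j t)"
    and "sub (\<epsilon> j t) [smile_j t] = \<epsilon> j one \<star> \<epsilon> one t"
  using smile_over[of j one t] assms by simp_all

lemma opcartesian_smile_j: "t \<in> over \<Longrightarrow> opcartesian X (smile_j t)"
  using opcartesian_smile[of j t E] by (simp add: overD)

lemma smile_j_cancel:
  assumes "t \<in> over" "\<chi> \<in> K x (ps @ [rep X j t] @ rs) y" "\<chi>' \<in> K x (ps @ [rep X j t] @ rs) y"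
    "paste X \<chi> ps (smile_j t) rs = paste X \<chi>' ps (smile_j t) rs"
  shows "\<chi> = \<chi>'"
  by (rule opcartesian_cancel[OF opcartesian_smile_j[OF assms(1)], of _ _ ps rs])
    (use K_simps[OF assms(2)] K_simps[OF assms(3)] cells_simps(3)[OF smile_j(1)[OF assms(1)]] assms(4) in auto)

lemma smile_j_surj:
  assumes "t \<in> over" "\<omega> \<in> K x (ps @ [rep X j one, rep X one t] @ rs) y"
  shows "\<exists>\<chi>\<in>K x (ps @ [rep X j t] @ rs) y. paste X \<chi> ps (smile_j t) rs = \<omega>"
proof -
  note k = K_simps[OF assms(2)] and s = cells_simps[OF smile_j(1)[OF assms(1)]]
  have "chain X (tdom X (cleft X \<omega>)) (ps @ [rep X j t] @ rs) (tdom X (cright X \<omega>))"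
    using k assms(1) by (auto simp: chain_append)
  then have "is_opfactor X (smile_j t) ps \<omega> rs (opfactor X (smile_j t) ps \<omega> rs)"
    using opfactor[OF opcartesian_smile_j[OF assms(1)] k(1), of ps rs] k s by simp
  then show ?thesis
    using k s by (intro bexI[where x = "opfactor X (smile_j t) ps \<omega> rs"]) (auto simp: is_opfactor_def K_def)
qed

lemma smile_j_cancel1:
  assumes "t \<in> over" "\<chi> \<in> K x [rep X j t] y" "\<chi>' \<in> K x [rep X j t] y"
  shows "sub \<chi> [smile_j t] = sub \<chi>' [smile_j t] \<longleftrightarrow> \<chi> = \<chi>'"
  using smile_j_cancel[of t \<chi> x "[]" "[]" y \<chi>'] assms by (auto simp: paste_sub)

text \<open>The simultaneous substitution is split into two pastings, first at the left position and
  then at the right one, so that opcartesianness is applied to one position at a time.\<close>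

lemma smile_j_cancel2:
  assumes "t \<in> over" "\<chi> \<in> K x [rep X j t, rep X j t] y" "\<chi>' \<in> K x [rep X j t, rep X j t] y"
  shows "sub \<chi> [smile_j t, smile_j t] = sub \<chi>' [smile_j t, smile_j t] \<longleftrightarrow> \<chi> = \<chi>'"
proof -
  let ?s = "smile_j t" and ?q = "rep X j t" and ?c = "[cid X (rep X j one), cid X (rep X one t)]"
  have s: "?s \<in> cells X [rep X j one, rep X one t] ?q" using smile_j(1)[OF assms(1)] .
  have ci: "cid X ?q \<in> cells X [?q] ?q" "cid X (rep X j one) \<in> glob" "cid X (rep X one t) \<in> glob"
    using assms(1) cells_glob[OF cid_rep] by simp_all
  have e: "sub \<psi> [?s, ?s] = paste X (paste X \<psi> [] ?s [?q]) [rep X j one, rep X one t] ?s []"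
    and p: "paste X \<psi> [] ?s [?q] \<in> K x [rep X j one, rep X one t, ?q] y"
    if "\<psi> \<in> K x [?q, ?q] y" for \<psi>
  proof -
    note k = K_simps[OF that]
    have "sub (sub \<psi> [?s, cid X ?q]) (concat [?c, [?s]]) = sub \<psi> (map2 sub [?s, cid X ?q] [?c, [?s]])"
      by (rule sub_sub) (use k cells_simps[OF s] cells_glob[OF s] cells_glob[OF ci(1)] ci assms(1) in auto)
    moreover have "sub ?s ?c = ?s" "sub (cid X ?q) [?s] = ?s"
      using sub_cid[of ?s] cid_sub[OF cells_glob[OF s]] cells_simps[OF s] by simp_all
    ultimately show "sub \<psi> [?s, ?s] = paste X (paste X \<psi> [] ?s [?q]) [rep X j one, rep X one t] ?s []"
      by (simp add: paste_sub)
    show "paste X \<psi> [] ?s [?q] \<in> K x [rep X j one, rep X one t, ?q] y"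
      using paste_K[OF _ s, of \<psi> x "[]" "[?q]" y] that by simp
  qed
  show ?thesis
    using smile_j_cancel[OF assms(1), of "paste X \<chi> [] ?s [?q]" x "[rep X j one, rep X one t]" "[]" y "paste X \<chi>' [] ?s [?q]"]
      smile_j_cancel[OF assms(1), of \<chi> x "[]" "[?q]" y \<chi>'] e p assms by auto
qed

text \<open>Naturality of \<open>smile_j\<close> in its second argument. The instances are the unit
  (\<open>\<psi>\<close> is \<open>U\<close>), a morphism (\<open>\<psi>\<close> is its nullary
  form) and the multiplication (\<open>\<psi>\<close> is \<open>D\<close>, and
  \<open>\<alpha>s\<close> holds one more \<open>smile_j\<close>), each standing to the right of
  \<open>E(j,1)\<close>.\<close>

lemma smile_j_right:
  assumes "t \<in> over" "r \<in> over" "\<psi> \<in> K r qs t" "substs \<alpha>s ps qs"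
    "\<phi> \<in> cells X (rep X one r # ps) (rep X one t)" "sub (\<epsilon> one t) [\<phi>] = \<epsilon> one r \<star> sub \<psi> \<alpha>s"
  shows "sub (smile_j t) [cid X (rep X j one), \<phi>] = sub (sharp j t (\<epsilon> j r \<star> \<psi>)) (smile_j r # \<alpha>s)"
proof -
  note st = smile_j[OF assms(1)] and sr = smile_j[OF assms(2)]
  note w = \<epsilon>_hmul_sharp[OF assms(2,1,3)]
  have ci: "cid X (rep X j one) \<in> cells X [rep X j one] (rep X j one)" by simp
  note s1 = substs2[OF ci assms(5), simplified] and s2 = substs_Cons[OF sr(1) assms(4), simplified]
  have "sub (\<epsilon> j t) [sub (smile_j t) [cid X (rep X j one), \<phi>]] = \<epsilon> j one \<star> (\<epsilon> one r \<star> sub \<psi> \<alpha>s)"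
    using flat_sub[OF _ assms(1) st(1) s1] st(2) sub_hmul_right[OF \<epsilon>_K \<epsilon>_K substs1[OF assms(5)], of j] assms
    by simp
  also have "\<dots> = sub (\<epsilon> j r) [smile_j r] \<star> sub \<psi> \<alpha>s"
    using hmul_assoc[OF \<epsilon>_K \<epsilon>_K sub_K'[OF assms(3,4)], of j one] sr(2) assms by simp
  also have "\<dots> = sub (\<epsilon> j t) [sub (sharp j t (\<epsilon> j r \<star> \<psi>)) (smile_j r # \<alpha>s)]"
    using flat_sub[OF _ assms(1) w(1) s2] w(2) sub_hmul'[OF \<epsilon>_K assms(3) substs1[OF sr(1)] assms(4)] assms by simp
  finally show ?thesis
    using flat_eq_iff[OF _ assms(1) sub_cells'[OF st(1) s1] sub_cells'[OF w(1) s2]] by simp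
qed

definition skew_mult :: "'t \<Rightarrow> 'c \<Rightarrow> 'c" where
  "skew_mult t D = sharp one t (\<epsilon> one t \<star> sub D [smile_j t])"

definition skew_of :: "'t \<times> 'c \<times> 'c \<Rightarrow> 't \<times> 'c \<times> 'c" where
  "skew_of = (\<lambda>(t, U, D). (t, skew_mult t D, tau j t U))"

lemma skew_mult:
  assumes "t \<in> over" "D \<in> K t [rep X j t] t"
  shows "sub D [smile_j t] \<in> K t [rep X j one, rep X one t] t"
    "skew_mult t D \<in> cells X [rep X one t, rep X j one, rep X one t] (rep X one t)"
    "sub (\<epsilon> one t) [skew_mult t D] = \<epsilon> one t \<star> sub D [smile_j t]"
proof -
  show d: "sub D [smile_j t] \<in> K t [rep X j one, rep X one t] t"
    using sub_K'[OF assms(2) substs1[OF smile_j(1)[OF assms(1)]]] .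
  have k: "\<epsilon> one t \<star> sub D [smile_j t] \<in> K one [rep X one t, rep X j one, rep X one t] t"
    using hmul_K[OF \<epsilon>_K d, of one] assms by simp
  show "skew_mult t D \<in> cells X [rep X one t, rep X j one, rep X one t] (rep X one t)"
    "sub (\<epsilon> one t) [skew_mult t D] = \<epsilon> one t \<star> sub D [smile_j t]"
    unfolding skew_mult_def using sharp_cells[OF k] rep_cell_sharp[OF k] .
qed

lemma skew_mult_inj:
  "t \<in> over \<Longrightarrow> D \<in> K t [rep X j t] t \<Longrightarrow> D' \<in> K t [rep X j t] t \<Longrightarrow> skew_mult t D = skew_mult t D' \<Longrightarrow> D = D'"
  using skew_mult[of t D] skew_mult[of t D'] one_\<epsilon>_cancel[of "sub D [smile_j t]" t _ t "sub D' [smile_j t]"]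
    smile_j_cancel1[of t D t t D'] by simp

text \<open>The leading \<open>E(1,t)\<close> is removed by companion transposition, and the
  remaining \<open>E(j,1), E(1,t)\<close> is contracted by factoring through
  \<open>smile_j t\<close>.\<close>

lemma skew_mult_surj:
  assumes "t \<in> over" "m \<in> cells X [rep X one t, rep X j one, rep X one t] (rep X one t)"
  shows "\<exists>D\<in>K t [rep X j t] t. skew_mult t D = m"
proof -
  have k: "sub (\<epsilon> one t) [m] \<in> K one (rep X one t # [rep X j one, rep X one t]) t" using flat_K[OF _ _ assms(2)] assms(1) by simp
  then obtain \<omega> where w: "\<omega> \<in> K t [rep X j one, rep X one t] t" "\<epsilon> one t \<star> \<omega> = sub (\<epsilon> one t) [m]"
    using companion_transpose_surj[of "sub (\<epsilon> one t) [m]" t "[rep X j one, rep X one t]" t] assms(1)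
    by (auto simp: overD)
  obtain D where D: "D \<in> K t [rep X j t] t" "sub D [smile_j t] = \<omega>"
    using smile_j_surj[OF assms(1), of \<omega> t "[]" "[]" t] w(1) by (auto simp: paste_sub)
  show ?thesis
    using w(2) D sharp_flat[OF _ _ assms(2)] assms(1) by (intro bexI[OF _ D(1)]) (simp add: skew_mult_def)
qed

section \<open>The unit and associativity laws of skew monoids\<close>

lemma ccomp_one: "\<psi> \<in> cells X qs (rep X one t) \<Longrightarrow> t \<in> over \<Longrightarrow> ccomp X \<psi> one \<alpha>s = sub \<psi> \<alpha>s"
  using cells_simps(4)[of \<psi> qs "rep X one t"] by (simp add: sub_def)

lemma opfactor_eqI:
  assumes "opcartesian X \<phi>" "\<omega> \<in> Cell X" "cdom X \<omega> = ps @ [ccod X \<phi>] @ rs" "paste X \<omega> ps \<phi> rs = \<psi>"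
  shows "opfactor X \<phi> ps \<psi> rs = \<omega>"
proof -
  have \<phi>: "\<phi> \<in> cells X (cdom X \<phi>) (ccod X \<phi>)" using assms(1) by (simp add: opcartesian_def)
  note f = paste_frame[OF assms(2,3) \<phi>, unfolded assms(4)]
  have "is_opfactor X \<phi> ps \<psi> rs (opfactor X \<phi> ps \<psi> rs)"
    by (rule opfactor[OF assms(1) f(1,2)]) (use f cdom_chain[OF assms(2)] assms(3) in simp)
  then show ?thesis
    using f assms by - (rule opcartesian_cancel[OF assms(1), of _ _ ps rs], auto simp: is_opfactor_def)
qed

text \<open>Flattened, the two sides are \<open>\<epsilon> one j\<close> times
  \<open>U \<star> D\<close> and \<open>\<epsilon> one j\<close> times
  \<open>\<epsilon> j t\<close>, with \<open>smile_j t\<close> substituted into the second factor.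
  For the unitor, the counit is \<open>\<epsilon> one j \<star> \<epsilon> j one\<close>, and its
  last factor combines with \<open>\<epsilon> one t\<close> into \<open>\<epsilon> j t\<close> under
  \<open>smile_j t\<close>.\<close>

lemma skew_left_unit_iff:
  assumes "(t, U, D) \<in> flat_data"
  shows "sub (skew_mult t D) [tau j t U, cid X (rep X j one), cid X (rep X one t)] =
    skew_lam X j [Some t] t 0 (cid X (rep X one t)) \<longleftrightarrow> U \<star> D = \<epsilon> j t"
proof -
  have t: "t \<in> T" "t \<in> over" and U: "U \<in> K j [] t" and D: "D \<in> K t [rep X j t] t"
    using assms by (auto simp: flat_data_def)
  note m = skew_mult[OF t(2) D] and s = smile_j[OF t(2)]
  note u = tau_cells[OF jT t(1) U] flat_tau_N[OF jT t(1) U]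
  have ci: "cid X (rep X j one) \<in> cells X [rep X j one] (rep X j one)"
    "cid X (rep X one t) \<in> cells X [rep X one t] (rep X one t)" using t by simp_all
  note su = substs_Cons[OF u(1) substs2[OF ci], simplified]
  have L: "sub (\<epsilon> one t) [sub (skew_mult t D) [tau j t U, cid X (rep X j one), cid X (rep X one t)]]
      = \<epsilon> one j \<star> sub (U \<star> D) [smile_j t]"
    using flat_sub[OF _ t(2) m(2) su] m(3) sub_hmul_left[OF \<epsilon>_K m(1) substs1[OF u(1)]] u(2)
      hmul_assoc[OF \<epsilon>_K U m(1)] sub_nullary_hmul[OF U D substs1[OF s(1)]] t by simp
  have cou: "counit X j = \<epsilon> one j \<star> \<epsilon> j one"
    using K_simps(4)[OF \<epsilon>_K[of one j]] by (simp add: counit_def hmul_def)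
  have "counit X j \<in> K one ([rep X one j] @ [rep X j one]) one"
    unfolding cou by (rule hmul_K[OF \<epsilon>_K \<epsilon>_K]) simp_all
  then have cc: "counit X j \<in> cells X [rep X one j, rep X j one] (lid X E)"
    by (auto simp: K_def cells_def)
  have lu: "lunit (rep X one t) \<in> cells X [lid X E, rep X one t] (rep X one t)"
    using lunit_cells[of "rep X one t"] t by simp
  note sc = substs2[OF cc ci(2), simplified]
  \<comment> \<open>The factorization of an identity through the unit on its left is
    \<open>lunit\<close>, so the left-unitor substitutes the counit into
    \<open>lunit\<close>.\<close>
  have lam: "skew_lam X j [Some t] t 0 (cid X (rep X one t))
      = sub (lunit (rep X one t)) [counit X j, cid X (rep X one t)]"
    using t by (simp add: skew_lam_def skew_dom_def entry_def paste_sub lunit_def T_simps)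
  have "sub (\<epsilon> one t) [lunit (rep X one t)] = cid X (lid X E) \<star> \<epsilon> one t"
    using paste_lunit[of "\<epsilon> one t" E "rep X one t" "[]" t] t by (simp add: paste_sub)
  then have "sub (\<epsilon> one t) [skew_lam X j [Some t] t 0 (cid X (rep X one t))]
      = sub (cid X (lid X E) \<star> \<epsilon> one t) ([counit X j] @ map (cid X) [rep X one t])"
    unfolding lam using flat_sub[OF _ t(2) lu sc] by simp
  also have "\<dots> = sub (cid X (lid X E)) [counit X j] \<star> \<epsilon> one t"
    by (rule sub_hmul_left[OF _ _ substs1[OF cc], where x = one and y = one and z = t]) (use cid_lid_K t in auto)
  also have "\<dots> = \<epsilon> one j \<star> sub (\<epsilon> j t) [smile_j t]"
    using cid_sub[OF cells_glob[OF cc]] cells_simps(3)[OF cc] cou s(2)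
      hmul_assoc[OF \<epsilon>_K[of one j] \<epsilon>_K[of j one] \<epsilon>_K[of one t]] t by simp
  finally have R: "sub (\<epsilon> one t) [skew_lam X j [Some t] t 0 (cid X (rep X one t))]
    = \<epsilon> one j \<star> sub (\<epsilon> j t) [smile_j t]" .
  have UD: "U \<star> D \<in> K j [rep X j t] t" using hmul_K[OF U D] by simp
  have "skew_lam X j [Some t] t 0 (cid X (rep X one t)) \<in> cells X [rep X one j, rep X j one, rep X one t] (rep X one t)"
    unfolding lam using sub_cells'[OF lu sc] .
  from flat_eq_iff[OF _ t(2) sub_cells'[OF m(2) su] this] L R
    one_\<epsilon>_cancel[OF sub_K'[OF UD substs1[OF s(1)]] sub_K'[OF \<epsilon>_K substs1[OF s(1)]]]
    smile_j_cancel1[OF t(2) UD \<epsilon>_K] t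
  show ?thesis by simp
qed

text \<open>The right-unitor asks for a factorization through \<open>smile_j j\<close>, which is
  exhibited as \<open>\<omega>\<close>. Pasting \<open>frown X j\<close> into it replaces
  \<open>?v\<close>, that is \<open>E(j,\<eta>)\<close>, by the unit, and the law becomes an
  equation between nullary cells multiplied by \<open>\<epsilon> one t\<close>.\<close>

lemma skew_right_unit_iff:
  assumes "(t, U, D) \<in> flat_data"
  shows "skew_rho X j [Some t] t 1 (sub (skew_mult t D) [cid X (rep X one t), cid X (rep X j one), tau j t U]) =
    cid X (rep X one t) \<longleftrightarrow> sub D [sharp j t U] = hone t"
proof -
  have t: "t \<in> T" "t \<in> over" and U: "U \<in> K j [] t" and D: "D \<in> K t [rep X j t] t"
    using assms by (auto simp: flat_data_def)
  let ?ci = "cid X (rep X one t)" and ?cj = "cid X (rep X j one)" and ?v = "sharp j t (\<epsilon> j j \<star> U)"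
  note m = skew_mult[OF t(2) D] and s = smile_j[OF t(2)] and sj = smile_j[OF over_simps(1)]
  note u = tau_cells[OF jT t(1) U] flat_tau_N[OF jT t(1) U]
  have ci: "?cj \<in> cells X [rep X j one] (rep X j one)"
    "?ci \<in> cells X [rep X one t] (rep X one t)" using t by simp_all
  have v: "?v \<in> cells X [rep X j j] (rep X j t)" "sub (\<epsilon> j t) [?v] = \<epsilon> j j \<star> U"
    using \<epsilon>_hmul_sharp[OF over_simps(1) t(2) U] by simp_all
  note fj = frown_cells[OF jT]
  have Us: "sharp j t U \<in> cells X [] (rep X j t)" using sharp_cells[OF U] .
  have vf: "sub ?v [frown X j] = sharp j t U"
    using flat_sub[OF _ t(2) v(1) substs1[OF fj(1)]] v(2) fj(2) hmul_hone[OF U]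
      sub_hmul_nullary[OF \<epsilon>_K U substs1[OF fj(1)]] sharp_flat[OF _ t(2) sub_cells'[OF v(1) substs1[OF fj(1)]]] by simp
  have Dv: "sub D [?v] \<in> K t [rep X j j] t" using sub_K'[OF D substs1[OF v(1)]] .
  \<comment> \<open>This is what remains of the multiplication once \<open>smile_j_right\<close> has
    moved the unit past \<open>smile_j t\<close>: \<open>E(j,\<eta>)\<close> followed by
    \<open>D\<close>.\<close>
  define \<omega> where "\<omega> = sharp one t (\<epsilon> one t \<star> sub D [?v])"
  have k: "\<epsilon> one t \<star> sub D [?v] \<in> K one [rep X one t, rep X j j] t" using hmul_K[OF \<epsilon>_K Dv, of one] t by simp
  have \<omega>: "\<omega> \<in> cells X [rep X one t, rep X j j] (rep X one t)" "sub (\<epsilon> one t) [\<omega>] = \<epsilon> one t \<star> sub D [?v]"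
    unfolding \<omega>_def using sharp_cells[OF k] rep_cell_sharp[OF k] .
  have \<omega>sub: "sub (\<epsilon> one t) [sub \<omega> [?ci, \<phi>]] = \<epsilon> one t \<star> sub D [sub ?v [\<phi>]]"
    and \<omega>c: "sub \<omega> [?ci, \<phi>] \<in> cells X (rep X one t # ps) (rep X one t)"
    if "\<phi> \<in> cells X ps (rep X j j)" for \<phi> ps
  proof -
    note sc = substs2[OF ci(2) that, simplified]
    show "sub (\<epsilon> one t) [sub \<omega> [?ci, \<phi>]] = \<epsilon> one t \<star> sub D [sub ?v [\<phi>]]"
      using flat_sub[OF _ t(2) \<omega>(1) sc] \<omega>(2) sub_hmul_right[OF \<epsilon>_K Dv substs1[OF that], of one]
        sub_sub1[OF D v(1) substs1[OF that]] t by simp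
    show "sub \<omega> [?ci, \<phi>] \<in> cells X (rep X one t # ps) (rep X one t)" using sub_cells'[OF \<omega>(1) sc] .
  qed
  note su = substs_Cons[OF ci(2) substs2[OF ci(1) u(1)], simplified]
  have "sub (smile_j t) [?cj, tau j t U] = sub ?v [smile_j j]"
    using smile_j_right[OF t(2) over_simps(1) U substs_Nil, of "tau j t U"] u sub_Nil[OF U] by simp
  moreover have "sub (\<epsilon> one t) [sub (skew_mult t D) [?ci, ?cj, tau j t U]]
      = \<epsilon> one t \<star> sub D [sub (smile_j t) [?cj, tau j t U]]"
    using flat_sub[OF _ t(2) m(2) su] m(3) sub_hmul_right[OF \<epsilon>_K m(1) substs2[OF ci(1) u(1)], of one]
      sub_sub1[OF D s(1) substs2[OF ci(1) u(1)]] t by simp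
  ultimately have "sub \<omega> [?ci, smile_j j] = sub (skew_mult t D) [?ci, ?cj, tau j t U]"
    using \<omega>sub[OF sj(1)] flat_eq_iff[OF _ t(2) \<omega>c[OF sj(1)] sub_cells'[OF m(2) su]] by simp
  then have "opfactor X (smile_j j) [rep X one t] (sub (skew_mult t D) [?ci, ?cj, tau j t U]) [] = \<omega>"
    using cells_simps[OF \<omega>(1)] cells_simps[OF sj(1)]
    by (intro opfactor_eqI[OF opcartesian_smile_j]) (simp_all add: paste_sub)
  then have rho: "skew_rho X j [Some t] t 1 (sub (skew_mult t D) [?ci, ?cj, tau j t U]) = sub \<omega> [?ci, frown X j]"
    using t by (simp add: skew_rho_def skew_dom_def entry_def paste_sub T_simps)
  have f1: "sub \<omega> [?ci, frown X j] \<in> cells X [rep X one t] (rep X one t)" using \<omega>c[OF fj(1)] .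
  have DU: "sub D [sharp j t U] \<in> K t [] t" using sub_K'[OF D substs1[OF Us]] .
  have h: "hone t \<in> K t [] t" "\<epsilon> one t \<star> hone t = \<epsilon> one t"
    using hone_K T_simps(1)[OF t(1)] hmul_hone(1)[OF \<epsilon>_K, of one t] t by simp_all
  have "sub \<omega> [?ci, frown X j] = ?ci \<longleftrightarrow> \<epsilon> one t \<star> sub D [sharp j t U] = \<epsilon> one t \<star> hone t"
    using flat_eq_iff[OF _ t(2) f1 ci(2)] \<omega>sub[OF fj(1)] vf h t by simp
  with one_\<epsilon>_cancel[OF DU h(1) t(2)] rho show ?thesis by simp
qed

text \<open>Both sides carry the factor \<open>\<epsilon> one t\<close> and a
  \<open>smile_j t\<close> in each of two positions; these are removed by
  \<open>one_\<epsilon>_cancel\<close> and \<open>smile_j_cancel2\<close>.\<close>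

lemma skew_assoc_iff:
  assumes "t \<in> over" "D \<in> K t [rep X j t] t"
  shows "sub (skew_mult t D) [skew_mult t D, cid X (rep X j one), cid X (rep X one t)] =
      sub (skew_mult t D) [cid X (rep X one t), cid X (rep X j one), skew_mult t D] \<longleftrightarrow>
    D \<star> D = sub D [sharp j t (\<epsilon> j t \<star> D)]"
proof -
  let ?ci = "cid X (rep X one t)" and ?cj = "cid X (rep X j one)" and ?w = "sharp j t (\<epsilon> j t \<star> D)"
    and ?m = "skew_mult t D" and ?s = "smile_j t"
  note t = assms(1) and D = assms(2)
  note m = skew_mult[OF t D] and s = smile_j[OF t]
  note w = \<epsilon>_hmul_sharp[OF t t D]
  have ci: "?cj \<in> cells X [rep X j one] (rep X j one)"
    "?ci \<in> cells X [rep X one t] (rep X one t)" using t by simp_all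
  note s1 = substs_Cons[OF m(2) substs2[OF ci], simplified]
    and s2 = substs_Cons[OF ci(2) substs2[OF ci(1) m(2)], simplified]
    and ss = substs2[OF s(1) s(1), simplified]
  have DD: "D \<star> D \<in> K t [rep X j t, rep X j t] t" "sub D [?w] \<in> K t [rep X j t, rep X j t] t"
    using hmul_K[OF D D] sub_K'[OF D substs1[OF w(1)]] by simp_all
  have "sub (\<epsilon> one t) [sub ?m [?m, ?cj, ?ci]] = \<epsilon> one t \<star> sub D [?s] \<star> sub D [?s]"
    using flat_sub[OF _ t m(2) s1] m(3) sub_hmul_left[OF \<epsilon>_K m(1) substs1[OF m(2)]] t by simp
  also have "\<dots> = \<epsilon> one t \<star> sub (D \<star> D) [?s, ?s]"
    using hmul_assoc[OF \<epsilon>_K m(1) m(1), of one] sub_hmul'[OF D D substs1[OF s(1)] substs1[OF s(1)]] t by simp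
  finally have L: "sub (\<epsilon> one t) [sub ?m [?m, ?cj, ?ci]] = \<epsilon> one t \<star> sub (D \<star> D) [?s, ?s]" .
  have "sub ?s [?cj, ?m] = sub ?w [?s, ?s]"
    using smile_j_right[OF t t D substs1[OF s(1)], of ?m] m by simp
  then have R: "sub (\<epsilon> one t) [sub ?m [?ci, ?cj, ?m]] = \<epsilon> one t \<star> sub (sub D [?w]) [?s, ?s]"
    using flat_sub[OF _ t m(2) s2] m(3) sub_hmul_right[OF \<epsilon>_K m(1) substs2[OF ci(1) m(2)], of one]
      sub_sub1[OF D s(1) substs2[OF ci(1) m(2)]] sub_sub1[OF D w(1) ss] t by simp
  show ?thesis
    using L R flat_eq_iff[OF _ t sub_cells'[OF m(2) s1] sub_cells'[OF m(2) s2]]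
      one_\<epsilon>_cancel[OF sub_K'[OF DD(1) ss] sub_K'[OF DD(2) ss] t] smile_j_cancel2[OF t DD] by simp
qed

lemma skew_of_law:
  assumes "(t, U, D) \<in> flat_data"
  shows "is_skew_monoid (skew_multicat_of X j) (skew_of (t, U, D)) \<longleftrightarrow> flat_law (t, U, D)"
proof -
  have t: "t \<in> T" "t \<in> over" and U: "U \<in> K j [] t" and D: "D \<in> K t [rep X j t] t"
    using assms by (auto simp: flat_data_def)
  note m = skew_mult[OF t(2) D] and u = tau_cells[OF jT t(1) U]
  show ?thesis
    using skew_left_unit_iff[OF assms] skew_right_unit_iff[OF assms] skew_assoc_iff[OF t(2) D]
      ccomp_one[OF m(2) t(2)] m(2) u t
    by (simp add: is_skew_monoid_def skew_of_def flat_law_def skew_multicat_of_def skew_dom_def entry_def T_simps)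
qed

lemma skew_of_hom:
  assumes S: "(t, U, D) \<in> flat_data" and S': "(t', U', D') \<in> flat_data"
  shows "is_skew_monoid_hom (skew_multicat_of X j) (skew_of (t, U, D)) (skew_of (t', U', D')) \<tau> \<longleftrightarrow>
    \<tau> \<in> flat_hom (t, U, D) (t', U', D')"
proof (cases "\<tau> \<in> cells X [rep X one t] (rep X one t')")
  case False
  then show ?thesis using assms
    by (auto simp: is_skew_monoid_hom_def skew_of_def flat_hom_def flat_data_def T_simps skew_multicat_of_def
      skew_dom_def entry_def)
next
  case \<tau>: True
  have t: "t \<in> T" "t \<in> over" and U: "U \<in> K j [] t" and D: "D \<in> K t [rep X j t] t"
    using S by (auto simp: flat_data_def)
  have t': "t' \<in> T" "t' \<in> over" and U': "U' \<in> K j [] t'" and D': "D' \<in> K t' [rep X j t'] t'"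
    using S' by (auto simp: flat_data_def)
  let ?N = "nullary X t t' \<tau>" and ?cj = "cid X (rep X j one)"
  let ?r = "sharp j t' (\<epsilon> j t \<star> ?N)"
  note N = nullary_K[OF t(1) t'(1) \<tau>] and f = flat_tau[OF t(1) t'(1) \<tau>]
  note m = skew_mult[OF t(2) D] and m' = skew_mult[OF t'(2) D'] and s = smile_j[OF t(2)] and s' = smile_j[OF t'(2)]
  have r: "?r \<in> cells X [rep X j t] (rep X j t')" "sub (\<epsilon> j t') [?r] = \<epsilon> j t \<star> ?N"
    using \<epsilon>_hmul_sharp[OF t(2) t'(2) N] by simp_all
  have ci: "?cj \<in> cells X [rep X j one] (rep X j one)" by simp
  note st = substs2[OF ci \<tau>, simplified]
  note s3 = substs_Cons[OF \<tau> st, simplified]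
  have DN: "D \<star> ?N \<in> K t [rep X j t] t'" "?N \<star> sub D' [?r] \<in> K t [rep X j t] t'"
    using hmul_K[OF D N] hmul_K[OF N sub_K'[OF D' substs1[OF r(1)]]] by simp_all
  have L: "sub (\<epsilon> one t') [sub \<tau> [skew_mult t D]] = \<epsilon> one t \<star> sub (D \<star> ?N) [smile_j t]"
    using flat_sub[OF _ t'(2) \<tau> substs1[OF m(2)]] f sub_hmul_nullary[OF \<epsilon>_K N substs1[OF m(2)]] m(3)
      hmul_assoc[OF \<epsilon>_K m(1) N] sub_hmul_nullary[OF D N substs1[OF s(1)]] t by simp
  \<comment> \<open>The right-hand copy of \<open>\<tau>\<close> crosses \<open>E(j,1)\<close> and
    becomes \<open>E(j,\<tau>)\<close>, which is how the substitution in \<open>flat_hom_law\<close>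
    arises.\<close>
  have "sub (smile_j t') [?cj, \<tau>] = sub ?r [smile_j t]"
    using smile_j_right[OF t'(2) t(2) N substs_Nil, of \<tau>] \<tau> f sub_Nil[OF N] by simp
  then have "sub (sub D' [smile_j t']) [?cj, \<tau>] = sub (sub D' [?r]) [smile_j t]"
    using sub_sub1[OF D' s'(1) st] sub_sub1[OF D' r(1) substs1[OF s(1)]] by simp
  then have "sub (\<epsilon> one t') [sub (skew_mult t' D') [\<tau>, ?cj, \<tau>]] = \<epsilon> one t \<star> ?N \<star> sub (sub D' [?r]) [smile_j t]"
    using flat_sub[OF _ t'(2) m'(2) s3] m'(3) sub_hmul'[OF \<epsilon>_K m'(1) substs1[OF \<tau>] st] f t' by simp
  also have "\<dots> = \<epsilon> one t \<star> sub (?N \<star> sub D' [?r]) [smile_j t]"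
    using hmul_assoc[OF \<epsilon>_K N sub_K'[OF sub_K'[OF D' substs1[OF r(1)]] substs1[OF s(1)]]]
      sub_nullary_hmul[OF N sub_K'[OF D' substs1[OF r(1)]] substs1[OF s(1)]] t by simp
  finally have "sub \<tau> [skew_mult t D] = sub (skew_mult t' D') [\<tau>, ?cj, \<tau>] \<longleftrightarrow> D \<star> ?N = ?N \<star> sub D' [?r]"
    using L flat_eq_iff[OF _ t'(2) sub_cells'[OF \<tau> substs1[OF m(2)]] sub_cells'[OF m'(2) s3]]
      one_\<epsilon>_cancel[OF sub_K'[OF DN(1) substs1[OF s(1)]] sub_K'[OF DN(2) substs1[OF s(1)]] t(2)]
      smile_j_cancel1[OF t(2) DN] by simp
  then show ?thesis
    using unit_iff[OF t(1) t'(1) U U' \<tau>] ccomp_one[OF \<tau> t'(2)] ccomp_one[OF m'(2) t'(2)] \<tau> t t'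
    by (simp add: is_skew_monoid_hom_def skew_of_def flat_hom_def flat_hom_law_def skew_multicat_of_def
      skew_dom_def entry_def T_simps)
qed

lemma skew_presents:
  "presents (tight_hom_cat X A E) flat_monads fst flat_hom
    (skew_Mon (skew_multicat_of X j)) skew_Mon_forget skew_of (\<lambda>_ _ \<tau>. \<tau>)"
proof (rule flat_presents)
  \<comment> \<open>The left inverse is given by a description of \<open>D\<close>, which
    \<open>skew_mult_inj\<close> makes unique, in place of a formula.\<close>
  let ?k = "\<lambda>(t, m, u). (t, nullary X j t u, THE D. D \<in> K t [rep X j t] t \<and> skew_mult t D = m)"
  have "bij_betw skew_of flat_monads {R. is_skew_monoid (skew_multicat_of X j) R}"
  proof (rule bij_flat_monads[where k = ?k])
    fix S assume S: "S \<in> flat_data"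
    obtain t U D where [simp]: "S = (t, U, D)" by (cases S)
    have t: "t \<in> T" "t \<in> over" and U: "U \<in> K j [] t" and D: "D \<in> K t [rep X j t] t"
      using S by (auto simp: flat_data_def)
    have "(THE D'. D' \<in> K t [rep X j t] t \<and> skew_mult t D' = skew_mult t D) = D"
      using D skew_mult_inj[OF t(2)] by blast
    then show "?k (skew_of S) = S" using nullary_tau[OF jT t(1) U] by (simp add: skew_of_def)
  next
    fix S assume "S \<in> flat_data"
    then show "is_skew_monoid (skew_multicat_of X j) (skew_of S) \<longleftrightarrow> flat_law S" using skew_of_law by (cases S) auto
  next
    fix R assume R: "is_skew_monoid (skew_multicat_of X j) R"
    obtain t m u where [simp]: "R = (t, m, u)" by (cases R)
    from R have t: "t \<in> T" and m: "m \<in> cells X [rep X one t, rep X j one, rep X one t] (rep X one t)" and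
      u: "u \<in> cells X [rep X one j] (rep X one t)"
      by (auto simp: is_skew_monoid_def skew_multicat_of_def skew_dom_def entry_def T_simps split: if_splits)
    obtain D where "D \<in> K t [rep X j t] t" "skew_mult t D = m" using skew_mult_surj[OF _ m] t by auto
    then show "\<exists>S\<in>flat_data. skew_of S = R"
      using nullary_K[OF jT t u] tau_nullary[OF jT t u] t
      by (intro bexI[where x = "(t, nullary X j t u, D)"]) (auto simp: skew_of_def flat_data_def)
  qed
  then show "bij_betw skew_of flat_monads (Obj (skew_Mon (skew_multicat_of X j)))" by (simp add: skew_Mon_def)
next
  fix S assume "S \<in> flat_monads"
  then show "fob skew_Mon_forget (skew_of S) = fst S \<and>
      Idn (skew_Mon (skew_multicat_of X j)) (skew_of S) = cid X (rep X one (fst S))"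
    by (auto simp: skew_Mon_def skew_Mon_forget_def skew_of_def flat_monads_def flat_data_def T_simps skew_multicat_of_def)
next
  fix S S' assume "S \<in> flat_monads" "S' \<in> flat_monads"
  then show "Hom (skew_Mon (skew_multicat_of X j)) (skew_of S) (skew_of S') = (\<lambda>\<tau>. \<tau>) ` flat_hom S S' \<and>
      (\<forall>\<tau>\<in>flat_hom S S'. farr skew_Mon_forget (skew_of S) (skew_of S') \<tau> = \<tau>)"
    using skew_of_hom by (cases S, cases S') (auto simp: skew_Mon_def skew_Mon_forget_def flat_monads_def)
next
  fix S S' S'' \<tau> \<sigma>
  assume S: "S \<in> flat_monads" "S' \<in> flat_monads" "S'' \<in> flat_monads"
    and "\<tau> \<in> flat_hom S S'" "\<sigma> \<in> flat_hom S' S''"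
  then have \<tau>: "\<tau> \<in> cells X [rep X one (fst S)] (rep X one (fst S'))"
    and \<sigma>: "\<sigma> \<in> cells X [rep X one (fst S')] (rep X one (fst S''))"
    by (auto simp: flat_hom_def)
  have "fst S'' \<in> over" using S(3) by (auto simp: flat_monads_def flat_data_def)
  then show "Comp (skew_Mon (skew_multicat_of X j)) (skew_of S) (skew_of S') (skew_of S'') \<sigma> \<tau> = vcomp X \<sigma> \<tau>"
    using vcomp_cells(1)[OF \<sigma> \<tau>] ccomp_one[OF \<sigma>] by (simp add: skew_Mon_def skew_multicat_of_def)
qed

end

section \<open>Monoids in the multicategory associated to a dense tight-cell\<close>

locale dense_tight_cell = tight_cell X j A E
  for X :: "('o, 't, 'l, 'c) vdc" and j :: 't and A E :: 'o +
  assumes dense: "dense X j"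
begin

lemma \<epsilon>_cancel:
  assumes "t \<in> T" "t' \<in> T" "\<psi> \<in> K t ps t'" "\<psi>' \<in> K t ps t'"
  shows "\<epsilon> j t \<star> \<psi> = \<epsilon> j t \<star> \<psi>' \<longleftrightarrow> \<psi> = \<psi>'"
  using dense_inj[OF j dense _ _ _ _ K_simps(9)[OF assms(3)] assms(3,4)] assms(1,2) by (auto simp: T_simps)

lemma \<epsilon>_surj:
  assumes "t \<in> T" "t' \<in> T" "\<chi> \<in> K j (rep X j t # ps) t'"
  shows "\<exists>\<psi>\<in>K t ps t'. \<epsilon> j t \<star> \<psi> = \<chi>"
proof -
  have "chain X (tdom X t) ps (tdom X t')" using K_simps(9)[OF assms(3)] assms(1) by simp
  from dense_surj[OF j dense _ _ _ _ this assms(3)] assms(1,2) show ?thesis by (simp add: T_simps)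
qed

text \<open>Flattened, transposition is multiplication by \<open>\<epsilon> one j\<close>. Its
  bijectivity, in \<open>transpose_eq_iff\<close> and \<open>transpose_surj\<close>, is thus an
  instance of companion transposition.\<close>

lemma
  assumes "t \<in> T" "\<phi> \<in> cells X ps (rep X j t)"
  shows transpose_cells: "transpose X j t \<phi> \<in> cells X (rep X one j # ps) (rep X one t)"
    and flat_transpose: "sub (\<epsilon> one t) [transpose X j t \<phi>] = \<epsilon> one j \<star> sub (\<epsilon> j t) [\<phi>]"
proof -
  have ci: "cid X (rep X one j) \<in> cells X [rep X one j] (rep X one j)" by simp
  note s = smile_over[OF over_simps(2) over_simps(1) over_simps(3)[OF assms(1)]]
  note ss = substs2[OF ci assms(2), simplified]
  have e: "transpose X j t \<phi> = sub (smile X j one t) [cid X (rep X one j), \<phi>]"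
    using cells_simps(4)[OF s(1)] assms(1) by (simp add: transpose_def sub_def)
  show "transpose X j t \<phi> \<in> cells X (rep X one j # ps) (rep X one t)"
    unfolding e using sub_cells'[OF s(1) ss] .
  show "sub (\<epsilon> one t) [transpose X j t \<phi>] = \<epsilon> one j \<star> sub (\<epsilon> j t) [\<phi>]"
    unfolding e using flat_sub[OF _ _ s(1) ss] s(2) sub_hmul_right[OF \<epsilon>_K \<epsilon>_K substs1[OF assms(2)], of one] assms(1)
    by simp
qed

lemma transpose_eq_iff:
  assumes "t \<in> T" "\<phi> \<in> cells X ps (rep X j t)" "\<phi>' \<in> cells X ps (rep X j t)"
  shows "transpose X j t \<phi> = transpose X j t \<phi>' \<longleftrightarrow> \<phi> = \<phi>'"
  using flat_eq_iff[OF _ _ transpose_cells[OF assms(1,2)] transpose_cells[OF assms(1,3)]]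
    flat_transpose[OF assms(1,2)] flat_transpose[OF assms(1,3)] assms(1)
    one_\<epsilon>_cancel[OF flat_K[OF _ _ assms(2)] flat_K[OF _ _ assms(3)]] flat_eq_iff[OF _ _ assms(2,3)] by simp

lemma transpose_surj:
  assumes "t \<in> T" "\<psi> \<in> cells X (rep X one j # ps) (rep X one t)"
  shows "\<exists>\<phi>\<in>cells X ps (rep X j t). transpose X j t \<phi> = \<psi>"
proof -
  have "sub (\<epsilon> one t) [\<psi>] \<in> K one (rep X one j # ps) t" using flat_K[OF _ _ assms(2)] assms(1) by simp
  then obtain \<omega> where w: "\<omega> \<in> K j ps t" "\<epsilon> one j \<star> \<omega> = sub (\<epsilon> one t) [\<psi>]"
    using companion_transpose_surj[of "sub (\<epsilon> one t) [\<psi>]" j ps t] by auto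
  note c = sharp_cells[OF w(1)]
  have "transpose X j t (sharp j t \<omega>) = \<psi>"
    using flat_eq_iff[OF _ _ transpose_cells[OF assms(1) c] assms(2)] flat_transpose[OF assms(1) c]
      rep_cell_sharp[OF w(1)] w(2) assms(1) by simp
  with c show ?thesis by blast
qed

lemma untranspose_transpose:
  "t \<in> T \<Longrightarrow> \<phi> \<in> cells X (map (rep X j) fs) (rep X j t) \<Longrightarrow> untranspose X j fs t (transpose X j t \<phi>) = \<phi>"
  unfolding untranspose_def using transpose_eq_iff by (intro the_equality) auto

text \<open>Instances with \<open>map (rep X j) fs\<close> evaluated, for the arities that occur in
  the laws of monoids and homomorphisms.\<close>

lemma untranspose_simps:
  "t \<in> T \<Longrightarrow> \<phi> \<in> cells X [] (rep X j t) \<Longrightarrow> untranspose X j [] t (transpose X j t \<phi>) = \<phi>"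
  "t \<in> T \<Longrightarrow> \<phi> \<in> cells X [rep X j s] (rep X j t) \<Longrightarrow> untranspose X j [s] t (transpose X j t \<phi>) = \<phi>"
  "t \<in> T \<Longrightarrow> \<phi> \<in> cells X [rep X j r, rep X j s] (rep X j t) \<Longrightarrow>
    untranspose X j [r, s] t (transpose X j t \<phi>) = \<phi>"
  by (simp_all add: untranspose_transpose)

lemma ccomp_A: "\<psi> \<in> cells X qs (rep X j t) \<Longrightarrow> t \<in> over \<Longrightarrow> ccomp X \<psi> (tid X A) \<alpha>s = sub \<psi> \<alpha>s"
  using cells_simps(4)[of \<psi> qs "rep X j t"] by (simp add: sub_def)

text \<open>This is also the cell that is substituted into \<open>D\<close> in the associativity
  equation of \<open>flat_law\<close>.\<close>

abbreviation mon_mult :: "'t \<Rightarrow> 'c \<Rightarrow> 'c" where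
  "mon_mult t D \<equiv> sharp j t (\<epsilon> j t \<star> D)"

definition mon_of :: "'t \<times> 'c \<times> 'c \<Rightarrow> 't \<times> 'c \<times> 'c" where
  "mon_of = (\<lambda>(t, U, D). (t, transpose X j t (mon_mult t D), transpose X j t (sharp j t U)))"

text \<open>A homomorphism is named by the 2-cell \<open>\<tau>\<close> that
  \<open>unary_to_tight\<close> assigns to it; as a multimorphism it is the transpose of
  \<open>E(j,\<tau>)\<close>.\<close>

definition mon_hom :: "'t \<times> 'c \<times> 'c \<Rightarrow> 't \<times> 'c \<times> 'c \<Rightarrow> 'c \<Rightarrow> 'c" where
  "mon_hom S S' \<tau> = transpose X j (fst S') (rep_right X j (fst S) (fst S') \<tau>)"

text \<open>In the left unit law the unit replaces the leading \<open>\<epsilon> j t\<close> by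
  \<open>U\<close>, so flattening gives the required equation at once. The right unit law and
  associativity keep that factor on both sides, and density cancels it.\<close>

lemma mon_of_law:
  assumes "(t, U, D) \<in> flat_data"
  shows "is_monoid (multicat_of X j) (mon_of (t, U, D)) \<longleftrightarrow> flat_law (t, U, D)"
proof -
  have t: "t \<in> T" "t \<in> over" and U: "U \<in> K j [] t" and D: "D \<in> K t [rep X j t] t"
    using assms by (auto simp: flat_data_def)
  let ?m = "mon_mult t D" and ?u = "sharp j t U" and ?i = "cid X (rep X j t)"
  note m = \<epsilon>_hmul_sharp[OF t(2,2) D]
  have u: "?u \<in> cells X [] (rep X j t)" "sub (\<epsilon> j t) [?u] = U" using sharp_cells[OF U] rep_cell_sharp[OF U] .
  have i: "?i \<in> cells X [rep X j t] (rep X j t)" using t by simp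
  note ui = substs2[OF u(1) i, simplified] and iu = substs2[OF i u(1), simplified]
    and mi = substs2[OF m(1) i, simplified] and im = substs2[OF i m(1), simplified]
  note sm = sub_cells'[OF m(1)]
  have Du: "sub D [?u] \<in> K t [] t" and Dm: "sub D [?m] \<in> K t [rep X j t, rep X j t] t"
    and DD: "D \<star> D \<in> K t [rep X j t, rep X j t] t"
    using sub_K'[OF D substs1[OF u(1)]] sub_K'[OF D substs1[OF m(1)]] hmul_K[OF D D] by simp_all
  have "sub (\<epsilon> j t) [sub ?m [?u, ?i]] = U \<star> D"
    using flat_sub[OF _ t(2) m(1) ui] m(2) sub_hmul_left[OF \<epsilon>_K D substs1[OF u(1)]] u(2) t by simp
  then have 1: "sub ?m [?u, ?i] = ?i \<longleftrightarrow> U \<star> D = \<epsilon> j t"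
    using flat_eq_iff[OF _ t(2) sm[OF ui] i] t by simp
  have h: "hone t \<in> K t [] t" "\<epsilon> j t \<star> hone t = \<epsilon> j t"
    using hone_K T_simps(1)[OF t(1)] hmul_hone(1)[OF \<epsilon>_K, of j t] t by simp_all
  have "sub (\<epsilon> j t) [sub ?m [?i, ?u]] = \<epsilon> j t \<star> sub D [?u]"
    using flat_sub[OF _ t(2) m(1) iu] m(2) sub_hmul_right[OF \<epsilon>_K D substs1[OF u(1)], of j] t by simp
  then have 2: "sub ?m [?i, ?u] = ?i \<longleftrightarrow> sub D [?u] = hone t"
    using flat_eq_iff[OF _ t(2) sm[OF iu] i] \<epsilon>_cancel[OF t(1,1) Du h(1)] h t by simp
  have "sub (\<epsilon> j t) [sub ?m [?m, ?i]] = \<epsilon> j t \<star> (D \<star> D)"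
    using flat_sub[OF _ t(2) m(1) mi] m(2) sub_hmul_left[OF \<epsilon>_K D substs1[OF m(1)]]
      hmul_assoc[OF \<epsilon>_K D D] t by simp
  moreover have "sub (\<epsilon> j t) [sub ?m [?i, ?m]] = \<epsilon> j t \<star> sub D [?m]"
    using flat_sub[OF _ t(2) m(1) im] m(2) sub_hmul_right[OF \<epsilon>_K D substs1[OF m(1)], of j] t by simp
  ultimately have 3: "sub ?m [?m, ?i] = sub ?m [?i, ?m] \<longleftrightarrow> D \<star> D = sub D [?m]"
    using flat_eq_iff[OF _ t(2) sm[OF mi] sm[OF im]] \<epsilon>_cancel[OF t(1,1) DD Dm] by simp
  show ?thesis
    using 1 2 3 t transpose_cells[OF t(1) m(1)] transpose_cells[OF t(1) u(1)] ccomp_A[OF m(1) t(2)]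
      transpose_eq_iff[OF t(1) sm[OF ui] i] transpose_eq_iff[OF t(1) sm[OF iu] i]
      transpose_eq_iff[OF t(1) sm[OF mi] sm[OF im]] m(1) u(1) i
    by (simp add: is_monoid_def mon_of_def flat_law_def multicat_of_def untranspose_simps T_simps)
qed

text \<open>Flattened, both sides of the multiplicativity law begin with one factor
  \<open>\<epsilon> j t\<close>, which density cancels; the rest is the second equation of
  \<open>flat_hom_law\<close>.\<close>

lemma mon_hom_law:
  assumes S: "(t, U, D) \<in> flat_data" and S': "(t', U', D') \<in> flat_data"
    and \<tau>: "\<tau> \<in> cells X [rep X one t] (rep X one t')"
  shows "is_monoid_hom (multicat_of X j) (mon_of (t, U, D)) (mon_of (t', U', D'))
      (mon_hom (t, U, D) (t', U', D') \<tau>) \<longleftrightarrow> \<tau> \<in> flat_hom (t, U, D) (t', U', D')"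
proof -
  have t: "t \<in> T" "t \<in> over" and U: "U \<in> K j [] t" and D: "D \<in> K t [rep X j t] t"
    using S by (auto simp: flat_data_def)
  have t': "t' \<in> T" "t' \<in> over" and U': "U' \<in> K j [] t'" and D': "D' \<in> K t' [rep X j t'] t'"
    using S' by (auto simp: flat_data_def)
  let ?N = "nullary X t t' \<tau>" and ?m = "mon_mult t D" and ?u = "sharp j t U"
    and ?m' = "mon_mult t' D'" and ?u' = "sharp j t' U'" and ?r = "rep_right X j t t' \<tau>"
  note N = nullary_K[OF t(1) t'(1) \<tau>]
  note m = \<epsilon>_hmul_sharp[OF t(2,2) D] and m' = \<epsilon>_hmul_sharp[OF t'(2,2) D']
  have u: "?u \<in> cells X [] (rep X j t)" "sub (\<epsilon> j t) [?u] = U" using sharp_cells[OF U] rep_cell_sharp[OF U] .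
  have u': "?u' \<in> cells X [] (rep X j t')" "sub (\<epsilon> j t') [?u'] = U'" using sharp_cells[OF U'] rep_cell_sharp[OF U'] .
  note r = rep_right_cells[OF over_simps(1) t(1) t'(1) \<tau>]
  have re: "?r = sharp j t' (\<epsilon> j t \<star> ?N)" using rep_right_sharp t by simp
  note rr = substs2[OF r(1) r(1), simplified]
  note c = sub_cells'[OF r(1) substs1[OF u(1)]] sub_cells'[OF r(1) substs1[OF m(1)]] sub_cells'[OF m'(1) rr]
  have "sub (\<epsilon> j t') [sub ?r [?u]] = U \<star> ?N"
    using flat_sub[OF _ t'(2) r(1) substs1[OF u(1)]] r(2) sub_hmul_nullary[OF \<epsilon>_K N substs1[OF u(1)]] u(2) t by simp
  then have 1: "sub ?r [?u] = ?u' \<longleftrightarrow> U \<star> ?N = U'"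
    using flat_eq_iff[OF _ t'(2) c(1) u'(1)] u'(2) by simp
  have DN: "D \<star> ?N \<in> K t [rep X j t] t'" "?N \<star> sub D' [?r] \<in> K t [rep X j t] t'"
    using hmul_K[OF D N] hmul_K[OF N sub_K'[OF D' substs1[OF r(1)]]] by simp_all
  have "sub (\<epsilon> j t') [sub ?r [?m]] = \<epsilon> j t \<star> (D \<star> ?N)"
    using flat_sub[OF _ t'(2) r(1) substs1[OF m(1)]] r(2) sub_hmul_nullary[OF \<epsilon>_K N substs1[OF m(1)]] m(2)
      hmul_assoc[OF \<epsilon>_K D N] t by simp
  moreover have "sub (\<epsilon> j t') [sub ?m' [?r, ?r]] = \<epsilon> j t \<star> (?N \<star> sub D' [?r])"
    using flat_sub[OF _ t'(2) m'(1) rr] m'(2) sub_hmul'[OF \<epsilon>_K D' substs1[OF r(1)] substs1[OF r(1)]] r(2)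
      hmul_assoc[OF \<epsilon>_K N sub_K'[OF D' substs1[OF r(1)]]] t t' by simp
  ultimately have 2: "sub ?r [?m] = sub ?m' [?r, ?r] \<longleftrightarrow> D \<star> ?N = ?N \<star> sub D' [?r]"
    using flat_eq_iff[OF _ t'(2) c(2,3)] \<epsilon>_cancel[OF t(1) t'(1) DN] by simp
  show ?thesis
    using 1 2 \<tau> t t' transpose_cells[OF t'(1) r(1)] ccomp_A[OF m'(1) t'(2)] ccomp_A[OF r(1) t'(2)]
      transpose_eq_iff[OF t'(1) c(1) u'(1)] transpose_eq_iff[OF t'(1) c(2,3)] m(1) u(1) m'(1) r(1)
    by (simp add: is_monoid_hom_def mon_of_def mon_hom_def flat_hom_def flat_hom_law_def multicat_of_def
      untranspose_simps re[symmetric] T_simps)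
qed

text \<open>With \<open>rep_right_surj\<close>, this says that density makes \<open>E(j,-)\<close>
  fully faithful, which identifies unary multimorphisms with 2-cells between tight-cells.\<close>

lemma rep_right_inj:
  assumes "s \<in> T" "t \<in> T" "\<tau> \<in> cells X [rep X one s] (rep X one t)" "\<tau>' \<in> cells X [rep X one s] (rep X one t)"
    "rep_right X j s t \<tau> = rep_right X j s t \<tau>'"
  shows "\<tau> = \<tau>'"
proof -
  have "\<epsilon> j s \<star> nullary X s t \<tau> = \<epsilon> j s \<star> nullary X s t \<tau>'"
    using rep_right_cells(2)[OF over_simps(1) assms(1,2)] assms(3-5) by metis
  then have "nullary X s t \<tau> = nullary X s t \<tau>'"
    using \<epsilon>_cancel[OF assms(1,2) nullary_K[OF assms(1-3)] nullary_K[OF assms(1,2,4)]] by simp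
  then show ?thesis using tau_nullary[OF assms(1-3)] tau_nullary[OF assms(1,2,4)] by metis
qed

lemma rep_right_surj:
  assumes "s \<in> T" "t \<in> T" "\<phi> \<in> cells X [rep X j s] (rep X j t)"
  shows "\<exists>\<tau>\<in>cells X [rep X one s] (rep X one t). rep_right X j s t \<tau> = \<phi>"
proof -
  have "sub (\<epsilon> j t) [\<phi>] \<in> K j [rep X j s] t" using flat_K[OF _ _ assms(3)] assms(2) by simp
  then obtain N where N: "N \<in> K s [] t" "\<epsilon> j s \<star> N = sub (\<epsilon> j t) [\<phi>]"
    using \<epsilon>_surj[OF assms(1,2)] by blast
  have "rep_right X j s t (tau s t N) = \<phi>"
    using rep_right_sharp[of j s t] nullary_tau[OF assms(1,2) N(1)] N(2) sharp_flat[OF _ _ assms(3)] assms(1,2) by simp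
  then show ?thesis using tau_cells[OF assms(1,2) N(1)] by blast
qed

text \<open>Unlike in the other two presentations, morphisms have to be renamed: a homomorphism here
  is a multimorphism, not a 2-cell between companions.\<close>

lemma mon_presents:
  "presents (tight_hom_cat X A E) flat_monads fst flat_hom (Mon (multicat_of X j)) (Mon_forget X j) mon_of mon_hom"
proof (rule flat_presents)
  let ?k = "\<lambda>(t, m, u). (t, sub (\<epsilon> j t) [untranspose X j [] t u],
    THE D. D \<in> K t [rep X j t] t \<and> transpose X j t (mon_mult t D) = m)"
  have "bij_betw mon_of flat_monads {R. is_monoid (multicat_of X j) R}"
  proof (rule bij_flat_monads[where k = ?k])
    fix S assume S: "S \<in> flat_data"
    obtain t U D where [simp]: "S = (t, U, D)" by (cases S)
    have t: "t \<in> T" "t \<in> over" and U: "U \<in> K j [] t" and D: "D \<in> K t [rep X j t] t"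
      using S by (auto simp: flat_data_def)
    have "D' = D" if "D' \<in> K t [rep X j t] t" "transpose X j t (mon_mult t D') = transpose X j t (mon_mult t D)" for D'
    proof -
      have "mon_mult t D' = mon_mult t D"
        using transpose_eq_iff[OF t(1) \<epsilon>_hmul_sharp(1)[OF t(2,2) that(1)] \<epsilon>_hmul_sharp(1)[OF t(2,2) D]] that(2) by simp
      then have "\<epsilon> j t \<star> D' = \<epsilon> j t \<star> D"
        using \<epsilon>_hmul_sharp(2)[OF t(2,2) that(1)] \<epsilon>_hmul_sharp(2)[OF t(2,2) D] by metis
      then show ?thesis using \<epsilon>_cancel[OF t(1,1) that(1) D] by simp
    qed
    with D have "(THE D'. D' \<in> K t [rep X j t] t \<and> transpose X j t (mon_mult t D') = transpose X j t (mon_mult t D)) = D"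
      by blast
    then show "?k (mon_of S) = S"
      using untranspose_simps(1)[OF t(1) sharp_cells[OF U]] rep_cell_sharp[OF U] by (simp add: mon_of_def)
  next
    fix S assume "S \<in> flat_data"
    then show "is_monoid (multicat_of X j) (mon_of S) \<longleftrightarrow> flat_law S" using mon_of_law by (cases S) auto
  next
    fix R assume R: "is_monoid (multicat_of X j) R"
    obtain t m u where [simp]: "R = (t, m, u)" by (cases R)
    from R have t: "t \<in> T" and m: "m \<in> cells X [rep X one j, rep X j t, rep X j t] (rep X one t)" and
      u: "u \<in> cells X [rep X one j] (rep X one t)"
      by (auto simp: is_monoid_def multicat_of_def T_simps split: if_splits)
    obtain m' where m': "m' \<in> cells X [rep X j t, rep X j t] (rep X j t)" "transpose X j t m' = m"
      using transpose_surj[OF t m] by blast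
    obtain u' where u': "u' \<in> cells X [] (rep X j t)" "transpose X j t u' = u"
      using transpose_surj[OF t u] by blast
    \<comment> \<open>Density splits the leading \<open>\<epsilon> j t\<close> off the
      multiplication; the remaining factor is the extension operator in flattened form.\<close>
    obtain D where D: "D \<in> K t [rep X j t] t" "\<epsilon> j t \<star> D = sub (\<epsilon> j t) [m']"
      using \<epsilon>_surj[OF t t flat_K[OF _ _ m'(1)]] t by auto
    show "\<exists>S\<in>flat_data. mon_of S = R"
      using D m' u' flat_K[OF _ _ u'(1)] sharp_flat[OF _ _ m'(1)] sharp_flat[OF _ _ u'(1)] t
      by (intro bexI[where x = "(t, sub (\<epsilon> j t) [u'], D)"]) (auto simp: mon_of_def flat_data_def)
  qed
  then show "bij_betw mon_of flat_monads (Obj (Mon (multicat_of X j)))" by (simp add: Mon_def)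
next
  fix S assume "S \<in> flat_monads"
  then have t: "fst S \<in> T" "fst S \<in> over" by (auto simp: flat_monads_def flat_data_def)
  have "rep_right X j (fst S) (fst S) (cid X (rep X one (fst S))) = cid X (rep X j (fst S))"
    using rep_right_sharp[of j "fst S" "fst S"] nullary_cid[OF t(1)] hmul_hone(1)[OF \<epsilon>_K, of j "fst S"]
      sharp_\<epsilon>[of j "fst S"] t by simp
  then show "fob (Mon_forget X j) (mon_of S) = fst S \<and>
      Idn (Mon (multicat_of X j)) (mon_of S) = mon_hom S S (cid X (rep X one (fst S)))"
    by (auto simp: Mon_def Mon_forget_def mon_of_def mon_hom_def multicat_of_def split: prod.splits)
next
  fix S S' assume S: "S \<in> flat_monads" "S' \<in> flat_monads"
  obtain t U D t' U' D' where e: "S = (t, U, D)" "S' = (t', U', D')" by (cases S, cases S')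
  have d: "(t, U, D) \<in> flat_data" "(t', U', D') \<in> flat_data" and t: "t \<in> T" "t' \<in> T" "t' \<in> over"
    using S e by (auto simp: flat_monads_def flat_data_def)
  have f: "fst (mon_of S) = t" "fst (mon_of S') = t'" by (simp_all add: e mon_of_def)
  \<comment> \<open>A homomorphism is transposed back to a 2-cell
    \<open>E(j,t) \<Rightarrow> E(j,t')\<close>, which is \<open>E(j,\<tau>)\<close> for some
    \<open>\<tau>\<close> because \<open>E(j,-)\<close> is full.\<close>
  have h: "\<psi> \<in> mon_hom S S' ` flat_hom S S'" if "is_monoid_hom (multicat_of X j) (mon_of S) (mon_of S') \<psi>" for \<psi>
  proof -
    have "\<psi> \<in> cells X (rep X one j # [rep X j t]) (rep X one t')"
      using that t by (auto simp: is_monoid_hom_def e mon_of_def multicat_of_def T_simps)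
    then obtain \<phi> where p: "\<phi> \<in> cells X [rep X j t] (rep X j t')" "transpose X j t' \<phi> = \<psi>"
      using transpose_surj[OF t(2)] by blast
    then obtain \<tau> where \<tau>: "\<tau> \<in> cells X [rep X one t] (rep X one t')" "rep_right X j t t' \<tau> = \<phi>"
      using rep_right_surj[OF t(1,2)] by blast
    then have "\<psi> = mon_hom S S' \<tau>" using p by (simp add: e mon_hom_def)
    with that mon_hom_law[OF d \<tau>(1)] show ?thesis by (simp add: e)
  qed
  have h': "is_monoid_hom (multicat_of X j) (mon_of S) (mon_of S') (mon_hom S S' \<tau>)" if "\<tau> \<in> flat_hom S S'" for \<tau>
    using that mon_hom_law[OF d, of \<tau>] by (simp add: e flat_hom_def)
  have "unary_to_tight X j t t' (mon_hom S S' \<tau>) = \<tau>" if "\<tau> \<in> flat_hom S S'" for \<tau>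
  proof -
    have \<tau>: "\<tau> \<in> cells X [rep X one t] (rep X one t')" using that by (simp add: flat_hom_def e)
    have "untranspose X j [t] t' (mon_hom S S' \<tau>) = rep_right X j t t' \<tau>"
      using untranspose_simps(2)[OF t(2) rep_right_cells(1)[OF over_simps(1) t(1,2) \<tau>]] by (simp add: mon_hom_def e)
    then show ?thesis unfolding unary_to_tight_def
      using \<tau> rep_right_inj[OF t(1,2) _ \<tau>] t by (intro the_equality) (auto simp: T_simps)
  qed
  with h h' show "Hom (Mon (multicat_of X j)) (mon_of S) (mon_of S') = mon_hom S S' ` flat_hom S S' \<and>
      (\<forall>\<tau>\<in>flat_hom S S'. farr (Mon_forget X j) (mon_of S) (mon_of S') (mon_hom S S' \<tau>) = \<tau>)"
    using f by (auto simp: Mon_def Mon_forget_def)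
next
  fix S S' S'' \<tau> \<sigma>
  assume S: "S \<in> flat_monads" "S' \<in> flat_monads" "S'' \<in> flat_monads"
    and "\<tau> \<in> flat_hom S S'" "\<sigma> \<in> flat_hom S' S''"
  then have \<tau>: "\<tau> \<in> cells X [rep X one (fst S)] (rep X one (fst S'))"
    and \<sigma>: "\<sigma> \<in> cells X [rep X one (fst S')] (rep X one (fst S''))"
    by (auto simp: flat_hom_def)
  let ?s = "fst S" and ?s' = "fst S'" and ?s'' = "fst S''"
  have t: "?s \<in> T" "?s' \<in> T" "?s'' \<in> T" "?s \<in> over" "?s' \<in> over" "?s'' \<in> over"
    using S by (auto simp: flat_monads_def flat_data_def)
  have f: "fst (mon_of S) = fst S" for S by (simp add: mon_of_def split: prod.splits)
  note r = rep_right_cells(1)[OF over_simps(1) t(1,2) \<tau>] and r' = rep_right_cells(1)[OF over_simps(1) t(2,3) \<sigma>]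
  \<comment> \<open>Multimorphisms compose by composing their untransposed forms, so functoriality
    of \<open>E(j,-)\<close> is what remains.\<close>
  have "sub (rep_right X j ?s' ?s'' \<sigma>) [rep_right X j ?s ?s' \<tau>] = rep_right X j ?s ?s'' (vcomp X \<sigma> \<tau>)"
    using sharp_comp[OF t(4-6) nullary_K[OF t(1,2) \<tau>] nullary_K[OF t(2,3) \<sigma>]] nullary_vcomp[OF t(1-3) \<tau> \<sigma>]
      rep_right_sharp t by simp
  then show "Comp (Mon (multicat_of X j)) (mon_of S) (mon_of S') (mon_of S'') (mon_hom S' S'' \<sigma>) (mon_hom S S' \<tau>)
    = mon_hom S S'' (vcomp X \<sigma> \<tau>)"
    using untranspose_simps(2)[OF t(2) r] untranspose_simps(2)[OF t(3) r'] ccomp_A[OF r' t(6)]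
    by (simp add: Mon_def multicat_of_def mon_hom_def f)
qed

end

theorem corollary4p27:
  fixes X :: "('o, 't, 'l, 'c) vdc" and j :: 't and A E :: 'o
  assumes "virtual_equipment X"
    and "j \<in> tights X A E"
    and "dense X j"
  shows "isomorphic_over (tight_hom_cat X A E)
           (Mon (multicat_of X j)) (Mon_forget X j)
           (skew_Mon (skew_multicat_of X j)) skew_Mon_forget
       \<and> isomorphic_over (tight_hom_cat X A E)
           (skew_Mon (skew_multicat_of X j)) skew_Mon_forget
           (RMnd X j) RMnd_forget"
proof -
  interpret virtual_equipment X by (rule assms(1))
  interpret dense_tight_cell X j A E
    by unfold_locales (use assms(2,3) in simp_all)
  show ?thesis
    using presents_isomorphic_over[OF mon_presents skew_presents]
      presents_isomorphic_over[OF skew_presents rmnd_presents] by blast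
qed

end
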